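(* Let $\mathcal{X}$ be a measure space, $K=K(y,\mathrm{d}x)$ a kernel on $\mathcal{X}$ (a measure on $\mathcal{X}$ depending measurably on $y\in\mathcal{X}$), $\nu$ a finite measure on $\mathcal{X}$, and $\sigma:\mathbb{R}_+\to\mathbb{R}_+$ strictly monotonically increasing. Let $\mathcal{L}_K$ be defined by $$\mathcal{L}_K\mu=\int_{y\in\mathcal{X}}K(y,\mathrm{d}x)\,\mathrm{d}\mu(y)-\int_{y\in\mathcal{X}}K(x,\mathrm{d}y)\,\mathrm{d}\mu(x),$$ and let $f_\infty$ be such that $\sigma(f_\infty)\nu$ is $K$-stationary, i.e. $\mathcal{L}_K(\sigma(f_\infty)\nu)=0$. Let $\mu_t=f_t\nu\ge0$, $f_t\in L^\infty$, be any solution to the nonlinear scattering equation $$\frac{\partial\mu}{\partial t}=\mathcal{L}_K\big(\sigma(f)\,\nu\big),\qquad f:=\frac{\mathrm{d}\mu}{\mathrm{d}\nu},\qquad f_{|t=0}=f_0.$$ (1) For every $C^2$ function $\Phi:\mathbb{R}_+\to\mathbb{R}_+$ with $\Phi(1)=\Phi'(1)=0$ and $\Phi''\ge0$, the functional $$H_\Phi(f|f_\infty):=\int_{\mathcal{X}}\left(\int_{f_\infty(x)}^{f(x)}\Phi'\left(\frac{\sigma(s)}{\sigma(f_\infty(x))}\right)\mathrm{d}s\right)\mathrm{d}\nu(x)$$ satisfies, in the sense of distributions, with $h:=\sigma(f_t)/\sigma(f_\infty)$, $$\frac{\mathrm{d}}{\mathrm{d}t}H_\Phi(f_t|f_\infty)=-\iint_{\mathcal{X}\times\mathcal{X}}\Big[(h(y)-h(x))\Phi'(h(y))+\Phi(h(x))-\Phi(h(y))\Big]K(x,\mathrm{d}y)\,\sigma(f_\infty(x))\,\mathrm{d}\nu(x)\le0.$$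 (2) If furthermore $\nu$ is $K$-reversible, i.e. $K(x,\mathrm{d}y)\,\mathrm{d}\nu(x)=K(y,\mathrm{d}x)\,\mathrm{d}\nu(y)$, then for every $C^2$ function $\Psi:\mathbb{R}\to\mathbb{R}_+$ with $\Psi'(0)=0$ and $\Psi''\ge0$, the functional $$N_\Psi(f|f_\infty):=\int_{\mathcal{X}}\left(\int_{f_\infty(x)}^{f(x)}\Psi'\big(\sigma(s)-\sigma(f_\infty(x))\big)\,\mathrm{d}s\right)\mathrm{d}\nu(x)$$ satisfies, with $g:=\sigma(f_t)-\sigma(f_\infty)$, $$\frac{\mathrm{d}}{\mathrm{d}t}N_\Psi(f_t|f_\infty)=-\iint_{\mathcal{X}\times\mathcal{X}}\Big[(g(y)-g(x))\Psi'(g(y))+\Psi(g(x))-\Psi(g(y))\Big]K(x,\mathrm{d}y)\,\mathrm{d}\nu(x)\le0.$$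
   Context: Standing assumption: there are no problems of integrability, i.e. all integrals converge and Fubini's theorem applies whenever needed. It is understood that $\sigma(f_\infty)>0$, so that the quotient $\sigma(f)/\sigma(f_\infty)$ is defined. In the definition of $\mathcal{L}_K\mu$, both terms are measures in the variable $x$. $K$-reversibility is an equality of measures on $\mathcal{X}\times\mathcal{X}$. In part (1), $\sigma(f_\infty)\nu$ is not assumed $K$-reversible. *)

theory Defs
  imports "HOL-Analysis.Analysis"
begin

text \<open>A kernel is an arbitrary (not necessarily finite) measure depending measurably on a point.\<close>

definition measure_kernel :: "'a measure \<Rightarrow> ('a \<Rightarrow> 'a measure) \<Rightarrow> bool" where
  "measure_kernel M K \<longleftrightarrow>
     (\<forall>y\<in>space M. sets (K y) = sets M) \<and>
     (\<forall>A\<in>sets M. (\<lambda>y. emeasure (K y) A) \<in> borel_measurable M)"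

text \<open>The measure \<open>K(x,dy) d\<mu>(x)\<close> on the product space. The set function below is a measure as
  soon as \<open>K x\<close> is finite for \<open>\<mu>\<close>-almost every \<open>x\<close>.\<close>

definition kernel_prod :: "'a measure \<Rightarrow> ('a \<Rightarrow> 'a measure) \<Rightarrow> ('a \<times> 'a) measure" where
  "kernel_prod \<mu> K =
     measure_of (space \<mu> \<times> space \<mu>) (sets (\<mu> \<Otimes>\<^sub>M \<mu>))
       (\<lambda>B. \<integral>\<^sup>+x. emeasure (K x) (Pair x -` B) \<partial>\<mu>)"

definition reversible :: "('a \<Rightarrow> 'a measure) \<Rightarrow> 'a measure \<Rightarrow> bool" where
  "reversible K \<mu> \<longleftrightarrow>
     kernel_prod \<mu> K = distr (kernel_prod \<mu> K) (\<mu> \<Otimes>\<^sub>M \<mu>) (\<lambda>(x, y). (y, x))"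

definition total_rate :: "('a \<Rightarrow> 'a measure) \<Rightarrow> 'a measure \<Rightarrow> ennreal" where
  "total_rate K \<mu> = (\<integral>\<^sup>+x. emeasure (K x) (space \<mu>) \<partial>\<mu>)"

text \<open>The signed measure \<open>L\<^sub>K \<mu>\<close>, evaluated at a measurable set \<open>A\<close>: the gain measure
  \<open>A \<mapsto> \<integral> K(y,A) d\<mu>(y)\<close> minus the loss measure, which has density \<open>x \<mapsto> K(x,X)\<close> with respect
  to \<open>\<mu>\<close>. Both have total mass \<open>total_rate K \<mu>\<close>, so the difference is meaningful when that is
  finite.\<close>

definition scattering :: "('a \<Rightarrow> 'a measure) \<Rightarrow> 'a measure \<Rightarrow> 'a set \<Rightarrow> real" where
  "scattering K \<mu> A =
     enn2real (\<integral>\<^sup>+y. emeasure (K y) A \<partial>\<mu>) -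
     enn2real (\<integral>\<^sup>+x\<in>A. emeasure (K x) (space \<mu>) \<partial>\<mu>)"

definition stationary :: "('a \<Rightarrow> 'a measure) \<Rightarrow> 'a measure \<Rightarrow> bool" where
  "stationary K \<mu> \<longleftrightarrow> total_rate K \<mu> < \<infinity> \<and> (\<forall>A\<in>sets \<mu>. scattering K \<mu> A = 0)"

text \<open>Solutions on \<open>[0,T)\<close>, where \<open>T = \<infinity>\<close> is allowed. Writing \<open>\<mu>\<^sub>t = f\<^sub>t \<nu>\<close>, the evolution equation
  \<open>\<partial>\<^sub>t \<mu> = L\<^sub>K(\<sigma>(f) \<nu>)\<close> with its initial condition is understood, on each measurable set \<open>A\<close>, in
  the time-integrated form \<open>\<mu>\<^sub>t(A) = \<mu>\<^sub>0(A) + \<integral>\<^sub>0\<^sup>t L\<^sub>K(\<sigma>(f\<^sub>s) \<nu>)(A) ds\<close>. The condition on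
  \<open>total_rate\<close> says that this integral converges. The representatives
  \<open>f\<^sub>t\<close> are taken nonnegative everywhere, because \<open>\<sigma>\<close> is only meaningful on \<open>[0,\<infinity>)\<close>.\<close>

definition scattering_solution ::
    "('a \<Rightarrow> 'a measure) \<Rightarrow> 'a measure \<Rightarrow> (real \<Rightarrow> real) \<Rightarrow> ereal \<Rightarrow>
     ('a \<Rightarrow> real) \<Rightarrow> (real \<Rightarrow> 'a \<Rightarrow> real) \<Rightarrow> bool" where
  "scattering_solution K \<nu> \<sigma> T f0 f \<longleftrightarrow>
     (\<lambda>(t, x). f t x)
       \<in> borel_measurable (restrict_space borel {t. 0 \<le> t \<and> ereal t < T} \<Otimes>\<^sub>M \<nu>) \<and>
     (\<forall>t. 0 \<le> t \<and> ereal t < T \<longrightarrow>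
        (\<forall>x\<in>space \<nu>. 0 \<le> f t x) \<and>
        (\<exists>C. AE x in \<nu>. f t x \<le> C) \<and>
        (\<integral>\<^sup>+s\<in>{0..t}. total_rate K (density \<nu> (\<lambda>x. ennreal (\<sigma> (f s x)))) \<partial>lborel) < \<infinity> \<and>
        (\<forall>A\<in>sets \<nu>.
           measure (density \<nu> (\<lambda>x. ennreal (f t x))) A =
           measure (density \<nu> (\<lambda>x. ennreal (f0 x))) A +
           (LINT s:{0..t}|lborel. scattering K (density \<nu> (\<lambda>x. ennreal (\<sigma> (f s x)))) A))) \<and>
     f0 \<in> borel_measurable \<nu> \<and>
     (AE x in \<nu>. f 0 x = f0 x)"

text \<open>\<open>d\<Phi>\<close> and \<open>dd\<Phi>\<close> are the first two derivatives (one-sided at end points) of the \<open>C\<^sup>2\<close> function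
  \<open>\<Phi>\<close> on \<open>S\<close>.\<close>

definition C2_on ::
    "real set \<Rightarrow> (real \<Rightarrow> real) \<Rightarrow> (real \<Rightarrow> real) \<Rightarrow> (real \<Rightarrow> real) \<Rightarrow> bool" where
  "C2_on S \<Phi> d\<Phi> dd\<Phi> \<longleftrightarrow>
     (\<forall>r\<in>S. (\<Phi> has_real_derivative d\<Phi> r) (at r within S)) \<and>
     (\<forall>r\<in>S. (d\<Phi> has_real_derivative dd\<Phi> r) (at r within S)) \<and>
     continuous_on S dd\<Phi>"

definition test_function :: "real set \<Rightarrow> (real \<Rightarrow> real) \<Rightarrow> bool" where
  "test_function S \<phi> \<longleftrightarrow>
     (\<forall>k. ((deriv ^^ k) \<phi>) differentiable_on UNIV) \<and>
     (\<exists>C. compact C \<and> C \<subseteq> S \<and> (\<forall>t. t \<notin> C \<longrightarrow> \<phi> t = 0))"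

text \<open>\<open>du\<close> is the derivative of \<open>u\<close> in the sense of distributions on the open set \<open>S\<close>, both functions
  being locally integrable there.\<close>

definition has_distr_deriv :: "(real \<Rightarrow> real) \<Rightarrow> (real \<Rightarrow> real) \<Rightarrow> real set \<Rightarrow> bool" where
  "has_distr_deriv u du S \<longleftrightarrow>
     (\<forall>C. compact C \<and> C \<subseteq> S \<longrightarrow> set_integrable lborel C u \<and> set_integrable lborel C du) \<and>
     (\<forall>\<phi>. test_function S \<phi> \<longrightarrow>
        (LINT t:S|lborel. u t * deriv \<phi> t) = - (LINT t:S|lborel. du t * \<phi> t))"

text \<open>The integrands (in \<open>x\<close>) of the two functionals, as functions of the derivatives \<open>d\<Phi>\<close> and
  \<open>d\<Psi>\<close>. The inner integrals are oriented: they change sign when \<open>f x < finf x\<close>.\<close>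

definition H_density ::
    "(real \<Rightarrow> real) \<Rightarrow> (real \<Rightarrow> real) \<Rightarrow> ('a \<Rightarrow> real) \<Rightarrow> ('a \<Rightarrow> real) \<Rightarrow> 'a \<Rightarrow> real" where
  "H_density \<sigma> d\<Phi> finf f x =
     (LBINT s=ereal (finf x)..ereal (f x). d\<Phi> (\<sigma> s / \<sigma> (finf x)))"

definition H_functional ::
    "'a measure \<Rightarrow> (real \<Rightarrow> real) \<Rightarrow> (real \<Rightarrow> real) \<Rightarrow> ('a \<Rightarrow> real) \<Rightarrow> ('a \<Rightarrow> real) \<Rightarrow> real" where
  "H_functional \<nu> \<sigma> d\<Phi> finf f = (\<integral>x. H_density \<sigma> d\<Phi> finf f x \<partial>\<nu>)"

definition N_density ::
    "(real \<Rightarrow> real) \<Rightarrow> (real \<Rightarrow> real) \<Rightarrow> ('a \<Rightarrow> real) \<Rightarrow> ('a \<Rightarrow> real) \<Rightarrow> 'a \<Rightarrow> real" where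
  "N_density \<sigma> d\<Psi> finf f x =
     (LBINT s=ereal (finf x)..ereal (f x). d\<Psi> (\<sigma> s - \<sigma> (finf x)))"

definition N_functional ::
    "'a measure \<Rightarrow> (real \<Rightarrow> real) \<Rightarrow> (real \<Rightarrow> real) \<Rightarrow> ('a \<Rightarrow> real) \<Rightarrow> ('a \<Rightarrow> real) \<Rightarrow> real" where
  "N_functional \<nu> \<sigma> d\<Psi> finf f = (\<integral>x. N_density \<sigma> d\<Psi> finf f x \<partial>\<nu>)"

definition dissipation ::
    "('a \<times> 'a) measure \<Rightarrow> (real \<Rightarrow> real) \<Rightarrow> (real \<Rightarrow> real) \<Rightarrow> ('a \<Rightarrow> real) \<Rightarrow> real" where
  "dissipation J \<Phi> d\<Phi> h =
     (\<integral>(x, y). (h y - h x) * d\<Phi> (h y) + \<Phi> (h x) - \<Phi> (h y) \<partial>J)"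

text \<open>Absolute convergence of each term of the dissipation integral, also integrated over compact
  time intervals in \<open>(0,T)\<close>.\<close>

definition dissipation_converges ::
    "ereal \<Rightarrow> ('a \<times> 'a) measure \<Rightarrow> (real \<Rightarrow> real) \<Rightarrow> (real \<Rightarrow> real) \<Rightarrow>
     (real \<Rightarrow> 'a \<Rightarrow> real) \<Rightarrow> bool" where
  "dissipation_converges T J \<Phi> d\<Phi> h \<longleftrightarrow>
     (\<forall>a b. 0 < a \<and> a \<le> b \<and> ereal b < T \<longrightarrow>
        set_integrable (lborel \<Otimes>\<^sub>M J) ({a..b} \<times> space J) (\<lambda>(t, x, y). h t y * d\<Phi> (h t y)) \<and>
        set_integrable (lborel \<Otimes>\<^sub>M J) ({a..b} \<times> space J) (\<lambda>(t, x, y). h t x * d\<Phi> (h t y)) \<and>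
        set_integrable (lborel \<Otimes>\<^sub>M J) ({a..b} \<times> space J) (\<lambda>(t, x, y). \<Phi> (h t x)) \<and>
        set_integrable (lborel \<Otimes>\<^sub>M J) ({a..b} \<times> space J) (\<lambda>(t, x, y). \<Phi> (h t y)))"

end

theory Submission
  imports Defs
begin

text \<open>Both functionals obey the same scheme. Let \<open>J\<close> be the measure \<open>K(x,dy) \<rho>(dx)\<close>, with
  \<open>\<rho> = \<sigma>(f\<^sub>\<infinity>)\<nu>\<close> in part (1) and \<open>\<rho> = \<nu>\<close> in part (2). Stationarity, respectively reversibility, says
  that the two marginals of \<open>J\<close> agree, so that the equation takes the weak form
  \<open>\<integral>\<psi> (f\<^sub>t - f\<^sub>s) d\<nu> = \<integral>\<^sub>s\<^sup>t \<integral> \<psi>(y) (w\<^sub>\<tau>(x) - w\<^sub>\<tau>(y)) dJ d\<tau>\<close> for bounded \<open>\<psi>\<close>, where \<open>w\<close> is \<open>h\<close> or \<open>g\<close>.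
  The integrand of the functional is convex in \<open>f\<close>, with subgradient \<open>\<Phi>'(w)\<close> (which may jump, as
  \<open>\<sigma>\<close> need not be continuous). After truncating the subgradient, the convexity inequality can be
  tested with \<open>\<psi> = \<Phi>'(w\<^sub>s)\<close>; averaging it over \<open>s\<close> for small increments \<open>t - s\<close> of either sign
  gives two opposite inequalities in the limit, because translations are continuous in \<open>L\<^sup>1\<close>. Hence
  \<open>H(b) - H(a) = \<integral>\<^sub>a\<^sup>b \<integral> \<Phi>'(w(y)) (w(x) - w(y)) dJ dt\<close>. The remaining terms \<open>\<Phi>(w(x)) - \<Phi>(w(y))\<close> of
  the dissipation integrate to zero since the marginals agree.\<close>

section \<open>Continuity of translations in \<open>L\<^sup>1\<close>\<close>

text \<open>In the convexity inequality the subgradient is therefore frozen at one time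
  \<open>s\<close>: it is then a function of the point alone, which the integrated equation accepts
  as a test function, for increments to either side of \<open>s\<close>. What appears is the
  subgradient at \<open>s\<close> against the flux at neighbouring times; what is wanted has both at
  \<open>s\<close>. After averaging in \<open>s\<close> the discrepancy is a translation error, and
  continuity of translations makes it o(h). Clipping is there because the subgradient may be
  unbounded while test functions must be bounded; it keeps monotonicity, hence convexity.
  \<open>K x\<close> may be infinite. Stationarity provides a finite weighted rate, from which
  follow finiteness of \<open>K x\<close> almost everywhere and sigma-finiteness of J, in both
  parts. Part (2) uses stationarity once more: the equation yields \<sigma>(f), and the same weak
  expression for the stationary density is zero, so g may take its place.\<close>

lemma emeasure_inner_compact_outer_open:
  fixes A :: "'a::euclidean_space set"
  assumes A: "A \<in> sets borel" "emeasure lborel A < \<infinity>" and "0 < e"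
  obtains K U where "compact K" "open U" "K \<subseteq> A" "A \<subseteq> U" "emeasure lborel (U - K) < ennreal e"
proof -
  have AL: "A \<in> sets lebesgue" using A by simp
  from \<open>0 < e\<close> have e3: "e/3 > 0" by simp
  obtain U where U: "open U" "A \<subseteq> U" "emeasure lebesgue (U - A) < ennreal (e/3)"
    using sets_lebesgue_outer_open[OF AL e3] by metis
  obtain C where C: "closed C" "C \<subseteq> A" "emeasure lebesgue (A - C) < ennreal (e/3)"
    using sets_lebesgue_inner_closed[OF AL e3] by metis
  have [measurable]: "A \<in> sets borel" "U \<in> sets borel" "C \<in> sets borel"
    using A U C by auto
  \<comment> \<open>The part of \<open>C\<close> lost when it is cut down to a ball. Since
    \<open>C\<close> lies in \<open>A\<close>, which has finite measure, these pieces shrink to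
    measure zero.\<close>
  define D where "D n = C - cball 0 (real n)" for n
  have D[measurable]: "D n \<in> sets borel" for n by (auto simp: D_def)
  have "(\<lambda>n. emeasure lborel (D n)) \<longlonglongrightarrow> emeasure lborel (\<Inter>n. D n)"
  proof (rule Lim_emeasure_decseq)
    show "decseq D" by (auto simp: decseq_def D_def)
    show "emeasure lborel (D i) \<noteq> \<infinity>" for i
    proof -
      have "emeasure lborel (D i) \<le> emeasure lborel A"
        using C by (intro emeasure_mono) (auto simp: D_def)
      then show ?thesis using A by auto
    qed
  qed auto
  moreover have "(\<Inter>n. D n) = {}"
    using real_arch_simple by (fastforce simp: D_def)
  ultimately have "(\<lambda>n. emeasure lborel (D n)) \<longlonglongrightarrow> 0" by simp
  then have "eventually (\<lambda>n. emeasure lborel (D n) < ennreal (e/3)) sequentially"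
    using e3 by (intro order_tendstoD) auto
  then obtain n where n: "emeasure lborel (D n) < ennreal (e/3)"
    by (auto simp: eventually_sequentially)
  define K where "K = C \<inter> cball 0 (real n)"
  have "compact K" using C by (auto simp: K_def intro: closed_Int_compact)
  have [measurable]: "K \<in> sets borel" by (auto simp: K_def)
  have "emeasure lborel (U - K) \<le> emeasure lborel ((U - A) \<union> (A - C) \<union> D n)"
    by (intro emeasure_mono) (auto simp: K_def D_def)
  also have "\<dots> \<le> emeasure lborel ((U - A) \<union> (A - C)) + emeasure lborel (D n)"
    by (intro emeasure_subadditive) auto
  also have "\<dots> \<le> emeasure lborel (U - A) + emeasure lborel (A - C) + emeasure lborel (D n)"
    by (intro add_right_mono emeasure_subadditive) auto
  also have "\<dots> < ennreal (e/3) + ennreal (e/3) + ennreal (e/3)"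
    using U C n by (intro add_strict_mono) auto
  also have "\<dots> = ennreal e" using \<open>0 < e\<close> by (simp flip: ennreal_plus)
  finally show ?thesis using that[of K U] \<open>compact K\<close> U C by (auto simp: K_def)
qed

lemma nn_integral_lborel_translation:
  fixes f :: "real \<Rightarrow> ennreal"
  assumes "f \<in> borel_measurable borel"
  shows "(\<integral>\<^sup>+x. f (x + r) \<partial>lborel) = (\<integral>\<^sup>+x. f x \<partial>lborel)"
  using nn_integral_real_affine[OF assms, of 1 r] by (simp add: add.commute)

text \<open>A small enough shift keeps the points of the compact set \<open>K\<close> inside
  \<open>U\<close>. The two indicators can then differ only if \<open>x\<close> or
  \<open>x + r\<close> lies in \<open>U - K\<close>, whose measure is small and invariant under
  translation.\<close>

lemma L1_translation_indicator:
  assumes A: "A \<in> sets borel" "emeasure lborel A < \<infinity>"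
  shows "((\<lambda>r. \<integral>\<^sup>+x. ennreal \<bar>indicator A (x + r) - indicator A (x::real)\<bar> \<partial>lborel) \<longlongrightarrow> 0) (at 0)"
proof (rule order_tendstoI)
  fix e :: ennreal assume "0 < e"
  obtain e' where e': "0 < e'" "ennreal e' < e"
    using \<open>0 < e\<close> by (metis ennreal_less_zero_iff ennreal_zero_less_top dense top.not_eq_extremum ennreal_cases ennreal_less_top less_le_trans order_less_le)
  obtain K U where KU: "compact K" "open U" "K \<subseteq> A" "A \<subseteq> U" "emeasure lborel (U - K) < ennreal (e'/2)"
    using emeasure_inner_compact_outer_open[OF A, of "e'/2"] e' by auto
  obtain d where d: "d > 0" "(\<Union>x\<in>K. ball x d) \<subseteq> U"
    using compact_subset_open_imp_ball_epsilon_subset[of K U] KU by auto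
  have [measurable]: "K \<in> sets borel" "U \<in> sets borel" "A \<in> sets borel"
    using KU A by (auto simp: compact_imp_closed)
  have "(\<integral>\<^sup>+x. ennreal \<bar>indicator A (x + r) - indicator A (x::real)\<bar> \<partial>lborel) < e" if "\<bar>r\<bar> < d" for r
  proof -
    have mem: "x + r \<in> U \<and> x - r \<in> U" if "x \<in> K" for x
      using d \<open>\<bar>r\<bar> < d\<close> that by (auto simp: dist_real_def subset_eq)
    have "(\<integral>\<^sup>+x. ennreal \<bar>indicator A (x + r) - indicator A (x::real)\<bar> \<partial>lborel)
      \<le> (\<integral>\<^sup>+x. indicator (U - K) x + indicator (U - K) (x + r) \<partial>lborel)"
    proof (intro nn_integral_mono)
      fix x
      show "ennreal \<bar>indicator A (x + r) - indicator A (x::real)\<bar> \<le> indicator (U - K) x + indicator (U - K) (x + r)"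
        using mem[of x] mem[of "x + r"] KU(3,4) by (auto simp: indicator_def)
    qed
    also have "\<dots> = (\<integral>\<^sup>+x. indicator (U - K) x \<partial>lborel) + (\<integral>\<^sup>+x. indicator (U - K) (x + r) \<partial>lborel)"
      by (intro nn_integral_add) auto
    also have "\<dots> = emeasure lborel (U - K) + emeasure lborel (U - K)"
      by (subst nn_integral_lborel_translation) auto
    also have "\<dots> < ennreal (e'/2) + ennreal (e'/2)"
      using KU by (intro add_strict_mono) auto
    also have "\<dots> = ennreal e'" using e' by (simp flip: ennreal_plus)
    finally show ?thesis using e' by auto
  qed
  then show "eventually (\<lambda>r. (\<integral>\<^sup>+x. ennreal \<bar>indicator A (x + r) - indicator A (x::real)\<bar> \<partial>lborel) < e) (at 0)"
    using d by (auto simp: eventually_at dist_real_def)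
qed auto

text \<open>Density argument: true for indicators, stable under sums, and stable under L1 limits
  because the approximation error of the shifted function equals that of the function
  itself.\<close>

lemma L1_translation:
  fixes g :: "real \<Rightarrow> real"
  assumes "integrable lborel g"
  shows "((\<lambda>r. \<integral>\<^sup>+x. ennreal \<bar>g (x + r) - g x\<bar> \<partial>lborel) \<longlongrightarrow> 0) (at 0)"
  using assms
proof (induction rule: integrable_induct)
  case (base A c)
  have [measurable]: "A \<in> sets borel" using base by simp
  have "(\<integral>\<^sup>+x. ennreal \<bar>indicat_real A (x + r) *\<^sub>R c - indicat_real A x *\<^sub>R c\<bar> \<partial>lborel)
    = ennreal \<bar>c\<bar> * (\<integral>\<^sup>+x. ennreal \<bar>indicator A (x + r) - indicator A x\<bar> \<partial>lborel)" for r
    by (subst nn_integral_cmult[symmetric])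
       (auto intro!: nn_integral_cong simp flip: ennreal_mult abs_mult simp: algebra_simps)
  moreover have "((\<lambda>r. ennreal \<bar>c\<bar> * (\<integral>\<^sup>+x. ennreal \<bar>indicator A (x + r) - indicator A x\<bar> \<partial>lborel)) \<longlongrightarrow> ennreal \<bar>c\<bar> * 0) (at 0)"
    using base by (intro ennreal_tendsto_cmult L1_translation_indicator) auto
  ultimately show ?case by simp
next
  case (add f g)
  have [measurable]: "f \<in> borel_measurable borel" "g \<in> borel_measurable borel"
    using add by auto
  show ?case
  proof (rule tendsto_sandwich[OF always_eventually always_eventually tendsto_const])
    show "((\<lambda>r. (\<integral>\<^sup>+x. ennreal \<bar>f (x + r) - f x\<bar> \<partial>lborel) + (\<integral>\<^sup>+x. ennreal \<bar>g (x + r) - g x\<bar> \<partial>lborel)) \<longlongrightarrow> 0) (at 0)"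
      using tendsto_add[OF add.IH] by simp
    show "\<forall>r. (\<integral>\<^sup>+ x. ennreal \<bar>f (x + r) + g (x + r) - (f x + g x)\<bar> \<partial>lborel)
      \<le> (\<integral>\<^sup>+x. ennreal \<bar>f (x + r) - f x\<bar> \<partial>lborel) + (\<integral>\<^sup>+x. ennreal \<bar>g (x + r) - g x\<bar> \<partial>lborel)"
      by (subst nn_integral_add[symmetric])
         (auto intro!: nn_integral_mono ennreal_leI simp flip: ennreal_plus)
  qed auto
next
  case (lim f s)
  have [measurable]: "f \<in> borel_measurable borel" "s i \<in> borel_measurable borel" for i
    using borel_measurable_integrable[OF lim.hyps(1)[of i]] borel_measurable_integrable[OF lim.hyps(4)] by simp_all
  have "(\<lambda>i. \<integral>\<^sup>+x. norm (f x - s i x) \<partial>lborel) \<longlonglongrightarrow> 0"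
  proof (rule nn_integral_dominated_convergence_norm[where w = "\<lambda>x. 2 * norm (f x)"])
    have "integrable lborel (\<lambda>x. 2 * norm (f x))" using lim.hyps(4) by simp
    then show "(\<integral>\<^sup>+x. ennreal (2 * norm (f x)) \<partial>lborel) < \<infinity>"
      unfolding integrable_iff_bounded by (auto simp: abs_mult)
  qed (use lim in auto)
  then have "(\<lambda>i. \<integral>\<^sup>+x. norm (s i x - f x) \<partial>lborel) \<longlonglongrightarrow> 0"
    by (subst norm_minus_commute)
  then have L: "(\<lambda>i. 2 * (\<integral>\<^sup>+x. norm (s i x - f x) \<partial>lborel)) \<longlonglongrightarrow> 2 * 0"
    by (intro ennreal_tendsto_cmult) auto
  show ?case
  proof (rule order_tendstoI)
    fix e :: ennreal assume "0 < e"
    \<comment> \<open>\<open>e1\<close> is the allowance for the approximating function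
      \<open>s i\<close>, and \<open>e - e1\<close> the one for its two distances to
      \<open>f\<close>.\<close>
    then obtain e1 where e1: "0 < e1" "e1 < e" using dense by blast
    have "eventually (\<lambda>i. 2 * (\<integral>\<^sup>+x. norm (s i x - f x) \<partial>lborel) < e - e1) sequentially"
      using e1 by (intro order_tendstoD(2)[OF L]) (auto simp: diff_gr0_ennreal)
    then obtain i where i: "2 * (\<integral>\<^sup>+x. norm (s i x - f x) \<partial>lborel) < e - e1"
      by (auto simp: eventually_sequentially)
    have "eventually (\<lambda>r. (\<integral>\<^sup>+x. ennreal \<bar>s i (x + r) - s i x\<bar> \<partial>lborel) < e1) (at 0)"
      using e1 by (intro order_tendstoD(2)[OF lim.IH[of i]])
    then show "eventually (\<lambda>r. (\<integral>\<^sup>+x. ennreal \<bar>f (x + r) - f x\<bar> \<partial>lborel) < e) (at 0)"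
    proof eventually_elim
      case (elim r)
      have "(\<integral>\<^sup>+x. ennreal \<bar>f (x + r) - f x\<bar> \<partial>lborel)
        \<le> (\<integral>\<^sup>+x. ennreal \<bar>s i (x + r) - s i x\<bar> + (ennreal (norm (s i (x + r) - f (x + r))) + ennreal (norm (s i x - f x))) \<partial>lborel)"
        by (intro nn_integral_mono) (auto intro!: ennreal_leI simp flip: ennreal_plus)
      also have "\<dots> = (\<integral>\<^sup>+x. ennreal \<bar>s i (x + r) - s i x\<bar> \<partial>lborel) + ((\<integral>\<^sup>+x. norm (s i (x + r) - f (x + r)) \<partial>lborel) + (\<integral>\<^sup>+x. norm (s i x - f x) \<partial>lborel))"
        by (simp add: nn_integral_add)
      also have "(\<integral>\<^sup>+x. norm (s i (x + r) - f (x + r)) \<partial>lborel) = (\<integral>\<^sup>+x. norm (s i x - f x) \<partial>lborel)"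
        using nn_integral_lborel_translation[of "\<lambda>x. ennreal (norm (s i x - f x))" r] by simp
      also have "(\<integral>\<^sup>+x. norm (s i x - f x) \<partial>lborel) + (\<integral>\<^sup>+x. norm (s i x - f x) \<partial>lborel) = 2 * (\<integral>\<^sup>+x. norm (s i x - f x) \<partial>lborel)"
        by (simp add: mult_2)
      also have "(\<integral>\<^sup>+x. ennreal \<bar>s i (x + r) - s i x\<bar> \<partial>lborel) + 2 * (\<integral>\<^sup>+x. norm (s i x - f x) \<partial>lborel) < e1 + (e - e1)"
        using elim i by (intro add_strict_mono)
      also have "\<dots> = e" using e1 by (simp add: add_diff_inverse_ennreal less_imp_le)
      finally show ?case .
    qed
  qed auto
qed

lemma nn_integral_pair_translation:
  fixes f :: "real \<times> 'b \<Rightarrow> ennreal"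
  assumes "sigma_finite_measure J"
  assumes [measurable]: "f \<in> borel_measurable (lborel \<Otimes>\<^sub>M J)"
  shows "(\<integral>\<^sup>+p. f (fst p + r, snd p) \<partial>(lborel \<Otimes>\<^sub>M J)) = (\<integral>\<^sup>+p. f p \<partial>(lborel \<Otimes>\<^sub>M J))"
proof -
  interpret J: sigma_finite_measure J by fact
  interpret P: pair_sigma_finite lborel J ..
  have "(\<integral>\<^sup>+p. f (fst p + r, snd p) \<partial>(lborel \<Otimes>\<^sub>M J)) = (\<integral>\<^sup>+z. \<integral>\<^sup>+x. f (x + r, z) \<partial>lborel \<partial>J)"
    by (subst P.nn_integral_snd[symmetric]) simp_all
  also have "\<dots> = (\<integral>\<^sup>+z. \<integral>\<^sup>+x. f (x, z) \<partial>lborel \<partial>J)"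
  proof (rule nn_integral_cong)
    fix z assume [simp]: "z \<in> space J"
    show "(\<integral>\<^sup>+x. f (x + r, z) \<partial>lborel) = (\<integral>\<^sup>+x. f (x, z) \<partial>lborel)"
      using nn_integral_lborel_translation[of "\<lambda>x. f (x, z)" r] by simp
  qed
  also have "\<dots> = (\<integral>\<^sup>+p. f p \<partial>(lborel \<Otimes>\<^sub>M J))"
    by (rule P.nn_integral_snd) simp
  finally show ?thesis .
qed

text \<open>For fixed \<open>z\<close> this is the one-dimensional result; the limit passes through
  the integral over \<open>z\<close> by dominated convergence, with twice the L1 norm of
  \<open>V (t, z)\<close> in \<open>t\<close> as majorant. Dominated convergence is stated for
  sequences, hence the sequential form of the limit.\<close>

lemma L1_pair_translation:
  fixes V :: "real \<times> 'b \<Rightarrow> real"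
  assumes "sigma_finite_measure J" and V: "integrable (lborel \<Otimes>\<^sub>M J) V"
  shows "((\<lambda>r. \<integral>\<^sup>+p. ennreal \<bar>V (fst p + r, snd p) - V p\<bar> \<partial>(lborel \<Otimes>\<^sub>M J)) \<longlongrightarrow> 0) (at 0)"
  unfolding tendsto_at_iff_sequentially
proof (intro allI impI)
  fix X :: "nat \<Rightarrow> real" assume X: "\<forall>i. X i \<in> UNIV - {0}" "X \<longlonglongrightarrow> 0"
  interpret J: sigma_finite_measure J by fact
  interpret P: pair_sigma_finite lborel J ..
  have [measurable]: "V \<in> borel_measurable (lborel \<Otimes>\<^sub>M J)" using V by auto
  have AE: "AE z in J. integrable lborel (\<lambda>t. V (t, z))"
    using P.AE_integrable_snd[of "\<lambda>t z. V (t, z)"] V by simp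
  let ?w = "\<lambda>z. \<integral>\<^sup>+t. ennreal \<bar>V (t, z)\<bar> \<partial>lborel"
  have w: "(\<integral>\<^sup>+z. 2 * ?w z \<partial>J) < \<infinity>"
  proof -
    have "(\<integral>\<^sup>+z. 2 * ?w z \<partial>J) = 2 * (\<integral>\<^sup>+p. ennreal \<bar>V p\<bar> \<partial>(lborel \<Otimes>\<^sub>M J))"
      by (subst nn_integral_cmult) (auto simp: P.nn_integral_snd[of "\<lambda>p. ennreal \<bar>V p\<bar>"])
    then show ?thesis using V by (auto simp: integrable_iff_bounded ennreal_mult_less_top)
  qed
  have "(\<lambda>i. \<integral>\<^sup>+z. \<integral>\<^sup>+t. ennreal \<bar>V (t + X i, z) - V (t, z)\<bar> \<partial>lborel \<partial>J) \<longlonglongrightarrow> (\<integral>\<^sup>+z. 0 \<partial>J)"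
  proof (rule nn_integral_dominated_convergence[where w = "\<lambda>z. 2 * ?w z"])
    show "AE z in J. (\<integral>\<^sup>+t. ennreal \<bar>V (t + X i, z) - V (t, z)\<bar> \<partial>lborel) \<le> 2 * ?w z" for i
    proof (rule AE_I2)
      fix z assume [simp]: "z \<in> space J"
      have [measurable]: "(\<lambda>t. V (t, z)) \<in> borel_measurable borel"
        using measurable_Pair1'[of z J lborel] by (auto intro: measurable_compose)
      have "(\<integral>\<^sup>+t. ennreal \<bar>V (t + X i, z) - V (t, z)\<bar> \<partial>lborel) \<le> (\<integral>\<^sup>+t. ennreal \<bar>V (t + X i, z)\<bar> + ennreal \<bar>V (t, z)\<bar> \<partial>lborel)"
        by (intro nn_integral_mono) (auto intro!: ennreal_leI simp flip: ennreal_plus)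
      also have "\<dots> = (\<integral>\<^sup>+t. ennreal \<bar>V (t + X i, z)\<bar> \<partial>lborel) + ?w z"
        by (subst nn_integral_add) auto
      also have "(\<integral>\<^sup>+t. ennreal \<bar>V (t + X i, z)\<bar> \<partial>lborel) = ?w z"
        by (rule nn_integral_lborel_translation) simp
      finally show "(\<integral>\<^sup>+t. ennreal \<bar>V (t + X i, z) - V (t, z)\<bar> \<partial>lborel) \<le> 2 * ?w z"
        by (simp add: mult_2)
    qed
    show "AE z in J. (\<lambda>i. \<integral>\<^sup>+t. ennreal \<bar>V (t + X i, z) - V (t, z)\<bar> \<partial>lborel) \<longlonglongrightarrow> 0"
      using AE
    proof eventually_elim
      case (elim z)
      show ?case
        using L1_translation[OF elim] X unfolding tendsto_at_iff_sequentially by (auto simp: comp_def)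
    qed
  qed (use w in auto)
  then show "((\<lambda>r. \<integral>\<^sup>+p. ennreal \<bar>V (fst p + r, snd p) - V p\<bar> \<partial>(lborel \<Otimes>\<^sub>M J)) \<circ> X) \<longlonglongrightarrow> 0"
    by (subst (asm) P.nn_integral_snd[symmetric, of "\<lambda>p. ennreal \<bar>V (fst p + X _, snd p) - V p\<bar>", simplified, symmetric])
       (simp_all add: comp_def)
qed

section \<open>Integrating a subgradient inequality in time\<close>

text \<open>Division by \<open>h > 0\<close> gives \<open>- e \<le> d\<close>; division by
  \<open>h < 0\<close> reverses the inequality and gives \<open>d \<le> e\<close>. A one-sided bound
  valid for increments of both signs thus becomes an equality.\<close>

lemma has_real_derivative_zero_of_lower_bound:
  fixes \<psi> :: "real \<Rightarrow> real"
  assumes d: "(\<psi> has_real_derivative d) (at 0)" and "\<psi> 0 = 0"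
    and lb: "\<And>e. e > 0 \<Longrightarrow> eventually (\<lambda>h. - e * \<bar>h\<bar> \<le> \<psi> h) (at 0)"
  shows "d = 0"
proof -
  have lim: "((\<lambda>h. \<psi> h / h) \<longlongrightarrow> d) (at 0)"
    using d assms(2) by (simp add: has_field_derivative_iff)
  have limr: "((\<lambda>h. \<psi> h / h) \<longlongrightarrow> d) (at_right 0)" and liml: "((\<lambda>h. \<psi> h / h) \<longlongrightarrow> d) (at_left 0)"
    using lim by (auto intro: tendsto_mono[OF at_le])
  have "- e \<le> d \<and> d \<le> e" if "e > 0" for e
  proof
    have "eventually (\<lambda>h. - e \<le> \<psi> h / h) (at_right 0)"
      using filter_leD[OF at_le[of "{0<..}" UNIV] lb[OF that]] eventually_at_right_less[of 0]
      by (auto elim: eventually_elim2 simp: field_simps)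
    then show "- e \<le> d"
      by (rule tendsto_lowerbound[OF limr]) auto
    have "eventually (\<lambda>h::real. h < 0) (at_left 0)" unfolding eventually_at_left_field by (auto intro: exI[of _ "-1"])
    then have "eventually (\<lambda>h. \<psi> h / h \<le> e) (at_left 0)"
      using filter_leD[OF at_le[of "{..<0}" UNIV] lb[OF that]]
      by (auto elim: eventually_elim2 simp: field_simps)
    then show "d \<le> e"
      by (rule tendsto_upperbound[OF liml]) auto
  qed
  then have "\<bar>d\<bar> \<le> e" if "e > 0" for e using that by (force simp: abs_le_iff)
  then show ?thesis by (metis abs_le_zero_iff dense_ge)
qed

text \<open>With a primitive of \<open>G\<close> the average is a difference of two values of that
  primitive, and differentiating leaves the boundary values of \<open>G\<close>. The averaging
  supplies the differentiability that \<open>G\<close> itself may lack.\<close>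

lemma moving_average_has_derivative:
  fixes G :: "real \<Rightarrow> real"
  assumes cont: "continuous_on {\<alpha><..<\<beta>} G" and ab: "\<alpha> < a" "a \<le> b" "b < \<beta>"
  shows "((\<lambda>h. LINT t:{a..b}|lborel. G (t + h)) has_real_derivative (G b - G a)) (at 0)"
proof -
  \<comment> \<open>Halfway points: they leave room for shifts of both signs inside a compact
    interval on which \<open>G\<close> is continuous.\<close>
  define a1 b1 where "a1 = (\<alpha> + a) / 2" and "b1 = (\<beta> + b) / 2"
  have o: "\<alpha> < a1" "a1 < a" "b < b1" "b1 < \<beta>" using ab by (auto simp: a1_def b1_def)
  have c1: "continuous_on {a1..b1} G"
    using cont by (rule continuous_on_subset) (use o in auto)
  define \<Gamma> where "\<Gamma> u = integral {a1..u} G" for u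
  have \<Gamma>: "(\<Gamma> has_real_derivative G u) (at u)" if "a1 < u" "u < b1" for u
  proof -
    have "(\<Gamma> has_real_derivative G u) (at u within {a1..b1})"
      unfolding \<Gamma>_def by (rule integral_has_real_derivative[OF c1]) (use that in auto)
    moreover have "at u within {a1..b1} = at u"
      using that by (intro at_within_interior) auto
    ultimately show ?thesis by simp
  qed
  have eq: "(LINT t:{a..b}|lborel. G (t + h)) = \<Gamma> (b + h) - \<Gamma> (a + h)"
    if h: "\<bar>h\<bar> < min (a - a1) (b1 - b)" for h
  proof -
    have h': "a1 \<le> a + h" "b + h \<le> b1" "a + h \<le> b + h" using h ab by linarith+
    have c2: "continuous_on {a + h..b + h} G"
      using c1 by (rule continuous_on_subset) (use h ab in auto)
    have "(LINT t:{a..b}|lborel. G (t + h)) = (LINT t|lborel. indicator {a + h..b + h} (h + 1 * t) *\<^sub>R G (h + 1 * t))"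
      unfolding set_lebesgue_integral_def
      by (intro Bochner_Integration.integral_cong) (auto simp: indicator_def add.commute)
    also have "\<dots> = (LINT t:{a + h..b + h}|lborel. G t)"
      unfolding set_lebesgue_integral_def
      using lborel_integral_real_affine[of 1 "\<lambda>t. indicator {a + h..b + h} t *\<^sub>R G t" h] by simp
    also have "\<dots> = integral {a + h..b + h} G"
      by (intro set_borel_integral_eq_integral(2) borel_integrable_atLeastAtMost' c2)
    also have "\<dots> = \<Gamma> (b + h) - \<Gamma> (a + h)"
      unfolding \<Gamma>_def
      using Henstock_Kurzweil_Integration.integral_combine[of a1 "a + h" "b + h" G] h'
        integrable_continuous_real[OF continuous_on_subset[OF c1], of a1 "b + h"]
      by auto
    finally show ?thesis .
  qed
  have ev: "eventually (\<lambda>h. \<Gamma> (b + h) - \<Gamma> (a + h) = (LINT t:{a..b}|lborel. G (t + h))) (nhds 0)"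
    unfolding eventually_nhds_metric
    using eq o by (intro exI[of _ "min (a - a1) (b1 - b)"]) (auto simp: dist_real_def)
  have "((\<lambda>h. \<Gamma> (b + h) - \<Gamma> (a + h)) has_real_derivative (G b - G a)) (at 0)"
    using \<Gamma>[of a] \<Gamma>[of b] DERIV_shift[of \<Gamma> _ 0 a] DERIV_shift[of \<Gamma> _ 0 b] o ab
    by (intro DERIV_diff) (simp_all add: add.commute)
  then show ?thesis
    using DERIV_cong_ev[OF refl ev refl] by simp
qed

text \<open>Averaging the subgradient inequality over \<open>s\<close> and using the \<open>L\<^sup>1\<close>-continuity of translations
  replaces \<open>V\<close> at time \<open>\<tau>\<close> by \<open>V\<close> at time \<open>s\<close>, so no regularity of \<open>W\<close> in time is needed.\<close>

lemma integral_eq_of_subgradient: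
  fixes V :: "real \<times> 'z \<Rightarrow> real" and W :: "real \<Rightarrow> 'z \<Rightarrow> real"
  assumes J: "sigma_finite_measure J" and V: "integrable (lborel \<Otimes>\<^sub>M J) V"
    and W[measurable]: "(\<lambda>(t, z). W t z) \<in> borel_measurable (lborel \<Otimes>\<^sub>M J)"
    and Wn: "\<And>t z. \<bar>W t z\<bar> \<le> n"
    and sub: "\<And>s t. \<alpha> < s \<Longrightarrow> s < \<beta> \<Longrightarrow> \<alpha> < t \<Longrightarrow> t < \<beta> \<Longrightarrow>
      sgn (t - s) * (\<integral>p. indicator {min s t..max s t} (fst p) * (W s (snd p) * V p) \<partial>(lborel \<Otimes>\<^sub>M J)) \<le> G t - G s"
    and ab: "\<alpha> < a" "a \<le> b" "b < \<beta>"
  shows "G b - G a = (\<integral>p. indicator {a..b} (fst p) * (W (fst p) (snd p) * V p) \<partial>(lborel \<Otimes>\<^sub>M J))"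
proof -
  interpret J: sigma_finite_measure J by fact
  interpret P: pair_sigma_finite lborel J ..
  let ?M = "(lborel :: real measure) \<Otimes>\<^sub>M J"
  have [measurable]: "V \<in> borel_measurable ?M" using V by auto
  have Wt[measurable]: "W t \<in> borel_measurable J" for t
    using measurable_compose[OF measurable_Pair1'[of t lborel J] W] by simp
  have n: "0 \<le> n" using Wn[of 0 undefined] by simp
  have WL: "\<bar>W t z\<bar> * \<bar>v\<bar> \<le> n * \<bar>v\<bar>" for t z v
    using Wn by (intro mult_right_mono) auto

  have bound: "\<bar>\<integral>p. indicator S (fst p) * (W t (snd p) * V p) \<partial>?M\<bar> \<le> n * (\<integral>p. indicator S (fst p) * \<bar>V p\<bar> \<partial>?M)"
    if [measurable]: "S \<in> sets borel" for S t
  proof -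
    have i: "integrable ?M (\<lambda>p. n * (indicator S (fst p) * \<bar>V p\<bar>))"
      by (intro integrable_mult_right Bochner_Integration.integrable_bound[OF V]) (auto simp: indicator_def)
    have "\<bar>\<integral>p. indicator S (fst p) * (W t (snd p) * V p) \<partial>?M\<bar> \<le> (\<integral>p. n * (indicator S (fst p) * \<bar>V p\<bar>) \<partial>?M)"
      by (rule order_trans[OF integral_abs_bound integral_mono[OF _ i]])
        (use n in \<open>auto simp: indicator_def abs_mult WL intro!: Bochner_Integration.integrable_bound[OF i]\<close>)
    then show ?thesis by simp
  qed

  \<comment> \<open>\<open>sub\<close> bounds the increment from below by minus \<open>n\<close>
    times the integral of \<open>\<bar>V p\<bar>\<close> over the time strip; exchanging the two
    times bounds it from above. The strips shrink to a single time, which is null.\<close>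
  have cont: "continuous_on {\<alpha><..<\<beta>} G"
    unfolding continuous_on_sequentially
  proof (intro allI ballI impI, elim conjE)
    fix X :: "nat \<Rightarrow> real" and t assume t: "t \<in> {\<alpha><..<\<beta>}" and X: "\<forall>k. X k \<in> {\<alpha><..<\<beta>}" "X \<longlonglongrightarrow> t"
    let ?S = "\<lambda>k. {min t (X k)..max t (X k)}"
    have "(\<lambda>k. \<integral>p. indicator (?S k) (fst p) * \<bar>V p\<bar> \<partial>?M) \<longlonglongrightarrow> (\<integral>p. 0 \<partial>?M)"
    proof (rule Bochner_Integration.integral_dominated_convergence[where w = "\<lambda>p. \<bar>V p\<bar>"])
      show "integrable ?M (\<lambda>p. \<bar>V p\<bar>)" using V by simp
      have "emeasure ?M ({t} \<times> space J) = 0"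
        by (subst J.emeasure_pair_measure_Times) auto
      then have "AE p in ?M. p \<notin> {t} \<times> space J"
        by (intro AE_not_in) (auto simp: null_sets_def)
      then show "AE p in ?M. (\<lambda>k. indicator (?S k) (fst p) * \<bar>V p\<bar>) \<longlonglongrightarrow> 0"
        using AE_space
      proof eventually_elim
        case (elim p)
        then have "fst p \<noteq> t" by (auto simp: space_pair_measure)
        then have "eventually (\<lambda>k. dist (X k) t < dist (fst p) t) sequentially"
          using X(2) by (intro tendstoD) auto
        then have "eventually (\<lambda>k. indicator (?S k) (fst p) * \<bar>V p\<bar> = 0) sequentially"
          by eventually_elim (auto simp: dist_real_def indicator_def)
        then show ?case by (rule tendsto_eventually)
      qed
    qed (auto simp: indicator_def)
    then have lim: "(\<lambda>k. n * (\<integral>p. indicator (?S k) (fst p) * \<bar>V p\<bar> \<partial>?M)) \<longlonglongrightarrow> 0"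
      using tendsto_mult_right_zero by fastforce
    have bnd: "\<bar>G t' - G s\<bar> \<le> n * (\<integral>p. indicator {min s t'..max s t'} (fst p) * \<bar>V p\<bar> \<partial>?M)"
      if "s \<in> {\<alpha><..<\<beta>}" "t' \<in> {\<alpha><..<\<beta>}" for s t'
    proof -
      have *: "- (n * (\<integral>p. indicator {min s t'..max s t'} (fst p) * \<bar>V p\<bar> \<partial>?M)) \<le> G t' - G s"
        if "s \<in> {\<alpha><..<\<beta>}" "t' \<in> {\<alpha><..<\<beta>}" for s t'
        using sub[of s t'] bound[of "{min s t'..max s t'}" s] that
        by (auto simp: sgn_if split: if_splits)
      from *[of s t'] *[of t' s] that show ?thesis
        by (simp add: min.commute max.commute abs_le_iff)
    qed
    have "(\<lambda>k. G (X k) - G t) \<longlonglongrightarrow> 0"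
      by (rule Lim_null_comparison[OF always_eventually lim]) (use bnd t X in auto)
    then show "(G \<circ> X) \<longlonglongrightarrow> G t" by (simp add: LIM_zero_iff comp_def)
  qed

  \<comment> \<open>The expected rate of change of \<open>G\<close>: subgradient and flux both taken
    at time \<open>t\<close>.\<close>
  define D where "D t = (\<integral>z. W t z * V (t, z) \<partial>J)" for t
  have WV: "integrable ?M (\<lambda>(t, z). W t z * V (t, z))"
    by (rule Bochner_Integration.integrable_bound[where f = "\<lambda>p. n * V p"])
      (use V n in \<open>auto simp: abs_mult case_prod_unfold WL\<close>)
  have Dint: "integrable lborel D"
    unfolding D_def using P.integrable_fst[OF WV] by simp
  have I: "(LINT t:{a..b}|lborel. D t) = (\<integral>p. indicator {a..b} (fst p) * (W (fst p) (snd p) * V p) \<partial>?M)"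
  proof -
    have "integrable ?M (\<lambda>(t, z). indicator {a..b} t * (W t z * V (t, z)))"
      by (rule Bochner_Integration.integrable_bound[OF WV]) (auto simp: indicator_def)
    from P.integral_fst[OF this] show ?thesis
      by (simp add: D_def set_lebesgue_integral_def case_prod_unfold)
  qed

  \<comment> \<open>How far \<open>V\<close> moves, in L1 of \<open>J\<close>, between time
    \<open>t\<close> and the times up to \<open>t + h\<close>. Written in the displacement
    \<open>r\<close>, its integral over all \<open>t\<close> becomes an integral of the translation
    error \<open>\<omega> r\<close> over short displacements.\<close>
  define err where "err h t = (\<integral>\<^sup>+r. indicator {min 0 h..max 0 h} r * (\<integral>\<^sup>+z. ennreal \<bar>V (t + r, z) - V (t, z)\<bar> \<partial>J) \<partial>lborel)" for h t
  have err_meas[measurable]: "err h \<in> borel_measurable borel" for h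
    unfolding err_def by measurable
  define \<omega> where "\<omega> r = (\<integral>\<^sup>+p. ennreal \<bar>V (fst p + r, snd p) - V p\<bar> \<partial>?M)" for r
  have err_total: "(\<integral>\<^sup>+t. err h t \<partial>lborel) = (\<integral>\<^sup>+r. indicator {min 0 h..max 0 h} r * \<omega> r \<partial>lborel)" for h
  proof -
    have "(\<integral>\<^sup>+t. err h t \<partial>lborel) = (\<integral>\<^sup>+r. \<integral>\<^sup>+t. indicator {min 0 h..max 0 h} r * (\<integral>\<^sup>+z. ennreal \<bar>V (t + r, z) - V (t, z)\<bar> \<partial>J) \<partial>lborel \<partial>lborel)"
      unfolding err_def by (rule lborel_pair.Fubini') measurable
    also have "\<dots> = (\<integral>\<^sup>+r. indicator {min 0 h..max 0 h} r * \<omega> r \<partial>lborel)"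
    proof (rule nn_integral_cong)
      fix r :: real
      have "(\<integral>\<^sup>+t. indicator {min 0 h..max 0 h} r * (\<integral>\<^sup>+z. ennreal \<bar>V (t + r, z) - V (t, z)\<bar> \<partial>J) \<partial>lborel)
        = indicator {min 0 h..max 0 h} r * (\<integral>\<^sup>+t. (\<integral>\<^sup>+z. ennreal \<bar>V (t + r, z) - V (t, z)\<bar> \<partial>J) \<partial>lborel)"
        by (rule nn_integral_cmult) measurable
      also have "(\<integral>\<^sup>+t. (\<integral>\<^sup>+z. ennreal \<bar>V (t + r, z) - V (t, z)\<bar> \<partial>J) \<partial>lborel) = \<omega> r"
        unfolding \<omega>_def by (subst J.nn_integral_fst[symmetric]) auto
      finally show "(\<integral>\<^sup>+t. indicator {min 0 h..max 0 h} r * (\<integral>\<^sup>+z. ennreal \<bar>V (t + r, z) - V (t, z)\<bar> \<partial>J) \<partial>lborel)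
        = indicator {min 0 h..max 0 h} r * \<omega> r" .
    qed
    finally show ?thesis .
  qed

  \<comment> \<open>Since \<open>sgn h * \<bar>h\<bar> = h\<close>, one inequality covers forward
    and backward increments, and the error enters with the same sign in both. It is claimed only at
    times where the slice of \<open>V\<close> is integrable and the error finite, that is, for
    almost every \<open>t\<close> once \<open>h\<close> is small.\<close>
  have key: "h * D t - n * enn2real (err h t) \<le> G (t + h) - G t"
    if t: "\<alpha> < t" "t < \<beta>" "\<alpha> < t + h" "t + h < \<beta>" and Vt: "integrable J (\<lambda>z. V (t, z))" and fin: "err h t < \<infinity>"
    for t h
  proof -
    let ?S = "{min t (t + h)..max t (t + h)}"
    have iV: "integrable ?M (\<lambda>p. indicator ?S (fst p) * (W t (snd p) * V p))"
      by (rule Bochner_Integration.integrable_bound[where f = "\<lambda>p. n * V p"])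
        (use V n in \<open>auto simp: abs_mult indicator_def WL\<close>)
    have WVt: "integrable J (\<lambda>z. W t z * V (t, z))"
      by (rule Bochner_Integration.integrable_bound[where f = "\<lambda>z. n * V (t, z)"])
        (use Vt n in \<open>auto simp: abs_mult WL\<close>)
    have ic: "integrable ?M (\<lambda>(s, z). indicator ?S s * (W t z * V (t, z)))"
      by (rule P.Fubini_integrable) (use WVt Vt in \<open>auto simp: abs_mult intro!: integrable_real_mult_indicator\<close>)
    have c: "(\<integral>p. indicator ?S (fst p) * (W t (snd p) * V (t, snd p)) \<partial>?M) = \<bar>h\<bar> * D t"
    proof -
      have "max t (t + h) - min t (t + h) = \<bar>h\<bar>" "min t (t + h) \<le> max t (t + h)" by auto
      then show ?thesis
        using P.integral_fst[OF ic] by (simp add: D_def case_prod_unfold)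
    qed
    have dist: "indicator ?S (fst p) * (W t (snd p) * (V p - V (t, snd p)))
        = indicator ?S (fst p) * (W t (snd p) * V p) - indicator ?S (fst p) * (W t (snd p) * V (t, snd p))" for p
      by (simp add: right_diff_distrib)
    have ic': "integrable ?M (\<lambda>p. indicator ?S (fst p) * (W t (snd p) * V (t, snd p)))"
      using ic by (simp add: case_prod_unfold)
    have id: "integrable ?M (\<lambda>p. indicator ?S (fst p) * (W t (snd p) * (V p - V (t, snd p))))"
      unfolding dist by (rule Bochner_Integration.integrable_diff[OF iV ic'])
    have diff: "(\<integral>p. indicator ?S (fst p) * (W t (snd p) * V p) \<partial>?M) - \<bar>h\<bar> * D t
      = (\<integral>p. indicator ?S (fst p) * (W t (snd p) * (V p - V (t, snd p))) \<partial>?M)"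
      unfolding c[symmetric] dist by (rule Bochner_Integration.integral_diff[OF iV ic', symmetric])
    have "ennreal \<bar>(\<integral>p. indicator ?S (fst p) * (W t (snd p) * V p) \<partial>?M) - \<bar>h\<bar> * D t\<bar>
        \<le> (\<integral>\<^sup>+p. ennreal \<bar>indicator ?S (fst p) * (W t (snd p) * (V p - V (t, snd p)))\<bar> \<partial>?M)"
      using integral_norm_bound_ennreal[OF id] unfolding real_norm_def diff .
    also have "\<dots> \<le> (\<integral>\<^sup>+p. ennreal n * (indicator ?S (fst p) * ennreal \<bar>V p - V (t, snd p)\<bar>) \<partial>?M)"
    proof (rule nn_integral_mono)
      fix p
      show "ennreal \<bar>indicator ?S (fst p) * (W t (snd p) * (V p - V (t, snd p)))\<bar>
          \<le> ennreal n * (indicator ?S (fst p) * ennreal \<bar>V p - V (t, snd p)\<bar>)"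
        using WL[of t "snd p" "V p - V (t, snd p)"] n
        by (cases "fst p \<in> ?S") (simp_all add: abs_mult ennreal_leI flip: ennreal_mult)
    qed
    also have "\<dots> = ennreal n * (\<integral>\<^sup>+p. indicator ?S (fst p) * ennreal \<bar>V p - V (t, snd p)\<bar> \<partial>?M)"
      by (rule nn_integral_cmult) simp
    also have "(\<integral>\<^sup>+p. indicator ?S (fst p) * ennreal \<bar>V p - V (t, snd p)\<bar> \<partial>?M) = err h t"
    proof -
      have "(\<integral>\<^sup>+p. indicator ?S (fst p) * ennreal \<bar>V p - V (t, snd p)\<bar> \<partial>?M)
         = (\<integral>\<^sup>+p. indicator ?S (fst p + t) * ennreal \<bar>V (fst p + t, snd p) - V (t, snd p)\<bar> \<partial>?M)"
        by (subst nn_integral_pair_translation[OF J, symmetric, of _ t]) simp_all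
      also have "\<dots> = (\<integral>\<^sup>+r. \<integral>\<^sup>+z. indicator ?S (r + t) * ennreal \<bar>V (r + t, z) - V (t, z)\<bar> \<partial>J \<partial>lborel)"
        by (subst J.nn_integral_fst[symmetric]) auto
      also have "\<dots> = err h t"
        unfolding err_def by (intro nn_integral_cong)
          (auto simp: indicator_def add.commute)
      finally show ?thesis .
    qed
    finally have "ennreal \<bar>(\<integral>p. indicator ?S (fst p) * (W t (snd p) * V p) \<partial>?M) - \<bar>h\<bar> * D t\<bar> \<le> ennreal n * err h t" .
    also have "\<dots> = ennreal (n * enn2real (err h t))"
      using fin n by (simp add: ennreal_mult'')
    finally have "\<bar>(\<integral>p. indicator ?S (fst p) * (W t (snd p) * V p) \<partial>?M) - \<bar>h\<bar> * D t\<bar> \<le> n * enn2real (err h t)"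
      using n by (subst (asm) ennreal_le_iff) auto
    moreover have "sgn h * (\<integral>p. indicator ?S (fst p) * (W t (snd p) * V p) \<partial>?M) \<le> G (t + h) - G t"
      using sub[of t "t + h"] t by simp
    ultimately show ?thesis
      by (auto simp: sgn_if abs_if split: if_splits)
  qed

  \<comment> \<open>The defect of the averaged inequality. Its derivative at 0 is the difference of
    the two sides of the claim, so it remains to bound \<open>\<psi>\<close> from below by
    o(h).\<close>
  define \<psi> where "\<psi> h = (LINT t:{a..b}|lborel. G (t + h)) - (LINT t:{a..b}|lborel. G t) - h * (LINT t:{a..b}|lborel. D t)" for h
  have "G b - G a - (LINT t:{a..b}|lborel. D t) = 0"
  proof (rule has_real_derivative_zero_of_lower_bound)
    show "(\<psi> has_real_derivative (G b - G a - (LINT t:{a..b}|lborel. D t))) (at 0)"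
      unfolding \<psi>_def
      by (auto intro!: derivative_eq_intros moving_average_has_derivative[OF cont ab])
    show "\<psi> 0 = 0" by (simp add: \<psi>_def)
    fix e :: real assume "e > 0"
    \<comment> \<open>\<open>n + 1\<close> rather than \<open>n\<close>, since the bound
      \<open>n\<close> may be 0; the error \<open>n * (e' * \<bar>h\<bar>)\<close> then stays below
      \<open>e * \<bar>h\<bar>\<close>.\<close>
    define e' where "e' = e / (n + 1)"
    have "e' > 0" using \<open>e > 0\<close> n by (simp add: e'_def)
    have "eventually (\<lambda>r. \<omega> r < ennreal e') (at 0)"
      unfolding \<omega>_def using \<open>e' > 0\<close> by (intro order_tendstoD(2)[OF L1_pair_translation[OF J V]]) auto
    then obtain d where d: "d > 0" "\<And>r. r \<noteq> 0 \<Longrightarrow> \<bar>r\<bar> < d \<Longrightarrow> \<omega> r < ennreal e'"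
      by (auto simp: eventually_at dist_real_def)
    \<comment> \<open>The filter \<open>at 0\<close> says nothing about \<open>r = 0\<close>; there
      \<open>\<omega>\<close> vanishes.\<close>
    have \<omega>: "\<omega> r \<le> ennreal e'" if "\<bar>r\<bar> < d" for r
      using d(2)[of r] that by (cases "r = 0") (auto simp: \<omega>_def less_imp_le)
    have "- e * \<bar>h\<bar> \<le> \<psi> h" if h: "\<bar>h\<bar> < Min {d, a - \<alpha>, \<beta> - b}" for h
    proof -
      have "(\<integral>\<^sup>+t. err h t \<partial>lborel) \<le> (\<integral>\<^sup>+r. ennreal e' * indicator {min 0 h..max 0 h} r \<partial>lborel)"
        unfolding err_total by (intro nn_integral_mono) (use \<omega> h in \<open>auto simp: indicator_def\<close>)
      also have "\<dots> = ennreal (e' * \<bar>h\<bar>)"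
        using \<open>e' > 0\<close> by (subst nn_integral_cmult) (auto simp: ennreal_mult max_def min_def)
      finally have le: "(\<integral>\<^sup>+t. err h t \<partial>lborel) \<le> ennreal (e' * \<bar>h\<bar>)" .
      then have "(\<integral>\<^sup>+t. err h t \<partial>lborel) \<noteq> \<infinity>" by (auto simp: top_unique)
      then have fin: "AE t in lborel. err h t \<noteq> \<infinity>" by (intro nn_integral_PInf_AE) auto
      have eq: "(\<integral>\<^sup>+t. ennreal (enn2real (err h t)) \<partial>lborel) = (\<integral>\<^sup>+t. err h t \<partial>lborel)"
        using fin by (intro nn_integral_cong_AE) (auto simp: less_top)
      have ei: "integrable lborel (\<lambda>t. enn2real (err h t))"
        using le by (intro integrableI_bounded) (auto simp: eq top_unique less_top[symmetric])
      have "(\<integral>t. enn2real (err h t) \<partial>lborel) \<le> e' * \<bar>h\<bar>"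
        using le \<open>e' > 0\<close> unfolding eq[symmetric]
        by (subst (asm) nn_integral_eq_integral[OF ei]) auto
      moreover have "(LINT t:{a..b}|lborel. enn2real (err h t)) \<le> (\<integral>t. enn2real (err h t) \<partial>lborel)"
        unfolding set_lebesgue_integral_def
        by (intro integral_mono integrable_mult_indicator ei) (auto simp: indicator_def)
      ultimately have e_le: "(LINT t:{a..b}|lborel. enn2real (err h t)) \<le> e' * \<bar>h\<bar>" by simp
      have i1: "set_integrable lborel {a..b} G" "set_integrable lborel {a..b} (\<lambda>t. G (t + h))"
        using ab h by (auto intro!: borel_integrable_atLeastAtMost' continuous_on_subset[OF cont]
            continuous_on_compose2[OF cont] continuous_intros)
      have i2: "set_integrable lborel {a..b} D" "set_integrable lborel {a..b} (\<lambda>t. enn2real (err h t))"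
        using integrable_mult_indicator[OF _ Dint, of "{a..b}"] integrable_mult_indicator[OF _ ei, of "{a..b}"]
        by (auto simp: set_integrable_def)
      have "(LINT t:{a..b}|lborel. h * D t - n * enn2real (err h t)) \<le> (LINT t:{a..b}|lborel. G (t + h) - G t)"
        unfolding set_lebesgue_integral_def
      proof (rule integral_mono_AE)
        show "AE t in lborel. indicator {a..b} t *\<^sub>R (h * D t - n * enn2real (err h t)) \<le> indicator {a..b} t *\<^sub>R (G (t + h) - G t)"
          using fin P.AE_integrable_fst'[OF V]
        proof eventually_elim
          case (elim t)
          show ?case
            using key[of t h] elim ab h by (auto simp: indicator_def less_top)
        qed
      qed (use set_integral_diff(1)[OF i1(2) i1(1)] set_integral_diff(1)[OF set_integrable_mult_right[OF i2(1)] set_integrable_mult_right[OF i2(2)], of h n] in \<open>auto simp: set_integrable_def\<close>)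
      also have "\<dots> = (LINT t:{a..b}|lborel. G (t + h)) - (LINT t:{a..b}|lborel. G t)"
        by (rule set_integral_diff[OF i1(2) i1(1)])
      finally have "h * (LINT t:{a..b}|lborel. D t) - n * (LINT t:{a..b}|lborel. enn2real (err h t)) \<le> (LINT t:{a..b}|lborel. G (t + h)) - (LINT t:{a..b}|lborel. G t)"
        by (subst (asm) set_integral_diff) (use i2 in auto)
      moreover have "n * (LINT t:{a..b}|lborel. enn2real (err h t)) \<le> n * (e' * \<bar>h\<bar>)"
        using e_le n by (intro mult_left_mono)
      moreover have "n * (e' * \<bar>h\<bar>) \<le> e * \<bar>h\<bar>"
        using n \<open>e > 0\<close> by (auto simp: e'_def field_simps intro!: mult_right_mono)
      ultimately show ?thesis by (simp add: \<psi>_def)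
    qed
    then show "eventually (\<lambda>h. - e * \<bar>h\<bar> \<le> \<psi> h) (at 0)"
      unfolding eventually_at using d ab by (intro exI[of _ "Min {d, a - \<alpha>, \<beta> - b}"]) (auto simp: dist_real_def)
  qed
  then show ?thesis by (simp add: I)
qed

section \<open>Chain rule for convex functionals\<close>

text \<open>The signed indicator of the interval between \<open>u\<close> and \<open>v\<close>. It
  puts both orientations into one integral over the whole line whose integrand is jointly measurable
  in the endpoints and the variable, so that integrals with moving endpoints are measurable. The
  endpoints get 0, as in the open intervals of \<open>LBINT\<close>.\<close>

definition oriented :: "real \<Rightarrow> real \<Rightarrow> real \<Rightarrow> real" where
  "oriented u v s = (if u < s \<and> s < v then 1 else if v < s \<and> s < u then - 1 else 0)"

lemma measurable_oriented[measurable]: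
  assumes [measurable]: "u \<in> borel_measurable M" "v \<in> borel_measurable M" "s \<in> borel_measurable M"
  shows "(\<lambda>x. oriented (u x) (v x) (s x)) \<in> borel_measurable M"
  unfolding oriented_def by measurable

lemma interval_integral_oriented:
  "(LBINT s=ereal u..ereal v. g s) = (\<integral>s. oriented u v s * g s \<partial>lborel)"
proof (cases "u \<le> v")
  case True
  then have "oriented u v s = indicator {u<..<v} s" for s
    by (auto simp: oriented_def indicator_def)
  with True show ?thesis
    by (simp add: interval_lebesgue_integral_def set_lebesgue_integral_def)
next
  case False
  then have "oriented u v s = - indicator {v<..<u} s" for s
    by (auto simp: oriented_def indicator_def)
  with False show ?thesis
    by (simp add: interval_lebesgue_integral_def set_lebesgue_integral_def)
qed

text \<open>A monotone function is bounded between its values at the ends of the interval, whether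
  it jumps or not.\<close>

lemma oriented_integrable_mono:
  assumes "mono g"
  shows "integrable lborel (\<lambda>s. oriented u v s * g s)"
proof (rule integrableI_bounded_set[where A = "{min u v..max u v}" and B = "\<bar>g (min u v)\<bar> + \<bar>g (max u v)\<bar>"])
  have [measurable]: "g \<in> borel_measurable borel" using assms by (rule borel_measurable_mono)
  show "(\<lambda>s. oriented u v s * g s) \<in> borel_measurable lborel" by simp
  have "\<bar>g s\<bar> \<le> \<bar>g (min u v)\<bar> + \<bar>g (max u v)\<bar>" if "min u v \<le> s" "s \<le> max u v" for s
    using monoD[OF assms that(1)] monoD[OF assms that(2)] by linarith
  then show "AE s in lborel. s \<in> {min u v..max u v} \<longrightarrow> norm (oriented u v s * g s) \<le> \<bar>g (min u v)\<bar> + \<bar>g (max u v)\<bar>"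
    by (intro AE_I2) (auto simp: oriented_def)
  show "AE s in lborel. s \<notin> {min u v..max u v} \<longrightarrow> oriented u v s * g s = 0"
    by (intro AE_I2) (auto simp: oriented_def)
qed auto

lemma integral_oriented: "(\<integral>s. oriented u v s \<partial>lborel) = v - u"
  using interval_integral_oriented[of u v "\<lambda>_. 1"] by simp

text \<open>The primitive of a monotone function is convex, and \<open>g u\<close> is one of its
  slopes at \<open>u\<close> even if \<open>g\<close> jumps there: to the right of \<open>u\<close>
  the integrand is at least \<open>g u\<close>, to the left at most.\<close>

lemma oriented_integral_subgradient:
  assumes g: "mono g"
  shows "g u * (v - u) \<le> (\<integral>s. oriented a v s * g s \<partial>lborel) - (\<integral>s. oriented a u s * g s \<partial>lborel)"
proof -
  have [measurable]: "g \<in> borel_measurable borel" using assms by (rule borel_measurable_mono)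
  have "g u * (v - u) = (\<integral>s. oriented u v s * g u \<partial>lborel)"
    by (simp add: integral_oriented)
  also have "\<dots> \<le> (\<integral>s. oriented u v s * g s \<partial>lborel)"
  proof (rule integral_mono)
    show "integrable lborel (\<lambda>s. oriented u v s * g u)"
      by (rule oriented_integrable_mono) (simp add: mono_def)
    show "oriented u v s * g u \<le> oriented u v s * g s" for s
      using monoD[OF g, of u s] monoD[OF g, of s u] by (auto simp: oriented_def)
  qed (rule oriented_integrable_mono[OF g])
  also have "\<dots> = (\<integral>s. oriented a v s * g s - oriented a u s * g s \<partial>lborel)"
  proof (rule integral_cong_AE)
    \<comment> \<open>Additivity of oriented integrals; because of the open ends it can fail at the
      three endpoints.\<close>
    show "AE s in lborel. oriented u v s * g s = oriented a v s * g s - oriented a u s * g s"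
      using AE_lborel_singleton[of a] AE_lborel_singleton[of u] AE_lborel_singleton[of v]
      by eventually_elim (auto simp: oriented_def)
  qed auto
  also have "\<dots> = (\<integral>s. oriented a v s * g s \<partial>lborel) - (\<integral>s. oriented a u s * g s \<partial>lborel)"
    by (intro Bochner_Integration.integral_diff oriented_integrable_mono g)
  finally show ?thesis .
qed

text \<open>Clipping is monotone and fixes 0. A clipped subgradient is therefore again the
  subgradient of a convex function, never changes sign against the original, and is bounded, hence
  admissible as a test function.\<close>

definition trunc :: "nat \<Rightarrow> real \<Rightarrow> real" where
  "trunc n r = max (- real n) (min (real n) r)"

lemma mono_trunc: "mono (trunc n)"
  by (auto simp: mono_def trunc_def)

lemma measurable_trunc[measurable]: "trunc n \<in> borel_measurable borel"
  by (rule borel_measurable_mono[OF mono_trunc])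

lemma abs_trunc: "\<bar>trunc n r\<bar> \<le> real n" "\<bar>trunc n r\<bar> \<le> \<bar>r\<bar>"
  by (auto simp: trunc_def)

lemma trunc_tendsto: "(\<lambda>n. trunc n r) \<longlonglongrightarrow> r"
proof (rule tendsto_eventually)
  obtain N where "\<bar>r\<bar> \<le> real N" using real_arch_simple by blast
  then show "eventually (\<lambda>n. trunc n r = r) sequentially"
    by (auto simp: eventually_sequentially trunc_def intro!: exI[of _ N])
qed

text \<open>Passes from sets to bounded test functions by approximation with simple functions. The
  integrands \<open>f - g\<close> and \<open>V\<close> have no sign, so the limit step needs
  dominated convergence, and boundedness of the test function has to be carried through the
  induction.\<close>

lemma integral_test_function:
  fixes V :: "'z \<Rightarrow> real" and u :: "'a \<Rightarrow> real"
  assumes V: "integrable M V" and \<pi>[measurable]: "\<pi> \<in> measurable M \<nu>"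
    and f: "integrable \<nu> f" "integrable \<nu> g"
    and sets: "\<And>A. A \<in> sets \<nu> \<Longrightarrow> (\<integral>x. indicator A x * f x \<partial>\<nu>) - (\<integral>x. indicator A x * g x \<partial>\<nu>) = (\<integral>z. indicator A (\<pi> z) * V z \<partial>M)"
    and u[measurable]: "u \<in> borel_measurable \<nu>" and ub: "\<And>x. \<bar>u x\<bar> \<le> C"
  shows "(\<integral>x. u x * (f x - g x) \<partial>\<nu>) = (\<integral>z. u (\<pi> z) * V z \<partial>M)"
proof -
  have [measurable]: "f \<in> borel_measurable \<nu>" "g \<in> borel_measurable \<nu>" "V \<in> borel_measurable M"
    using V f by auto
  have iM: "integrable M (\<lambda>z. v (\<pi> z) * V z)"
    if [measurable]: "v \<in> borel_measurable \<nu>" and b: "\<And>x. x \<in> space \<nu> \<Longrightarrow> \<bar>v x\<bar> \<le> C" for v :: "'a \<Rightarrow> real" and C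
  proof (rule Bochner_Integration.integrable_bound[where f = "\<lambda>z. C * V z"])
    have "\<bar>v (\<pi> z)\<bar> * \<bar>V z\<bar> \<le> \<bar>C\<bar> * \<bar>V z\<bar>" if "z \<in> space M" for z
      using b[OF measurable_space[OF \<pi> that]] by (intro mult_right_mono) auto
    then show "AE z in M. norm (v (\<pi> z) * V z) \<le> norm (C * V z)"
      by (intro AE_I2) (simp add: abs_mult)
  qed (use V in auto)
  have i\<nu>: "integrable \<nu> (\<lambda>x. v x * h x)"
    if [measurable]: "v \<in> borel_measurable \<nu>" and b: "\<And>x. x \<in> space \<nu> \<Longrightarrow> \<bar>v x\<bar> \<le> C" and "integrable \<nu> h" for v h :: "'a \<Rightarrow> real" and C
  proof (rule Bochner_Integration.integrable_bound[where f = "\<lambda>z. C * h z"])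
    have "\<bar>v x\<bar> * \<bar>h x\<bar> \<le> \<bar>C\<bar> * \<bar>h x\<bar>" if "x \<in> space \<nu>" for x
      using b[OF that] by (intro mult_right_mono) auto
    then show "AE x in \<nu>. norm (v x * h x) \<le> norm (C * h x)"
      by (intro AE_I2) (simp add: abs_mult)
  qed (use that in auto)
  let ?d = "\<lambda>x. f x - g x"
  have d: "integrable \<nu> ?d" using f by simp
  have *: "\<forall>C. (\<forall>x\<in>space \<nu>. v x \<le> C) \<longrightarrow> (\<integral>x. v x * ?d x \<partial>\<nu>) = (\<integral>z. v (\<pi> z) * V z \<partial>M)"
    if "v \<in> borel_measurable \<nu>" "\<And>x. 0 \<le> v x" for v
    using that
  proof (induct rule: borel_measurable_induct_real)
    case (set A)
    have "(\<integral>x. indicator A x * ?d x \<partial>\<nu>) = (\<integral>x. indicator A x * f x \<partial>\<nu>) - (\<integral>x. indicator A x * g x \<partial>\<nu>)"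
      using integrable_mult_indicator[OF set f(1)] integrable_mult_indicator[OF set f(2)]
      by (simp add: right_diff_distrib)
    with sets[OF set] show ?case by simp
  next
    case (mult u c)
    show ?case
    proof (intro allI impI)
      fix C assume C: "\<forall>x\<in>space \<nu>. c * u x \<le> C"
      show "(\<integral>x. c * u x * ?d x \<partial>\<nu>) = (\<integral>z. c * u (\<pi> z) * V z \<partial>M)"
      proof (cases "c = 0")
        case False
        then have "\<forall>x\<in>space \<nu>. u x \<le> C / c"
          using C mult(1) by (auto simp: field_simps)
        then have "(\<integral>x. u x * ?d x \<partial>\<nu>) = (\<integral>z. u (\<pi> z) * V z \<partial>M)"
          using mult by blast
        then show ?thesis by (simp add: mult.assoc)
      qed simp
    qed
  next
    case (add u v)
    show ?case
    proof (intro allI impI)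
      fix C assume C: "\<forall>x\<in>space \<nu>. v x + u x \<le> C"
      have bu: "\<forall>x\<in>space \<nu>. u x \<le> C" "\<forall>x\<in>space \<nu>. v x \<le> C"
        using C add(2,5) by (smt (verit))+
      have bu': "\<And>x. x \<in> space \<nu> \<Longrightarrow> \<bar>u x\<bar> \<le> C" "\<And>x. x \<in> space \<nu> \<Longrightarrow> \<bar>v x\<bar> \<le> C"
        using bu add(2,5) by (simp_all add: abs_of_nonneg)
      have eq: "(\<integral>x. u x * ?d x \<partial>\<nu>) = (\<integral>z. u (\<pi> z) * V z \<partial>M)" "(\<integral>x. v x * ?d x \<partial>\<nu>) = (\<integral>z. v (\<pi> z) * V z \<partial>M)"
        using add(3)[rule_format, OF bspec[OF bu(1)]] add(7)[rule_format, OF bspec[OF bu(2)]] by simp_all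
      have "(\<integral>x. (v x + u x) * ?d x \<partial>\<nu>) = (\<integral>x. v x * ?d x \<partial>\<nu>) + (\<integral>x. u x * ?d x \<partial>\<nu>)"
        unfolding distrib_right using add(1,4) bu' d
        by (intro Bochner_Integration.integral_add i\<nu>) auto
      also have "\<dots> = (\<integral>z. (v (\<pi> z) + u (\<pi> z)) * V z \<partial>M)"
        unfolding distrib_right eq using add(1,4) bu'
        by (intro Bochner_Integration.integral_add[symmetric] iM) auto
      finally show "(\<integral>x. (v x + u x) * ?d x \<partial>\<nu>) = (\<integral>z. (v (\<pi> z) + u (\<pi> z)) * V z \<partial>M)" .
    qed
  next
    case (seq U)
    show ?case
    proof (intro allI impI)
      fix C assume C: "\<forall>x\<in>space \<nu>. v x \<le> C"
      have [measurable]: "U i \<in> borel_measurable \<nu>" for i by fact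
      have U_le: "U i x \<le> v x" if "x \<in> space \<nu>" for x i
        using seq(4,5) that by (intro incseq_le) (auto simp: incseq_def le_fun_def)
      have UC: "\<bar>U i x\<bar> \<le> C" if "x \<in> space \<nu>" for x i
        using U_le[OF that, of i] C that seq(2)[of i x] by force
      have eq: "(\<integral>x. U i x * ?d x \<partial>\<nu>) = (\<integral>z. U i (\<pi> z) * V z \<partial>M)" for i
        using seq(3)[of i] UC[of _ i] by (meson abs_le_D1)
      have vm: "v \<in> borel_measurable \<nu>"
        by (rule borel_measurable_LIMSEQ_real[OF seq(5)]) auto
      have "(\<lambda>i. \<integral>x. U i x * ?d x \<partial>\<nu>) \<longlonglongrightarrow> (\<integral>x. v x * ?d x \<partial>\<nu>)"
      proof (rule integral_dominated_convergence[where w = "\<lambda>x. C * \<bar>?d x\<bar>"])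
        show "integrable \<nu> (\<lambda>x. C * \<bar>?d x\<bar>)" using d by simp
        show "AE x in \<nu>. (\<lambda>i. U i x * ?d x) \<longlonglongrightarrow> v x * ?d x"
          using seq(5) by (intro AE_I2 tendsto_intros)
        show "AE x in \<nu>. norm (U i x * ?d x) \<le> C * \<bar>?d x\<bar>" for i
          using UC by (intro AE_I2) (auto simp: abs_mult intro!: mult_right_mono)
      qed (use vm in auto)
      moreover have "(\<lambda>i. \<integral>z. U i (\<pi> z) * V z \<partial>M) \<longlonglongrightarrow> (\<integral>z. v (\<pi> z) * V z \<partial>M)"
      proof (rule integral_dominated_convergence[where w = "\<lambda>z. C * \<bar>V z\<bar>"])
        show "integrable M (\<lambda>z. C * \<bar>V z\<bar>)" using V by simp
        show "AE z in M. (\<lambda>i. U i (\<pi> z) * V z) \<longlonglongrightarrow> v (\<pi> z) * V z"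
          using seq(5)[OF measurable_space[OF \<pi>]] by (intro AE_I2 tendsto_mult tendsto_const)
        show "AE z in M. norm (U i (\<pi> z) * V z) \<le> C * \<bar>V z\<bar>" for i
          using UC measurable_space[OF \<pi>] by (intro AE_I2) (auto simp: abs_mult intro!: mult_right_mono)
      qed (use vm in \<open>auto intro: measurable_compose[OF \<pi>]\<close>)
      ultimately show "(\<integral>x. v x * ?d x \<partial>\<nu>) = (\<integral>z. v (\<pi> z) * V z \<partial>M)"
        unfolding eq by (rule LIMSEQ_unique)
    qed
  qed
  \<comment> \<open>The induction covers nonnegative functions: it is applied to
    \<open>u + C\<close> and to the constant \<open>C\<close>, and the results are
    subtracted.\<close>
  have b1: "\<bar>u x + C\<bar> \<le> 2 * C" "0 \<le> u x + C" "u x + C \<le> 2 * C" "\<bar>C\<bar> \<le> C" for x using ub[of x] by linarith+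
  have C1: "\<bar>C\<bar> \<le> C" using b1(4) .
  have "(\<integral>x. (u x + C) * ?d x \<partial>\<nu>) = (\<integral>z. (u (\<pi> z) + C) * V z \<partial>M)"
    using *[rule_format, of "\<lambda>x. u x + C" "2 * C"] b1(2,3) by simp
  moreover have "(\<integral>x. C * ?d x \<partial>\<nu>) = (\<integral>z. C * V z \<partial>M)"
    using *[of "\<lambda>x. C"] C1 by auto
  moreover have "(\<integral>x. (u x + C) * ?d x \<partial>\<nu>) = (\<integral>x. u x * ?d x \<partial>\<nu>) + (\<integral>x. C * ?d x \<partial>\<nu>)"
    unfolding distrib_right using ub d by (intro Bochner_Integration.integral_add i\<nu>) auto
  moreover have "(\<integral>z. (u (\<pi> z) + C) * V z \<partial>M) = (\<integral>z. u (\<pi> z) * V z \<partial>M) + (\<integral>z. C * V z \<partial>M)"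
    unfolding distrib_right using ub V by (intro Bochner_Integration.integral_add iM) auto
  ultimately show ?thesis by linarith
qed


text \<open>For the clipped subgradient this is \<open>integral_eq_of_subgradient\<close> with
  \<open>G\<close> the clipped functional. The clipping is removed by dominated convergence: on the
  right the majorant comes from \<open>pV\<close>, on the left it is the unclipped density of the
  functional.\<close>

theorem integrated_chain_rule:
  fixes \<nu> :: "'a measure" and V :: "real \<times> ('a \<times> 'a) \<Rightarrow> real" and p :: "'a \<Rightarrow> real \<Rightarrow> real"
  assumes J: "sigma_finite_measure J" "sets J = sets (\<nu> \<Otimes>\<^sub>M \<nu>)"
    and V: "integrable (lborel \<Otimes>\<^sub>M J) V"
    and fm[measurable]: "(\<lambda>(t, x). f t x) \<in> borel_measurable (borel \<Otimes>\<^sub>M \<nu>)"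
    and fi: "\<And>t. \<alpha> < t \<Longrightarrow> t < \<beta> \<Longrightarrow> integrable \<nu> (f t)"
    and weak: "\<And>s t A. \<alpha> < s \<Longrightarrow> s \<le> t \<Longrightarrow> t < \<beta> \<Longrightarrow> A \<in> sets \<nu> \<Longrightarrow>
      (\<integral>x. indicator A x * f t x \<partial>\<nu>) - (\<integral>x. indicator A x * f s x \<partial>\<nu>)
        = (\<integral>z. indicator A (snd (snd z)) * (indicator {s..t} (fst z) * V z) \<partial>(lborel \<Otimes>\<^sub>M J))"
    and pm[measurable]: "(\<lambda>(x, r). p x r) \<in> borel_measurable (\<nu> \<Otimes>\<^sub>M borel)"
    and mono: "\<And>x. mono (p x)"
    and finf[measurable]: "finf \<in> borel_measurable \<nu>"
    and p0: "AE x in \<nu>. p x (finf x) = 0"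
    and H: "\<And>t. \<alpha> < t \<Longrightarrow> t < \<beta> \<Longrightarrow> integrable \<nu> (\<lambda>x. LBINT s=ereal (finf x)..ereal (f t x). p x s)"
    and pV: "integrable (lborel \<Otimes>\<^sub>M J) (\<lambda>(t, z). p (snd z) (f t (snd z)) * V (t, z))"
    and ab: "\<alpha> < a" "a \<le> b" "b < \<beta>"
  shows "(\<integral>x. (LBINT s=ereal (finf x)..ereal (f b x). p x s) \<partial>\<nu>) - (\<integral>x. (LBINT s=ereal (finf x)..ereal (f a x). p x s) \<partial>\<nu>)
    = (\<integral>(t, z). indicator {a..b} t * (p (snd z) (f t (snd z)) * V (t, z)) \<partial>(lborel \<Otimes>\<^sub>M J))"
proof -
  let ?M = "(lborel :: real measure) \<Otimes>\<^sub>M J"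
  have [measurable_cong]: "sets J = sets (\<nu> \<Otimes>\<^sub>M \<nu>)" by fact
  have [measurable]: "V \<in> borel_measurable ?M" using V by auto
  have [measurable]: "f t \<in> borel_measurable \<nu>" for t
    using measurable_compose[OF measurable_Pair1'[of t borel \<nu>] fm] by simp
  have [measurable]: "p x \<in> borel_measurable borel" for x
    by (rule borel_measurable_mono[OF mono])
  have mono': "mono (\<lambda>r. trunc n (p x r))" for n x
    using mono[of x] mono_trunc[of n] by (auto simp: mono_def)
  define P where "P t x = (\<integral>s. oriented (finf x) (f t x) s * p x s \<partial>lborel)" for t x
  define Pn where "Pn n t x = (\<integral>s. oriented (finf x) (f t x) s * trunc n (p x s) \<partial>lborel)" for n t x
  have Pn_meas[measurable]: "Pn n t \<in> borel_measurable \<nu>" for n t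
    unfolding Pn_def by measurable
  have P_meas[measurable]: "P t \<in> borel_measurable \<nu>" for t
    unfolding P_def by measurable
  have P_int: "integrable \<nu> (P t)" if "\<alpha> < t" "t < \<beta>" for t
    using H[OF that] by (simp add: interval_integral_oriented P_def[abs_def])
  \<comment> \<open>Monotonicity and the zero at \<open>finf x\<close> give \<open>p x\<close> the
    sign of the orientation, so both integrands are nonnegative and clipping can only lower
    them.\<close>
  have Pn_le: "\<bar>Pn n t x\<bar> \<le> P t x" if "p x (finf x) = 0" for n t x
  proof -
    have "0 \<le> oriented (finf x) (f t x) s * trunc n (p x s) \<and> oriented (finf x) (f t x) s * trunc n (p x s) \<le> oriented (finf x) (f t x) s * p x s" for s
      using monoD[OF mono[of x], of s "finf x"] monoD[OF mono[of x], of "finf x" s] that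
      by (auto simp: oriented_def trunc_def)
    then show ?thesis
      unfolding Pn_def P_def
      by (subst abs_of_nonneg) (auto intro!: integral_nonneg_AE integral_mono oriented_integrable_mono mono mono')
  qed
  have Pn_int: "integrable \<nu> (Pn n t)" if "\<alpha> < t" "t < \<beta>" for n t
    by (rule Bochner_Integration.integrable_bound[OF P_int[OF that]])
      (use p0 in \<open>auto elim!: eventually_mono intro: order_trans[OF Pn_le abs_ge_self]\<close>)
  have Pn_tendsto: "(\<lambda>n. Pn n t x) \<longlonglongrightarrow> P t x" for t x
    unfolding Pn_def P_def
  proof (rule integral_dominated_convergence[where w = "\<lambda>s. \<bar>oriented (finf x) (f t x) s * p x s\<bar>"])
    show "integrable lborel (\<lambda>s. \<bar>oriented (finf x) (f t x) s * p x s\<bar>)"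
      by (intro integrable_abs oriented_integrable_mono mono)
    show "AE s in lborel. (\<lambda>n. oriented (finf x) (f t x) s * trunc n (p x s)) \<longlonglongrightarrow> oriented (finf x) (f t x) s * p x s"
      by (intro AE_I2 tendsto_mult tendsto_const trunc_tendsto)
  qed (auto simp: abs_mult abs_trunc intro!: mult_left_mono)
  define W where "W n t z = trunc n (p (snd z) (f t (snd z)))" for n t and z :: "'a \<times> 'a"
  have W_meas[measurable]: "(\<lambda>(t, z). W n t z) \<in> borel_measurable ?M" for n
    unfolding W_def by measurable
  have step: "(\<integral>x. Pn n b x \<partial>\<nu>) - (\<integral>x. Pn n a x \<partial>\<nu>)
    = (\<integral>z. indicator {a..b} (fst z) * (W n (fst z) (snd z) * V z) \<partial>?M)" for n
  proof (rule integral_eq_of_subgradient[OF J(1) V W_meas, where n = "real n" and \<alpha> = \<alpha> and \<beta> = \<beta>])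
    show "\<bar>W n t z\<bar> \<le> real n" for t z by (simp add: W_def abs_trunc)
    fix s t assume st: "\<alpha> < s" "s < \<beta>" "\<alpha> < t" "t < \<beta>"
    \<comment> \<open>The subgradient at the fixed time \<open>s\<close>. It is tested against the
      equation on the interval between \<open>s\<close> and \<open>t\<close>, whichever of the two
      comes first.\<close>
    define u where "u x = trunc n (p x (f s x))" for x
    have [measurable]: "u \<in> borel_measurable \<nu>" unfolding u_def by measurable
    have ub: "\<bar>u x\<bar> \<le> real n" for x by (simp add: u_def abs_trunc)
    have test: "(\<integral>x. u x * (f t' x - f s' x) \<partial>\<nu>) = (\<integral>z. indicator {s'..t'} (fst z) * (W n s (snd z) * V z) \<partial>?M)"
      if "\<alpha> < s'" "s' \<le> t'" "t' < \<beta>" for s' t'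
    proof -
      have "(\<integral>x. u x * (f t' x - f s' x) \<partial>\<nu>) = (\<integral>z. u (snd (snd z)) * (indicator {s'..t'} (fst z) * V z) \<partial>?M)"
      proof (rule integral_test_function[where \<pi> = "\<lambda>z. snd (snd z)", OF _ _ fi fi weak _ ub])
        have "integrable ?M (\<lambda>z. indicator ({s'..t'} \<times> space J) z *\<^sub>R V z)"
          by (intro integrable_mult_indicator V) auto
        also have "?this \<longleftrightarrow> integrable ?M (\<lambda>z. indicator {s'..t'} (fst z) * V z)"
          by (intro Bochner_Integration.integrable_cong) (auto simp: space_pair_measure indicator_def)
        finally show "integrable ?M (\<lambda>z. indicator {s'..t'} (fst z) * V z)" .
      qed (use that in auto)
      then show ?thesis
        by (simp add: u_def W_def mult_ac)
    qed
    have "sgn (t - s) * (\<integral>z. indicator {min s t..max s t} (fst z) * (W n s (snd z) * V z) \<partial>?M) = (\<integral>x. u x * (f t x - f s x) \<partial>\<nu>)"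
    proof (cases "s \<le> t")
      case True
      then show ?thesis using test[of s t] st by (cases "s = t") auto
    next
      case False
      then have "(\<integral>z. indicator {t..s} (fst z) * (W n s (snd z) * V z) \<partial>?M) = (\<integral>x. u x * (f s x - f t x) \<partial>\<nu>)"
        using test[of t s] st by simp
      also have "\<dots> = - (\<integral>x. u x * (f t x - f s x) \<partial>\<nu>)"
        unfolding Bochner_Integration.integral_minus[symmetric]
        by (intro Bochner_Integration.integral_cong) (auto simp: algebra_simps)
      finally show ?thesis using False by (simp add: min_def max_def)
    qed
    also have "\<dots> \<le> (\<integral>x. Pn n t x - Pn n s x \<partial>\<nu>)"
    proof (rule integral_mono)
      have i: "integrable \<nu> (\<lambda>x. real n * (f t x - f s x))" using fi st by simp
      have "\<bar>u x\<bar> * \<bar>f t x - f s x\<bar> \<le> real n * \<bar>f t x - f s x\<bar>" for x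
        using ub by (intro mult_right_mono) auto
      then show "integrable \<nu> (\<lambda>x. u x * (f t x - f s x))"
        by (intro Bochner_Integration.integrable_bound[OF i]) (auto simp: abs_mult)
      show "integrable \<nu> (\<lambda>x. Pn n t x - Pn n s x)" using Pn_int st by simp
      show "u x * (f t x - f s x) \<le> Pn n t x - Pn n s x" for x
        unfolding u_def Pn_def by (rule oriented_integral_subgradient[OF mono'])
    qed
    also have "\<dots> = (\<integral>x. Pn n t x \<partial>\<nu>) - (\<integral>x. Pn n s x \<partial>\<nu>)"
      using Pn_int st by simp
    finally show "sgn (t - s) * (\<integral>z. indicator {min s t..max s t} (fst z) * (W n s (snd z) * V z) \<partial>?M)
      \<le> (\<integral>x. Pn n t x \<partial>\<nu>) - (\<integral>x. Pn n s x \<partial>\<nu>)" .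
  qed (use ab in auto)
  have lim: "(\<lambda>n. \<integral>x. Pn n t x \<partial>\<nu>) \<longlonglongrightarrow> (\<integral>x. P t x \<partial>\<nu>)" if "\<alpha> < t" "t < \<beta>" for t
  proof (rule integral_dominated_convergence[where w = "P t"])
    show "AE x in \<nu>. (\<lambda>n. Pn n t x) \<longlonglongrightarrow> P t x" by (intro AE_I2 Pn_tendsto)
    show "AE x in \<nu>. norm (Pn n t x) \<le> P t x" for n
      using p0 by eventually_elim (simp add: Pn_le)
  qed (use P_int[OF that] in simp_all)
  have rhs: "(\<lambda>n. \<integral>z. indicator {a..b} (fst z) * (W n (fst z) (snd z) * V z) \<partial>?M)
    \<longlonglongrightarrow> (\<integral>z. indicator {a..b} (fst z) * (p (snd (snd z)) (f (fst z) (snd (snd z))) * V z) \<partial>?M)"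
  proof (rule integral_dominated_convergence[where w = "\<lambda>z. \<bar>p (snd (snd z)) (f (fst z) (snd (snd z))) * V z\<bar>"])
    show "integrable ?M (\<lambda>z. \<bar>p (snd (snd z)) (f (fst z) (snd (snd z))) * V z\<bar>)"
      using integrable_abs[OF pV] by (simp add: case_prod_unfold)
    show "AE z in ?M. (\<lambda>n. indicator {a..b} (fst z) * (W n (fst z) (snd z) * V z))
      \<longlonglongrightarrow> indicator {a..b} (fst z) * (p (snd (snd z)) (f (fst z) (snd (snd z))) * V z)"
      unfolding W_def by (intro AE_I2 tendsto_mult tendsto_const trunc_tendsto)
    show "AE z in ?M. norm (indicator {a..b} (fst z) * (W n (fst z) (snd z) * V z)) \<le> \<bar>p (snd (snd z)) (f (fst z) (snd (snd z))) * V z\<bar>" for n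
      unfolding W_def by (intro AE_I2) (auto simp: abs_mult indicator_def abs_trunc intro!: mult_right_mono)
  qed measurable
  have lhs: "(\<lambda>n. (\<integral>x. Pn n b x \<partial>\<nu>) - (\<integral>x. Pn n a x \<partial>\<nu>)) \<longlonglongrightarrow> (\<integral>x. P b x \<partial>\<nu>) - (\<integral>x. P a x \<partial>\<nu>)"
    using ab by (intro tendsto_diff lim) auto
  have "(\<integral>x. P b x \<partial>\<nu>) - (\<integral>x. P a x \<partial>\<nu>) = (\<integral>z. indicator {a..b} (fst z) * (p (snd (snd z)) (f (fst z) (snd (snd z))) * V z) \<partial>?M)"
    by (rule LIMSEQ_unique[OF lhs[unfolded step] rhs])
  then show ?thesis
    by (simp add: interval_integral_oriented P_def[abs_def] case_prod_unfold)
qed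

section \<open>The measure \<open>K(x,dy) \<rho>(dx)\<close>\<close>

lemma sets_kernel_prod[measurable_cong]: "sets (kernel_prod M K) = sets (M \<Otimes>\<^sub>M M)"
  by (simp add: kernel_prod_def space_pair_measure[symmetric] sets.sigma_sets_eq)

lemma space_kernel_prod: "space (kernel_prod M K) = space M \<times> space M"
  using sets.space_closed[of "M \<Otimes>\<^sub>M M"] by (simp add: kernel_prod_def space_measure_of_conv space_pair_measure)

text \<open>Dynkin induction starting from rectangles. Finiteness is what allows the complement
  step, where the mass of a section is subtracted from the total mass.\<close>

lemma measurable_emeasure_finite_kernel:
  assumes sets: "\<And>x. x \<in> space M \<Longrightarrow> sets (K x) = sets N"
    and m: "\<And>A. A \<in> sets N \<Longrightarrow> (\<lambda>x. emeasure (K x) A) \<in> borel_measurable M"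
    and fin: "\<And>x. x \<in> space M \<Longrightarrow> emeasure (K x) (space N) < \<infinity>"
    and B: "B \<in> sets (M \<Otimes>\<^sub>M N)"
  shows "(\<lambda>x. emeasure (K x) (Pair x -` B)) \<in> borel_measurable M"
  using B unfolding sets_pair_measure
proof (induction rule: sigma_sets_induct_disjoint[OF Int_stable_pair_measure_generator pair_measure_closed,
    consumes 1, case_names basic empty compl union])
  case (basic B)
  then obtain A1 A2 where [measurable]: "A1 \<in> sets M" "A2 \<in> sets N" and B: "B = A1 \<times> A2" by auto
  have [measurable]: "(\<lambda>x. emeasure (K x) A2) \<in> borel_measurable M" by (rule m) fact
  have "emeasure (K x) (Pair x -` B) = indicator A1 x * emeasure (K x) A2" for x
    by (auto simp: B indicator_def)
  then show ?case by simp
next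
  case empty
  then show ?case by simp
next
  case (compl B)
  have [measurable]: "(\<lambda>x. emeasure (K x) (space N)) \<in> borel_measurable M" by (rule m) auto
  have [measurable]: "(\<lambda>x. emeasure (K x) (Pair x -` B)) \<in> borel_measurable M" by fact
  have B: "B \<in> sets (M \<Otimes>\<^sub>M N)" using compl by (simp add: sets_pair_measure)
  have "emeasure (K x) (Pair x -` (space M \<times> space N - B)) = emeasure (K x) (space N) - emeasure (K x) (Pair x -` B)"
    if x: "x \<in> space M" for x
  proof -
    have sp: "space (K x) = space N" using sets[OF x] by (rule sets_eq_imp_space_eq)
    have "Pair x -` (space M \<times> space N - B) = space N - Pair x -` B" using x by auto
    moreover have "Pair x -` B \<in> sets (K x)" using sets_Pair1[OF B] sets[OF x] by simp
    moreover have "emeasure (K x) (Pair x -` B) \<noteq> \<infinity>"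
      using emeasure_space[of "K x" "Pair x -` B"] fin[OF x] sp by (auto simp: top_unique)
    ultimately show ?thesis
      using sets[OF x] sets.sets_into_space[of "Pair x -` B" N]
      by (subst emeasure_Diff[symmetric]) auto
  qed
  then show ?case by (subst measurable_cong) auto
next
  case (union B)
  have [measurable]: "(\<lambda>x. emeasure (K x) (Pair x -` B i)) \<in> borel_measurable M" for i by (rule union)
  have B: "B i \<in> sets (M \<Otimes>\<^sub>M N)" for i using union(2) by (auto simp: sets_pair_measure)
  have "emeasure (K x) (Pair x -` (\<Union>i. B i)) = (\<Sum>i. emeasure (K x) (Pair x -` B i))" if x: "x \<in> space M" for x
  proof -
    have "disjoint_family (\<lambda>i. Pair x -` B i)"
      using union(1) unfolding disjoint_family_on_def by blast
    then show ?thesis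
      using sets[OF x] sets_Pair1[OF B, of x]
      by (subst suminf_emeasure) (auto simp: vimage_UN image_subset_iff)
  qed
  then show ?case by (subst measurable_cong) auto
qed

lemma emeasure_kernel_prod:
  assumes K: "measure_kernel M K" and fin: "AE x in M. emeasure (K x) (space M) < \<infinity>"
    and B: "B \<in> sets (M \<Otimes>\<^sub>M M)"
  shows "emeasure (kernel_prod M K) B = (\<integral>\<^sup>+x. emeasure (K x) (Pair x -` B) \<partial>M)"
proof (rule emeasure_measure_of[OF kernel_prod_def])
  have sets: "sets (K x) = sets M" if "x \<in> space M" for x using K that by (simp add: measure_kernel_def)
  have m[measurable]: "(\<lambda>x. emeasure (K x) A) \<in> borel_measurable M" if "A \<in> sets M" for A
    using K that by (simp add: measure_kernel_def)
  \<comment> \<open>Measurability of the masses of sections was shown for finite kernels. Where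
    \<open>K x\<close> is infinite it is replaced by the null measure; this happens on a null set
    and leaves every integral unchanged.\<close>
  define K' where "K' x = (if emeasure (K x) (space M) < \<infinity> then K x else null_measure M)" for x
  have m': "(\<lambda>x. emeasure (K' x) (Pair x -` B)) \<in> borel_measurable M" if "B \<in> sets (M \<Otimes>\<^sub>M M)" for B
  proof (rule measurable_emeasure_finite_kernel[OF _ _ _ that])
    fix A assume [measurable]: "A \<in> sets M"
    have "emeasure (K' x) A = (if emeasure (K x) (space M) < \<infinity> then emeasure (K x) A else 0)" for x
      by (simp add: K'_def)
    then show "(\<lambda>x. emeasure (K' x) A) \<in> borel_measurable M" by simp
  qed (auto simp: K'_def sets)
  have eq: "(\<integral>\<^sup>+x. emeasure (K x) (Pair x -` B) \<partial>M) = (\<integral>\<^sup>+x. emeasure (K' x) (Pair x -` B) \<partial>M)" for B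
    using fin by (intro nn_integral_cong_AE) (auto elim!: eventually_mono simp: K'_def)
  show "sets (M \<Otimes>\<^sub>M M) \<subseteq> Pow (space M \<times> space M)"
    using sets.space_closed[of "M \<Otimes>\<^sub>M M"] by (simp add: space_pair_measure)
  show "positive (sets (kernel_prod M K)) (\<lambda>B. \<integral>\<^sup>+x. emeasure (K x) (Pair x -` B) \<partial>M)"
    by (simp add: positive_def)
  show "countably_additive (sets (kernel_prod M K)) (\<lambda>B. \<integral>\<^sup>+x. emeasure (K x) (Pair x -` B) \<partial>M)"
    unfolding countably_additive_def eq sets_kernel_prod
  proof (intro allI impI)
    fix A :: "nat \<Rightarrow> ('a \<times> 'a) set"
    assume A: "range A \<subseteq> sets (M \<Otimes>\<^sub>M M)" "disjoint_family A"
    have "(\<Sum>i. \<integral>\<^sup>+x. emeasure (K' x) (Pair x -` A i) \<partial>M) = (\<integral>\<^sup>+x. (\<Sum>i. emeasure (K' x) (Pair x -` A i)) \<partial>M)"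
      using A by (intro nn_integral_suminf[symmetric] m') auto
    also have "\<dots> = (\<integral>\<^sup>+x. emeasure (K' x) (Pair x -` (\<Union>i. A i)) \<partial>M)"
    proof (rule nn_integral_cong)
      fix x assume x: "x \<in> space M"
      have "sets (K' x) = sets M" using sets[OF x] by (simp add: K'_def)
      moreover have "disjoint_family (\<lambda>i. Pair x -` A i)"
        using A(2) unfolding disjoint_family_on_def by blast
      ultimately show "(\<Sum>i. emeasure (K' x) (Pair x -` A i)) = emeasure (K' x) (Pair x -` (\<Union>i. A i))"
        using A(1) sets_Pair1[of _ M M x]
        by (subst suminf_emeasure) (auto simp: vimage_UN image_subset_iff)
    qed
    finally show "(\<Sum>i. \<integral>\<^sup>+x. emeasure (K' x) (Pair x -` A i) \<partial>M) = (\<integral>\<^sup>+x. emeasure (K' x) (Pair x -` (\<Union>i. A i)) \<partial>M)" .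
  qed
  show "B \<in> sets (kernel_prod M K)" using B by (simp add: sets_kernel_prod)
qed

lemma emeasure_kernel_prod_Times:
  assumes K: "measure_kernel M K" "AE x in M. emeasure (K x) (space M) < \<infinity>"
    and A: "A \<in> sets M" "B \<in> sets M"
  shows "emeasure (kernel_prod M K) (A \<times> B) = (\<integral>\<^sup>+x. indicator A x * emeasure (K x) B \<partial>M)"
  using A by (subst emeasure_kernel_prod[OF K]) (auto intro!: nn_integral_cong simp: indicator_def)

text \<open>Both sides integrate \<open>u\<close> against one measure: restrict
  \<open>kernel_prod M K\<close> to pairs with second coordinate in \<open>A\<close> and project to
  the first coordinate; the rectangle formula identifies the result as \<open>M\<close> with density
  \<open>emeasure (K x) A\<close>.\<close>

lemma nn_integral_kernel_prod_fst:
  assumes K: "measure_kernel M K" "AE x in M. emeasure (K x) (space M) < \<infinity>"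
    and u[measurable]: "u \<in> borel_measurable M" and A[measurable]: "A \<in> sets M"
  shows "(\<integral>\<^sup>+z. u (fst z) * indicator A (snd z) \<partial>kernel_prod M K) = (\<integral>\<^sup>+x. u x * emeasure (K x) A \<partial>M)"
proof -
  let ?J = "kernel_prod M K"
  have [measurable]: "(\<lambda>x. emeasure (K x) A) \<in> borel_measurable M"
    using K A by (simp add: measure_kernel_def)
  have "distr (density ?J (\<lambda>z. indicator A (snd z))) M fst = density M (\<lambda>x. emeasure (K x) A)"
  proof (rule measure_eqI)
    fix B assume "B \<in> sets (distr (density ?J (\<lambda>z. indicator A (snd z))) M fst)"
    then have [measurable]: "B \<in> sets M" by simp
    have "emeasure (distr (density ?J (\<lambda>z. indicator A (snd z))) M fst) B
       = (\<integral>\<^sup>+z. indicator A (snd z) * indicator (fst -` B \<inter> space ?J) z \<partial>?J)"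
      by (subst emeasure_distr, simp, simp, subst emeasure_density) auto
    also have "\<dots> = (\<integral>\<^sup>+z. indicator (B \<times> A) z \<partial>?J)"
      by (intro nn_integral_cong) (auto simp: indicator_def)
    also have "\<dots> = emeasure ?J (B \<times> A)"
      by (rule nn_integral_indicator) simp
    also have "\<dots> = emeasure (density M (\<lambda>x. emeasure (K x) A)) B"
      by (subst emeasure_kernel_prod_Times[OF K]) (simp_all add: emeasure_density mult.commute)
    finally show "emeasure (distr (density ?J (\<lambda>z. indicator A (snd z))) M fst) B = emeasure (density M (\<lambda>x. emeasure (K x) A)) B" .
  qed simp
  then have "(\<integral>\<^sup>+x. u x \<partial>distr (density ?J (\<lambda>z. indicator A (snd z))) M fst) = (\<integral>\<^sup>+x. u x \<partial>density M (\<lambda>x. emeasure (K x) A))"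
    by simp
  then show ?thesis
    by (simp add: nn_integral_distr nn_integral_density mult.commute)
qed

lemma AE_finite_of_weighted:
  assumes c[measurable]: "c \<in> borel_measurable M" and k[measurable]: "k \<in> borel_measurable M"
    and pos: "AE x in M. 0 < c x" and fin: "(\<integral>\<^sup>+x. c x * k x \<partial>M) < \<infinity>"
  shows "AE x in M. k x < (\<infinity> :: ennreal)"
proof -
  have "AE x in M. c x * k x \<noteq> \<infinity>"
    using fin by (intro nn_integral_PInf_AE) auto
  with pos show ?thesis
    by eventually_elim (auto simp: ennreal_mult_eq_top_iff less_top[symmetric])
qed

text \<open>Where \<open>c\<close> is at least \<open>1/n\<close>, the rate is at most
  \<open>n\<close> times the weighted rate, so the strips over these sets have finite mass; the
  strip over \<open>c = 0\<close> sits over a null set. The weight serves part (2), where the finite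
  rate at hand is the one weighted by \<open>\<sigma> (finf x)\<close>.\<close>

lemma sigma_finite_kernel_prod:
  assumes K: "measure_kernel M K"
    and c[measurable]: "c \<in> borel_measurable M" and pos: "AE x in M. 0 < c x"
    and fin: "(\<integral>\<^sup>+x. c x * emeasure (K x) (space M) \<partial>M) < \<infinity>"
  shows "sigma_finite_measure (kernel_prod M K)"
proof -
  let ?k = "\<lambda>x. emeasure (K x) (space M)"
  have k[measurable]: "?k \<in> borel_measurable M"
    using K by (simp add: measure_kernel_def)
  have finK: "AE x in M. ?k x < \<infinity>" by (rule AE_finite_of_weighted[OF c k pos fin])
  define A where "A n = {x \<in> space M. 1 \<le> of_nat n * c x}" for n :: nat
  have [measurable]: "A n \<in> sets M" for n unfolding A_def by measurable
  define Z where "Z = {x \<in> space M. c x = 0}"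
  have [measurable]: "Z \<in> sets M" unfolding Z_def by measurable
  let ?C = "insert (Z \<times> space M) (range (\<lambda>n. A n \<times> space M))"
  show ?thesis
  proof (unfold sigma_finite_measure_def, intro exI[of _ ?C] conjI ballI)
    show "countable ?C" by auto
    show "?C \<subseteq> sets (kernel_prod M K)" by (auto simp: sets_kernel_prod)
    have "x \<in> Z \<or> (\<exists>n. x \<in> A n)" if x: "x \<in> space M" for x
    proof (cases "c x = 0")
      case False
      have "\<exists>n. 1 \<le> of_nat n * c x"
      proof (cases "c x")
        case (real r)
        then have "0 < r" using False by (auto simp: less_le)
        then obtain n where "1 < of_nat n * r" using ex_less_of_nat_mult by blast
        then have "ennreal 1 \<le> ennreal (real n * r)" by (intro ennreal_leI) simp
        with real show ?thesis
          by (intro exI[of _ n]) (simp add: ennreal_mult ennreal_of_nat_eq_real_of_nat)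
      qed (auto intro!: exI[of _ 1])
      then show ?thesis using x by (auto simp: A_def)
    qed (use x in \<open>simp add: Z_def\<close>)
    then show "\<Union>?C = space (kernel_prod M K)"
      by (auto simp: space_kernel_prod Z_def A_def)
    fix C assume "C \<in> ?C"
    then consider "C = Z \<times> space M" | n where "C = A n \<times> space M" by auto
    then show "emeasure (kernel_prod M K) C \<noteq> \<infinity>"
    proof cases
      case 1
      have "(\<integral>\<^sup>+x. indicator Z x * ?k x \<partial>M) = (\<integral>\<^sup>+x. 0 \<partial>M)"
        using pos by (intro nn_integral_cong_AE) (auto elim!: eventually_mono simp: Z_def indicator_def)
      then show ?thesis
        unfolding 1 by (subst emeasure_kernel_prod_Times[OF K finK]) auto
    next
      case 2
      have "(\<integral>\<^sup>+x. indicator (A n) x * ?k x \<partial>M) \<le> (\<integral>\<^sup>+x. of_nat n * (c x * ?k x) \<partial>M)"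
      proof (rule nn_integral_mono)
        fix x
        show "indicator (A n) x * ?k x \<le> of_nat n * (c x * ?k x)"
        proof (cases "x \<in> A n")
          case True
          then have "1 * ?k x \<le> of_nat n * c x * ?k x" by (intro mult_right_mono) (auto simp: A_def)
          with True show ?thesis by (simp add: mult.assoc)
        qed simp
      qed
      also have "\<dots> = of_nat n * (\<integral>\<^sup>+x. c x * ?k x \<partial>M)" by (intro nn_integral_cmult) auto
      also have "\<dots> < \<infinity>" using fin by (auto simp: ennreal_mult_less_top of_nat_less_top)
      finally show ?thesis
        unfolding 2 by (subst emeasure_kernel_prod_Times[OF K finK]) auto
    qed
  qed
qed

section \<open>Equal marginals, and the scattering operator as an integral over pairs of
  points\<close>

lemma distr_fst_eq_snd_kernel_prod:
  assumes "\<And>A. A \<in> sets M \<Longrightarrow> emeasure (kernel_prod M K) (A \<times> space M) = emeasure (kernel_prod M K) (space M \<times> A)"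
  shows "distr (kernel_prod M K) M fst = distr (kernel_prod M K) M snd"
proof (rule measure_eqI)
  fix A assume "A \<in> sets (distr (kernel_prod M K) M fst)"
  then have A: "A \<in> sets M" by simp
  then have "fst -` A \<inter> space (kernel_prod M K) = A \<times> space M" "snd -` A \<inter> space (kernel_prod M K) = space M \<times> A"
    using sets.sets_into_space[OF A] by (auto simp: space_kernel_prod)
  then show "emeasure (distr (kernel_prod M K) M fst) A = emeasure (distr (kernel_prod M K) M snd) A"
    using assms[OF A] A by (simp add: emeasure_distr)
qed simp

text \<open>The mass of \<open>space M \<times> A\<close> is the gain of \<open>A\<close>, that of
  \<open>A \<times> space M\<close> its loss. \<open>scattering\<close> compares the two as reals,
  where an infinite value would read as 0; finiteness of the total rate carries the equality back to
  extended values.\<close>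

lemma stationary_marginals:
  assumes K: "measure_kernel M K" and st: "stationary K M"
  shows "distr (kernel_prod M K) M fst = distr (kernel_prod M K) M snd"
proof (rule distr_fst_eq_snd_kernel_prod)
  fix A assume A: "A \<in> sets M"
  have [measurable]: "(\<lambda>x. emeasure (K x) B) \<in> borel_measurable M" if "B \<in> sets M" for B
    using K that by (simp add: measure_kernel_def)
  have tot: "(\<integral>\<^sup>+x. emeasure (K x) (space M) \<partial>M) < \<infinity>"
    using st by (simp add: stationary_def total_rate_def)
  have fin: "AE x in M. emeasure (K x) (space M) < \<infinity>"
    using AE_finite_of_weighted[of "\<lambda>_. 1" M "\<lambda>x. emeasure (K x) (space M)"] tot by simp
  have "emeasure (K x) A \<le> emeasure (K x) (space M)" if "x \<in> space M" for x
    using K A sets.sets_into_space[OF A] that by (intro emeasure_mono) (auto simp: measure_kernel_def)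
  then have g: "(\<integral>\<^sup>+x. emeasure (K x) A \<partial>M) \<le> (\<integral>\<^sup>+x. emeasure (K x) (space M) \<partial>M)"
    by (intro nn_integral_mono)
  have l: "(\<integral>\<^sup>+x\<in>A. emeasure (K x) (space M) \<partial>M) \<le> (\<integral>\<^sup>+x. emeasure (K x) (space M) \<partial>M)"
    by (intro nn_integral_mono) (auto simp: indicator_def)
  have "enn2real (\<integral>\<^sup>+x. emeasure (K x) A \<partial>M) = enn2real (\<integral>\<^sup>+x\<in>A. emeasure (K x) (space M) \<partial>M)"
    using st A by (simp add: stationary_def scattering_def)
  then have "(\<integral>\<^sup>+x. emeasure (K x) A \<partial>M) = (\<integral>\<^sup>+x\<in>A. emeasure (K x) (space M) \<partial>M)"
    using ennreal_enn2real[of "\<integral>\<^sup>+x. emeasure (K x) A \<partial>M"]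
      ennreal_enn2real[of "\<integral>\<^sup>+x\<in>A. emeasure (K x) (space M) \<partial>M"] le_less_trans[OF g tot] le_less_trans[OF l tot]
    by simp
  then show "emeasure (kernel_prod M K) (A \<times> space M) = emeasure (kernel_prod M K) (space M \<times> A)"
    using A by (simp add: emeasure_kernel_prod_Times[OF K fin] mult.commute cong: nn_integral_cong)
qed

text \<open>The swap of coordinates preserves the measure and exchanges the two strips over
  \<open>A\<close>.\<close>

lemma reversible_marginals:
  assumes rev: "reversible K M"
  shows "distr (kernel_prod M K) M fst = distr (kernel_prod M K) M snd"
proof (rule distr_fst_eq_snd_kernel_prod)
  fix A assume A[measurable]: "A \<in> sets M"
  let ?J = "kernel_prod M K"
  have "emeasure ?J (A \<times> space M) = emeasure (distr ?J (M \<Otimes>\<^sub>M M) (\<lambda>(x, y). (y, x))) (A \<times> space M)"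
    using rev by (simp add: reversible_def)
  also have "\<dots> = emeasure ?J ((\<lambda>(x, y). (y, x)) -` (A \<times> space M) \<inter> space ?J)"
    by (rule emeasure_distr) simp_all
  also have "(\<lambda>(x, y). (y, x)) -` (A \<times> space M) \<inter> space ?J = space M \<times> A"
    using sets.sets_into_space[OF A] by (auto simp: space_kernel_prod)
  finally show "emeasure ?J (A \<times> space M) = emeasure ?J (space M \<times> A)" .
qed

lemma total_rate_density:
  assumes K: "measure_kernel M K" "AE x in M. emeasure (K x) (space M) < \<infinity>"
    and v[measurable]: "v \<in> borel_measurable M"
  shows "total_rate K (density M v) = (\<integral>\<^sup>+z. v (fst z) \<partial>kernel_prod M K)"
proof -
  have [measurable]: "(\<lambda>x. emeasure (K x) B) \<in> borel_measurable M" if "B \<in> sets M" for B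
    using K that by (simp add: measure_kernel_def)
  have "total_rate K (density M v) = (\<integral>\<^sup>+x. v x * emeasure (K x) (space M) \<partial>M)"
    by (simp add: total_rate_def nn_integral_density)
  also have "\<dots> = (\<integral>\<^sup>+z. v (fst z) * indicator (space M) (snd z) \<partial>kernel_prod M K)"
    by (rule nn_integral_kernel_prod_fst[OF K, symmetric]) auto
  also have "\<dots> = (\<integral>\<^sup>+z. v (fst z) \<partial>kernel_prod M K)"
    by (intro nn_integral_cong) (auto simp: space_kernel_prod)
  finally show ?thesis .
qed

text \<open>The loss term lives on pairs whose first coordinate lies in \<open>A\<close>. Equality
  of the marginals moves it to the second coordinate, where the gain already has its indicator, so
  that gain and loss can be combined into a difference of \<open>v\<close> at the two points, tested
  at the second.\<close>

lemma scattering_density_nn: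
  assumes K: "measure_kernel M K" "AE x in M. emeasure (K x) (space M) < \<infinity>"
    and marg: "distr (kernel_prod M K) M fst = distr (kernel_prod M K) M snd"
    and v[measurable]: "v \<in> borel_measurable M" and A[measurable]: "A \<in> sets M"
  shows "scattering K (density M v) A =
    enn2real (\<integral>\<^sup>+z. v (fst z) * indicator A (snd z) \<partial>kernel_prod M K) -
    enn2real (\<integral>\<^sup>+z. v (snd z) * indicator A (snd z) \<partial>kernel_prod M K)"
proof -
  let ?J = "kernel_prod M K"
  have mK[measurable]: "(\<lambda>x. emeasure (K x) B) \<in> borel_measurable M" if "B \<in> sets M" for B
    using K that by (simp add: measure_kernel_def)
  have "(\<integral>\<^sup>+y. emeasure (K y) A \<partial>density M v) = (\<integral>\<^sup>+x. v x * emeasure (K x) A \<partial>M)"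
    by (rule nn_integral_density) auto
  also have "\<dots> = (\<integral>\<^sup>+z. v (fst z) * indicator A (snd z) \<partial>?J)"
    by (rule nn_integral_kernel_prod_fst[OF K, symmetric]) auto
  finally have gain: "(\<integral>\<^sup>+y. emeasure (K y) A \<partial>density M v) = (\<integral>\<^sup>+z. v (fst z) * indicator A (snd z) \<partial>?J)" .
  have "(\<integral>\<^sup>+x\<in>A. emeasure (K x) (space M) \<partial>density M v) = (\<integral>\<^sup>+x. (v x * indicator A x) * emeasure (K x) (space M) \<partial>M)"
    by (subst nn_integral_density) (auto simp: mult_ac)
  also have "\<dots> = (\<integral>\<^sup>+z. (v (fst z) * indicator A (fst z)) * indicator (space M) (snd z) \<partial>?J)"
    by (rule nn_integral_kernel_prod_fst[OF K, symmetric]) auto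
  also have "\<dots> = (\<integral>\<^sup>+z. v (fst z) * indicator A (fst z) \<partial>?J)"
    by (intro nn_integral_cong) (auto simp: space_kernel_prod)
  also have "\<dots> = (\<integral>\<^sup>+z. v (snd z) * indicator A (snd z) \<partial>?J)"
    using arg_cong[OF marg, of "\<lambda>N. \<integral>\<^sup>+x. v x * indicator A x \<partial>N"] by (simp add: nn_integral_distr)
  finally have loss: "(\<integral>\<^sup>+x\<in>A. emeasure (K x) (space M) \<partial>density M v) = (\<integral>\<^sup>+z. v (snd z) * indicator A (snd z) \<partial>?J)" .
  show ?thesis
    unfolding scattering_def space_density gain loss ..
qed

lemma scattering_density:
  fixes v :: "'a \<Rightarrow> real"
  assumes K: "measure_kernel M K" "AE x in M. emeasure (K x) (space M) < \<infinity>"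
    and marg: "distr (kernel_prod M K) M fst = distr (kernel_prod M K) M snd"
    and v[measurable]: "v \<in> borel_measurable M" and nn: "\<And>x. 0 \<le> v x"
    and i: "integrable (kernel_prod M K) (\<lambda>z. v (fst z))" "integrable (kernel_prod M K) (\<lambda>z. v (snd z))"
    and A[measurable]: "A \<in> sets M"
  shows "scattering K (density M (\<lambda>x. ennreal (v x))) A = (\<integral>z. indicator A (snd z) * (v (fst z) - v (snd z)) \<partial>kernel_prod M K)"
proof -
  let ?J = "kernel_prod M K"
  have ia: "integrable ?J (\<lambda>z. indicator A (snd z) * v (fst z))" "integrable ?J (\<lambda>z. indicator A (snd z) * v (snd z))"
    by (rule Bochner_Integration.integrable_bound[OF i(1)], auto simp: indicator_def)
      (rule Bochner_Integration.integrable_bound[OF i(2)], auto simp: indicator_def)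
  have e: "ennreal (v x) * indicator A y = ennreal (indicator A y * v x)" for x y
    by (simp add: indicator_def)
  have "scattering K (density M (\<lambda>x. ennreal (v x))) A
      = (\<integral>z. indicator A (snd z) * v (fst z) \<partial>?J) - (\<integral>z. indicator A (snd z) * v (snd z) \<partial>?J)"
    using nn by (subst scattering_density_nn[OF K marg _ A], simp, unfold e, subst (1 2) integral_eq_nn_integral) auto
  then show ?thesis
    unfolding right_diff_distrib by (simp add: Bochner_Integration.integral_diff[OF ia])
qed

section \<open>Distributional derivatives\<close>

text \<open>The open enclosure matters: a function that is zero off \<open>C\<close> vanishes at
  both \<open>a\<close> and \<open>b\<close>.\<close>

lemma compact_subset_einterval:
  assumes T: "0 < T" and C: "compact C" "C \<subseteq> einterval 0 T"
  obtains a b where "0 < a" "a < b" "ereal b < T" "C \<subseteq> {a<..<b}"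
proof (cases "C = {}")
  case True
  from ereal_dense2[OF T] obtain b where "0 < ereal b" "ereal b < T" by (auto simp: zero_ereal_def)
  then show ?thesis using that[of "b/2" b] True by (auto simp: zero_ereal_def)
next
  case False
  obtain l where l: "l \<in> C" "\<And>x. x \<in> C \<Longrightarrow> l \<le> x" using compact_attains_inf[OF C(1) False] by auto
  obtain r where r: "r \<in> C" "\<And>x. x \<in> C \<Longrightarrow> x \<le> r" using compact_attains_sup[OF C(1) False] by auto
  have "0 < l" "ereal r < T" using l r C by (auto simp: einterval_iff)
  obtain b where b: "ereal r < ereal b" "ereal b < T" using ereal_dense2[OF \<open>ereal r < T\<close>] by auto
  show ?thesis
  proof (rule that[of "l/2" b])
    show "C \<subseteq> {l/2<..<b}" using l r b \<open>0 < l\<close> by fastforce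
    show "l/2 < b" using l(2)[OF r(1)] b \<open>0 < l\<close> by simp
  qed (use \<open>0 < l\<close> b in auto)
qed

text \<open>Integration by parts through Fubini: with \<open>u t\<close> written as
  \<open>u a\<close> plus the integral of \<open>d\<close> over \<open>[a, t]\<close>, exchanging
  the order of integration leaves the inner integral of \<open>deriv \<phi>\<close> over
  \<open>[s, b]\<close>, which is \<open>- \<phi> s\<close>. The term with \<open>u a\<close> drops
  out because \<open>\<phi>\<close> vanishes at both ends.\<close>

lemma has_distr_deriv_of_increments:
  assumes T: "0 < T"
    and d: "\<And>a b. 0 < a \<Longrightarrow> a \<le> b \<Longrightarrow> ereal b < T \<Longrightarrow> set_integrable lborel {a..b} d"
    and u: "\<And>a b. 0 < a \<Longrightarrow> a \<le> b \<Longrightarrow> ereal b < T \<Longrightarrow> u b - u a = (LINT t:{a..b}|lborel. d t)"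
  shows "has_distr_deriv u d (einterval 0 T)"
proof -
  \<comment> \<open>On compact subintervals \<open>u\<close> is an indefinite integral plus a
    constant; the continuity gives its local integrability.\<close>
  have cont: "continuous_on {a..b} u" if ab: "0 < a" "a \<le> b" "ereal b < T" for a b
  proof -
    have "continuous_on {a..b} (\<lambda>t. u a + integral {a..t} d)"
      using set_borel_integral_eq_integral(1)[OF d[OF ab]]
      by (intro continuous_intros indefinite_integral_continuous_1)
    moreover have "u a + integral {a..t} d = u t" if t: "t \<in> {a..b}" for t
    proof -
      have tT: "ereal t < T" using t ab by (auto intro: le_less_trans[of "ereal t" "ereal b"])
      show ?thesis
        using set_borel_integral_eq_integral(2)[OF d[of a t]] u[of a t] t ab tT by auto
    qed
    ultimately show ?thesis by (metis (no_types, lifting) continuous_on_cong)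
  qed
  show ?thesis
    unfolding has_distr_deriv_def
  proof (intro conjI allI impI)
    fix C assume C: "compact C \<and> C \<subseteq> einterval 0 T"
    then obtain a b where ab: "0 < a" "a < b" "ereal b < T" "C \<subseteq> {a<..<b}"
      using compact_subset_einterval[OF T] by blast
    have Cm: "C \<in> sets lborel" using C by (auto simp: compact_imp_closed)
    have sub: "C \<subseteq> {a..b}" using ab(4) by force
    show "set_integrable lborel C u"
      by (rule set_integrable_subset[OF borel_integrable_atLeastAtMost'[OF cont] Cm sub]) (use ab in auto)
    show "set_integrable lborel C d"
      by (rule set_integrable_subset[OF d Cm sub]) (use ab in auto)
  next
    fix \<phi> assume test: "test_function (einterval 0 T) \<phi>"
    then obtain C where C: "compact C" "C \<subseteq> einterval 0 T" "\<And>t. t \<notin> C \<Longrightarrow> \<phi> t = 0"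
      unfolding test_function_def by blast
    then obtain a b where ab: "0 < a" "a < b" "ereal b < T" "C \<subseteq> {a<..<b}"
      using compact_subset_einterval[OF T] by blast
    have diff: "((deriv ^^ k) \<phi>) differentiable_on UNIV" for k
      using test unfolding test_function_def by blast
    have "\<phi> differentiable_on UNIV" "deriv \<phi> differentiable_on UNIV"
      using diff[of 0] diff[of 1] by simp_all
    then have D: "(\<phi> has_real_derivative deriv \<phi> t) (at t)" and contD: "continuous_on UNIV (deriv \<phi>)" for t
      by (auto simp: differentiable_on_def DERIV_deriv_iff_real_differentiable intro: differentiable_imp_continuous_on)
    have [measurable]: "deriv \<phi> \<in> borel_measurable borel"
      using contD by (rule borel_measurable_continuous_onI)
    have [measurable]: "\<phi> \<in> borel_measurable borel"
      using D by (intro borel_measurable_continuous_onI) (auto simp: continuous_on_eq_continuous_at intro: DERIV_isCont)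
    have \<phi>0: "\<phi> t = 0" if "t \<notin> {a<..<b}" for t using C(3) ab(4) that by blast
    \<comment> \<open>\<open>\<phi>\<close> vanishes on the open complement of \<open>C\<close>,
      hence so does its derivative.\<close>
    have D0: "deriv \<phi> t = 0" if t: "t \<notin> {a..b}" for t
    proof -
      have "open (- C)" using C(1) by (simp add: compact_imp_closed open_Compl)
      moreover have "t \<in> - C" using t ab(4) by force
      ultimately have "eventually (\<lambda>s. s \<in> - C) (nhds t)" by (rule eventually_nhds_in_open)
      then have "eventually (\<lambda>s. \<phi> s = 0) (nhds t)" by eventually_elim (use C(3) in auto)
      then have "deriv \<phi> t = deriv (\<lambda>_. 0) t" by (intro deriv_cong_ev) auto
      then show ?thesis by simp
    qed
    have sub: "{a..b} \<subseteq> einterval 0 T"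
    proof
      fix x assume "x \<in> {a..b}"
      then show "x \<in> einterval 0 T"
        using ab le_less_trans[of "ereal x" "ereal b" T] by (simp add: einterval_iff)
    qed
    define d' where "d' s = indicator {a..b} s * d s" for s
    have d': "integrable lborel d'"
      using d[of a b] ab by (simp add: d'_def[abs_def] set_integrable_def)
    then have [measurable]: "d' \<in> borel_measurable borel" by auto
    have "\<exists>B. \<forall>t\<in>{a..b}. \<bar>deriv \<phi> t\<bar> \<le> B"
      using compact_imp_bounded[OF compact_continuous_image[OF continuous_on_subset[OF contD] compact_Icc, of a b]]
      by (auto simp: bounded_iff)
    then obtain B where B: "\<And>t. t \<in> {a..b} \<Longrightarrow> \<bar>deriv \<phi> t\<bar> \<le> B" by blast
    \<comment> \<open>The double integrand on the triangle \<open>a \<le> s \<le> t \<le> b\<close>,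
      extended by 0. A majorant of product form, with \<open>B\<close> bounding
      \<open>deriv \<phi>\<close>, makes Fubini applicable.\<close>
    define k where "k t s = (if a \<le> s \<and> s \<le> t \<and> t \<le> b then d' s * deriv \<phi> t else 0)" for t s
    have [measurable]: "(\<lambda>(t, s). k t s) \<in> borel_measurable (lborel \<Otimes>\<^sub>M lborel)"
      unfolding k_def by measurable
    have ind: "integrable lborel (indicat_real {a..b})"
      by (rule integrable_real_indicator) (auto simp: emeasure_lborel_Icc_eq)
    have "integrable (lborel \<Otimes>\<^sub>M lborel) (\<lambda>(t, s). indicator {a..b} t * B * d' s)"
    proof (rule lborel_pair.Fubini_integrable)
      show "integrable lborel (\<lambda>t. \<integral>s. norm (case (t, s) of (t, s) \<Rightarrow> indicator {a..b} t * B * d' s) \<partial>lborel)"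
        by (simp add: abs_mult ind)
      show "AE t in lborel. integrable lborel (\<lambda>s. case (t, s) of (t, s) \<Rightarrow> indicator {a..b} t * B * d' s)"
        using d' by simp
    qed measurable
    then have k: "integrable (lborel \<Otimes>\<^sub>M lborel) (\<lambda>(t, s). k t s)"
    proof (rule Bochner_Integration.integrable_bound)
      show "AE x in lborel \<Otimes>\<^sub>M lborel. norm (case x of (t, s) \<Rightarrow> k t s) \<le> norm (case x of (t, s) \<Rightarrow> indicator {a..b} t * B * d' s)"
      proof (rule AE_I2, clarify)
        fix t s
        have "\<bar>deriv \<phi> t\<bar> * \<bar>d' s\<bar> \<le> \<bar>B\<bar> * \<bar>d' s\<bar>" if "t \<in> {a..b}"
          using B[OF that] by (intro mult_right_mono) auto
        then show "norm (k t s) \<le> norm (indicator {a..b} t * B * d' s)"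
          by (auto simp: k_def abs_mult mult.commute)
      qed
    qed measurable
    have "(LINT t:einterval 0 T|lborel. u t * deriv \<phi> t) = (LINT t:{a..b}|lborel. u t * deriv \<phi> t)"
      unfolding set_lebesgue_integral_def
      by (intro Bochner_Integration.integral_cong) (use sub D0 in \<open>auto simp: indicator_def\<close>)
    also have "\<dots> = (\<integral>t. u a * (indicator {a..b} t *\<^sub>R deriv \<phi> t) + (\<integral>s. k t s \<partial>lborel) \<partial>lborel)"
      unfolding set_lebesgue_integral_def
    proof (rule Bochner_Integration.integral_cong)
      fix t :: real
      show "indicator {a..b} t *\<^sub>R (u t * deriv \<phi> t) = u a * (indicator {a..b} t *\<^sub>R deriv \<phi> t) + (\<integral>s. k t s \<partial>lborel)"
      proof (cases "t \<in> {a..b}")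
        case True
        have "ereal t < T" using True ab by (auto intro: le_less_trans[of "ereal t" "ereal b"])
        then have uat: "u t - u a = (LINT s:{a..t}|lborel. d s)" using u[of a t] True ab by simp
        have "(\<integral>s. k t s \<partial>lborel) = (\<integral>s. (indicator {a..t} s *\<^sub>R d s) * deriv \<phi> t \<partial>lborel)"
          using True by (intro Bochner_Integration.integral_cong) (auto simp: k_def d'_def)
        then have "(\<integral>s. k t s \<partial>lborel) = (LINT s:{a..t}|lborel. d s) * deriv \<phi> t"
          by (simp only: Bochner_Integration.integral_mult_left_zero set_lebesgue_integral_def)
        then have "u t * deriv \<phi> t = u a * deriv \<phi> t + (\<integral>s. k t s \<partial>lborel)"
          by (simp add: left_diff_distrib flip: uat)
        then show ?thesis using True by simp
      next
        case False
        then have "k t s = 0" for s by (auto simp: k_def)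
        with False show ?thesis by simp
      qed
    qed simp
    also have "\<dots> = u a * (\<integral>t. indicator {a..b} t *\<^sub>R deriv \<phi> t \<partial>lborel) + (\<integral>t. \<integral>s. k t s \<partial>lborel \<partial>lborel)"
      using borel_integrable_atLeastAtMost'[OF continuous_on_subset[OF contD], of a b] lborel_pair.integrable_fst[OF k]
      by (simp add: set_integrable_def)
    also have "(\<integral>t. indicator {a..b} t *\<^sub>R deriv \<phi> t \<partial>lborel) = \<phi> b - \<phi> a"
      using ab D by (intro integral_FTC_atLeastAtMost continuous_on_subset[OF contD])
        (auto simp: has_real_derivative_iff_has_vector_derivative[symmetric] intro: DERIV_subset)
    also have "\<dots> = 0" using \<phi>0[of a] \<phi>0[of b] by simp
    also have "(\<integral>t. \<integral>s. k t s \<partial>lborel \<partial>lborel) = (\<integral>s. \<integral>t. k t s \<partial>lborel \<partial>lborel)"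
      using lborel_pair.Fubini_integral[OF k] by simp
    also have "\<dots> = (\<integral>s. - (indicator (einterval 0 T) s *\<^sub>R (d s * \<phi> s)) \<partial>lborel)"
    proof (rule Bochner_Integration.integral_cong)
      fix s :: real
      show "(\<integral>t. k t s \<partial>lborel) = - (indicator (einterval 0 T) s *\<^sub>R (d s * \<phi> s))"
      proof (cases "s \<in> {a..b}")
        case True
        have "(\<integral>t. k t s \<partial>lborel) = (\<integral>t. d s * (indicator {s..b} t *\<^sub>R deriv \<phi> t) \<partial>lborel)"
          using True by (intro Bochner_Integration.integral_cong) (auto simp: k_def d'_def indicator_def)
        also have "\<dots> = d s * (\<integral>t. indicator {s..b} t *\<^sub>R deriv \<phi> t \<partial>lborel)" by simp
        also have "(\<integral>t. indicator {s..b} t *\<^sub>R deriv \<phi> t \<partial>lborel) = \<phi> b - \<phi> s"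
          using True D by (intro integral_FTC_atLeastAtMost continuous_on_subset[OF contD])
            (auto simp: has_real_derivative_iff_has_vector_derivative[symmetric] intro: DERIV_subset)
        finally show ?thesis using True sub \<phi>0[of b] by (auto simp: indicator_def)
      next
        case False
        then have "k t s = 0" for t by (auto simp: k_def)
        moreover have "\<phi> s = 0" using \<phi>0[of s] False by force
        ultimately show ?thesis by simp
      qed
    qed simp
    finally show "(LINT t:einterval 0 T|lborel. u t * deriv \<phi> t) = - (LINT t:einterval 0 T|lborel. d t * \<phi> t)"
      by (simp add: set_lebesgue_integral_def)
  qed
qed

lemma set_integral_fst_Icc:
  fixes g :: "real \<Rightarrow> 'z \<Rightarrow> real"
  assumes J: "sigma_finite_measure J"
    and g: "set_integrable (lborel \<Otimes>\<^sub>M J) ({a..b} \<times> space J) (\<lambda>(t, z). g t z)"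
  shows "set_integrable lborel {a..b} (\<lambda>t. \<integral>z. g t z \<partial>J)"
    and "(LINT t:{a..b}|lborel. \<integral>z. g t z \<partial>J) = (LINT z:{a..b} \<times> space J|lborel \<Otimes>\<^sub>M J. g (fst z) (snd z))"
proof -
  interpret J: sigma_finite_measure J by fact
  interpret P: pair_sigma_finite lborel J ..
  have i: "integrable (lborel \<Otimes>\<^sub>M J) (\<lambda>(t, z). indicator ({a..b} \<times> space J) (t, z) * g t z)"
    using g by (simp add: set_integrable_def case_prod_unfold)
  have eq: "(\<integral>z. indicator ({a..b} \<times> space J) (t, z) * g t z \<partial>J) = indicator {a..b} t * (\<integral>z. g t z \<partial>J)" for t
  proof -
    have "(\<integral>z. indicator ({a..b} \<times> space J) (t, z) * g t z \<partial>J) = (\<integral>z. indicator {a..b} t * g t z \<partial>J)"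
      by (intro Bochner_Integration.integral_cong) (auto simp: indicator_def)
    then show ?thesis by simp
  qed
  show "set_integrable lborel {a..b} (\<lambda>t. \<integral>z. g t z \<partial>J)"
    using P.integrable_fst[OF i] unfolding eq by (simp add: set_integrable_def)
  show "(LINT t:{a..b}|lborel. \<integral>z. g t z \<partial>J) = (LINT z:{a..b} \<times> space J|lborel \<Otimes>\<^sub>M J. g (fst z) (snd z))"
    using P.integral_fst[OF i] unfolding eq by (simp add: set_lebesgue_integral_def case_prod_unfold)
qed

text \<open>Common core of both parts: \<open>w\<close> stands for h or g, \<open>\<theta>\<close>
  for the derivative of \<open>\<Phi>\<close>, and \<open>p x r\<close> for the value of
  \<open>\<theta>\<close> that belongs to the density value \<open>r\<close> at the point
  \<open>x\<close>.\<close>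

lemma has_distr_deriv_entropy:
  fixes \<nu> :: "'a measure" and f w :: "real \<Rightarrow> 'a \<Rightarrow> real" and p :: "'a \<Rightarrow> real \<Rightarrow> real" and T :: ereal
  assumes T: "0 < T"
    and J: "sigma_finite_measure J" "sets J = sets (\<nu> \<Otimes>\<^sub>M \<nu>)"
    and marg: "distr J \<nu> fst = distr J \<nu> snd"
    and fm: "(\<lambda>(t, x). f t x) \<in> borel_measurable (borel \<Otimes>\<^sub>M \<nu>)"
    and fi: "\<And>t. 0 < t \<Longrightarrow> ereal t < T \<Longrightarrow> integrable \<nu> (f t)"
    and V: "\<And>a b. 0 < a \<Longrightarrow> a \<le> b \<Longrightarrow> ereal b < T \<Longrightarrow> integrable (lborel \<Otimes>\<^sub>M J)
      (\<lambda>z. indicator {a..b} (fst z) * (w (fst z) (fst (snd z)) - w (fst z) (snd (snd z))))"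
    and weak: "\<And>s t A. 0 < s \<Longrightarrow> s \<le> t \<Longrightarrow> ereal t < T \<Longrightarrow> A \<in> sets \<nu> \<Longrightarrow>
      (\<integral>x. indicator A x * f t x \<partial>\<nu>) - (\<integral>x. indicator A x * f s x \<partial>\<nu>)
        = (\<integral>z. indicator A (snd (snd z)) * (indicator {s..t} (fst z) * (w (fst z) (fst (snd z)) - w (fst z) (snd (snd z)))) \<partial>(lborel \<Otimes>\<^sub>M J))"
    and pm: "(\<lambda>(x, r). p x r) \<in> borel_measurable (\<nu> \<Otimes>\<^sub>M borel)"
    and mono: "\<And>x. mono (p x)"
    and finf: "finf \<in> borel_measurable \<nu>"
    and p0: "AE x in \<nu>. p x (finf x) = 0"
    and pw: "\<And>t x. 0 < t \<Longrightarrow> ereal t < T \<Longrightarrow> x \<in> space \<nu> \<Longrightarrow> p x (f t x) = \<theta> (w t x)"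
    and \<Phi>m: "\<And>t. 0 < t \<Longrightarrow> ereal t < T \<Longrightarrow> (\<lambda>x. \<Phi> (w t x)) \<in> borel_measurable \<nu>"
    and H: "\<And>t. 0 < t \<Longrightarrow> ereal t < T \<Longrightarrow> integrable \<nu> (\<lambda>x. LBINT s=ereal (finf x)..ereal (f t x). p x s)"
    and conv: "dissipation_converges T J \<Phi> \<theta> w"
  shows "has_distr_deriv (\<lambda>t. \<integral>x. (LBINT s=ereal (finf x)..ereal (f t x). p x s) \<partial>\<nu>)
    (\<lambda>t. - dissipation J \<Phi> \<theta> (w t)) (einterval 0 T)"
proof -
  let ?M = "(lborel :: real measure) \<Otimes>\<^sub>M J"
  have [measurable_cong]: "sets J = sets (\<nu> \<Otimes>\<^sub>M \<nu>)" by fact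
  have spJ: "space J = space \<nu> \<times> space \<nu>"
    using sets_eq_imp_space_eq[OF J(2)] by (simp add: space_pair_measure)
  \<comment> \<open>Absolute convergence is assumed term by term, so the dissipation is split into
    four terms that may be integrated separately.\<close>
  define A1 where "A1 t z = w t (snd z) * \<theta> (w t (snd z))" for t and z :: "'a \<times> 'a"
  define A2 where "A2 t z = w t (fst z) * \<theta> (w t (snd z))" for t and z :: "'a \<times> 'a"
  define A3 where "A3 t z = \<Phi> (w t (fst z))" for t and z :: "'a \<times> 'a"
  define A4 where "A4 t z = \<Phi> (w t (snd z))" for t and z :: "'a \<times> 'a"
  have A: "set_integrable ?M ({a..b} \<times> space J) (\<lambda>z. A1 (fst z) (snd z))"
      "set_integrable ?M ({a..b} \<times> space J) (\<lambda>z. A2 (fst z) (snd z))"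
      "set_integrable ?M ({a..b} \<times> space J) (\<lambda>z. A3 (fst z) (snd z))"
      "set_integrable ?M ({a..b} \<times> space J) (\<lambda>z. A4 (fst z) (snd z))"
    if "0 < a" "a \<le> b" "ereal b < T" for a b
    using conv that unfolding dissipation_converges_def A1_def A2_def A3_def A4_def case_prod_unfold by auto
  define F where "F t z = (A1 t z - A2 t z) + (A3 t z - A4 t z)" for t z
  have diss: "dissipation J \<Phi> \<theta> (w t) = (\<integral>z. F t z \<partial>J)" for t
    unfolding dissipation_def F_def A1_def A2_def A3_def A4_def case_prod_unfold
    by (intro Bochner_Integration.integral_cong) (auto simp: algebra_simps)
  have Fi: "set_integrable ?M ({a..b} \<times> space J) (\<lambda>z. F (fst z) (snd z))"
    if "0 < a" "a \<le> b" "ereal b < T" for a b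
    unfolding F_def by (intro set_integral_add set_integral_diff A that)
  show ?thesis
  proof (rule has_distr_deriv_of_increments[OF T])
    fix a b :: real assume ab: "0 < a" "a \<le> b" "ereal b < T"
    have lt: "ereal t < T" if "t \<le> b" for t
      using that ab le_less_trans[of "ereal t" "ereal b" T] by simp
    show "set_integrable lborel {a..b} (\<lambda>t. - dissipation J \<Phi> \<theta> (w t))"
      using set_integral_fst_Icc(1)[OF J(1), of a b F] Fi[OF ab] unfolding diss
      by (simp add: case_prod_unfold set_integrable_def)
    \<comment> \<open>At each fixed \<open>t\<close> the two integrals are those of one function
      against the two equal marginals.\<close>
    have phi: "(LINT z:{a..b} \<times> space J|?M. A3 (fst z) (snd z)) = (LINT z:{a..b} \<times> space J|?M. A4 (fst z) (snd z))"
    proof -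
      have "(\<integral>z. A3 t z \<partial>J) = (\<integral>z. A4 t z \<partial>J)" if t: "t \<in> {a..b}" for t
      proof -
        have [measurable]: "(\<lambda>x. \<Phi> (w t x)) \<in> borel_measurable \<nu>" using t ab lt by (intro \<Phi>m) auto
        have "(\<integral>x. \<Phi> (w t x) \<partial>distr J \<nu> fst) = (\<integral>x. \<Phi> (w t x) \<partial>distr J \<nu> snd)" using marg by simp
        then show ?thesis by (simp add: integral_distr A3_def A4_def)
      qed
      then have "(LINT t:{a..b}|lborel. \<integral>z. A3 t z \<partial>J) = (LINT t:{a..b}|lborel. \<integral>z. A4 t z \<partial>J)"
        by (intro set_lebesgue_integral_cong) auto
      then show ?thesis
        using set_integral_fst_Icc(2)[OF J(1), of a b A3] set_integral_fst_Icc(2)[OF J(1), of a b A4] A(3,4)[OF ab]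
        by (simp add: case_prod_unfold)
    qed
    have "(LINT t:{a..b}|lborel. dissipation J \<Phi> \<theta> (w t)) = (LINT z:{a..b} \<times> space J|?M. F (fst z) (snd z))"
      using set_integral_fst_Icc(2)[OF J(1), of a b F] Fi[OF ab] by (simp add: diss case_prod_unfold)
    also have "\<dots> = (LINT z:{a..b} \<times> space J|?M. A1 (fst z) (snd z) - A2 (fst z) (snd z))
        + (LINT z:{a..b} \<times> space J|?M. A3 (fst z) (snd z) - A4 (fst z) (snd z))"
      unfolding F_def by (intro set_integral_add set_integral_diff A ab)
    also have "(LINT z:{a..b} \<times> space J|?M. A3 (fst z) (snd z) - A4 (fst z) (snd z)) = 0"
      by (subst set_integral_diff(2)) (use A(3,4)[OF ab] phi in auto)
    finally have D: "(LINT t:{a..b}|lborel. dissipation J \<Phi> \<theta> (w t)) = (LINT z:{a..b} \<times> space J|?M. A1 (fst z) (snd z) - A2 (fst z) (snd z))"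
      by simp

    obtain \<beta>' where \<beta>': "ereal b < ereal \<beta>'" "ereal \<beta>' < T" using ereal_dense2[OF ab(3)] by auto
    \<comment> \<open>The chain rule asks for a flux that is integrable over all times and for
      \<open>a\<close> and \<open>b\<close> strictly inside the time interval. So the flux is cut
      off outside a compact \<open>[\<alpha>, \<beta>]\<close> that contains both in its interior
      and stays within the lifetime of the solution.\<close>
    define \<alpha> \<beta> where "\<alpha> = a / 2" and "\<beta> = \<beta>'"
    have \<alpha>\<beta>: "0 < \<alpha>" "\<alpha> < a" "b < \<beta>" "ereal \<beta> < T" "\<alpha> \<le> \<beta>" using \<beta>' ab by (auto simp: \<alpha>_def \<beta>_def)
    have lt\<beta>: "ereal t < T" if "t \<le> \<beta>" for t
      using that \<alpha>\<beta> le_less_trans[of "ereal t" "ereal \<beta>" T] by simp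
    define v where "v z = indicator {\<alpha>..\<beta>} (fst z) * (w (fst z) (fst (snd z)) - w (fst z) (snd (snd z)))" for z
    have pv: "p (snd (snd z)) (f (fst z) (snd (snd z))) * v z = - (indicator ({\<alpha>..\<beta>} \<times> space J) z * (A1 (fst z) (snd z) - A2 (fst z) (snd z)))"
      if "z \<in> space ?M" for z
    proof (cases "fst z \<in> {\<alpha>..\<beta>}")
      case True
      then have "p (snd (snd z)) (f (fst z) (snd (snd z))) = \<theta> (w (fst z) (snd (snd z)))"
        using that \<alpha>\<beta>(1) by (intro pw lt\<beta>) (auto simp: space_pair_measure spJ)
      with True that show ?thesis
        by (cases z) (auto simp: v_def A1_def A2_def space_pair_measure algebra_simps)
    qed (cases z, auto simp: v_def indicator_def)
    have "(\<integral>x. (LBINT s=ereal (finf x)..ereal (f b x). p x s) \<partial>\<nu>) - (\<integral>x. (LBINT s=ereal (finf x)..ereal (f a x). p x s) \<partial>\<nu>)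
      = (\<integral>(t, z). indicator {a..b} t * (p (snd z) (f t (snd z)) * v (t, z)) \<partial>?M)"
    proof (rule integrated_chain_rule[OF J _ fm fi _ pm mono finf p0 H, where \<alpha> = \<alpha> and \<beta> = \<beta>])
      show "integrable ?M v"
        using V[of \<alpha> \<beta>] \<alpha>\<beta> unfolding v_def[abs_def] by simp
      have "integrable ?M (\<lambda>z. - (indicator ({\<alpha>..\<beta>} \<times> space J) z * (A1 (fst z) (snd z) - A2 (fst z) (snd z))))"
        using set_integral_diff(1)[OF A(1,2)[OF \<alpha>\<beta>(1,5,4)]] by (simp add: set_integrable_def)
      then show "integrable ?M (\<lambda>(t, z). p (snd z) (f t (snd z)) * v (t, z))"
        by (rule Bochner_Integration.integrable_cong[THEN iffD1, OF refl, rotated]) (simp add: pv[symmetric] case_prod_unfold)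
      fix s t B assume st: "\<alpha> < s" "s \<le> t" "t < \<beta>" "B \<in> sets \<nu>"
      have "indicator {s..t} \<tau> * indicator {\<alpha>..\<beta>} \<tau> = (indicator {s..t} \<tau> :: real)" for \<tau>
        using st by (auto simp: indicator_def)
      then have iv: "indicator {s..t} (fst z) * v z = indicator {s..t} (fst z) * (w (fst z) (fst (snd z)) - w (fst z) (snd (snd z)))" for z
        unfolding v_def mult.assoc[symmetric] by simp
      show "(\<integral>x. indicator B x * f t x \<partial>\<nu>) - (\<integral>x. indicator B x * f s x \<partial>\<nu>)
        = (\<integral>z. indicator B (snd (snd z)) * (indicator {s..t} (fst z) * v z) \<partial>?M)"
        unfolding iv using st \<alpha>\<beta>(1) lt\<beta>[of t] by (intro weak) auto
    qed (use \<alpha>\<beta> ab lt\<beta> in auto)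
    also have "\<dots> = (\<integral>z. - (indicator ({a..b} \<times> space J) z * (A1 (fst z) (snd z) - A2 (fst z) (snd z))) \<partial>?M)"
    proof (rule Bochner_Integration.integral_cong)
      fix z assume z: "z \<in> space ?M"
      have "(case z of (t, z) \<Rightarrow> indicator {a..b} t * (p (snd z) (f t (snd z)) * v (t, z)))
        = indicator {a..b} (fst z) * - (indicator ({\<alpha>..\<beta>} \<times> space J) z * (A1 (fst z) (snd z) - A2 (fst z) (snd z)))"
        unfolding pv[OF z, symmetric] by (simp add: case_prod_unfold)
      also have "\<dots> = - (indicator ({a..b} \<times> space J) z * (A1 (fst z) (snd z) - A2 (fst z) (snd z)))"
        using \<alpha>\<beta> by (cases z) (auto simp: indicator_def)
      finally show "(case z of (t, z) \<Rightarrow> indicator {a..b} t * (p (snd z) (f t (snd z)) * v (t, z)))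
        = - (indicator ({a..b} \<times> space J) z * (A1 (fst z) (snd z) - A2 (fst z) (snd z)))" .
    qed simp
    also have "\<dots> = (LINT t:{a..b}|lborel. - dissipation J \<Phi> \<theta> (w t))"
      using D by (simp add: set_lebesgue_integral_def)
    finally show "(\<integral>x. (LBINT s=ereal (finf x)..ereal (f b x). p x s) \<partial>\<nu>) - (\<integral>x. (LBINT s=ereal (finf x)..ereal (f a x). p x s) \<partial>\<nu>)
      = (LINT t:{a..b}|lborel. - dissipation J \<Phi> \<theta> (w t))" .
  qed
qed

section \<open>Weak form of the scattering equation\<close>

lemma nn_integral_snd_of_marginals:
  assumes "distr J M fst = distr J M snd" "sets J = sets (M \<Otimes>\<^sub>M M)" and [measurable]: "u \<in> borel_measurable M"
  shows "(\<integral>\<^sup>+z. u (snd z) \<partial>J) = (\<integral>\<^sup>+z. u (fst z) \<partial>J)"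
proof -
  have [measurable_cong]: "sets J = sets (M \<Otimes>\<^sub>M M)" by fact
  show ?thesis
    using arg_cong[OF assms(1), of "\<lambda>N. \<integral>\<^sup>+x. u x \<partial>N"] by (simp add: nn_integral_distr)
qed

text \<open>Stated for a reference measure \<open>\<rho>\<close> and a density \<open>v\<close> with
  respect to it, so that one lemma serves both parts: \<open>v\<close> is h when
  \<open>\<rho>\<close> is the stationary measure, and \<sigma>(f) when \<open>\<rho>\<close> is
  \<open>\<nu>\<close>. The time integral of the total rate is that of \<open>v\<close> at the first
  point of the pair; equal marginals transfer its finiteness to the second point.\<close>

lemma scattering_weak_form:
  fixes v f :: "real \<Rightarrow> 'a \<Rightarrow> real"
  assumes \<nu>: "finite_measure \<nu>"
    and K: "measure_kernel \<rho> K" "AE x in \<rho>. emeasure (K x) (space \<rho>) < \<infinity>"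
    and \<rho>: "sets \<rho> = sets \<nu>"
    and J: "sigma_finite_measure (kernel_prod \<rho> K)"
    and marg: "distr (kernel_prod \<rho> K) \<rho> fst = distr (kernel_prod \<rho> K) \<rho> snd"
    and vm: "(\<lambda>(t, x). v t x) \<in> borel_measurable (borel \<Otimes>\<^sub>M \<nu>)"
    and v0: "\<And>t x. 0 \<le> v t x"
    and dens: "\<And>s. 0 \<le> s \<Longrightarrow> ereal s < T \<Longrightarrow> density \<nu> (\<lambda>x. ennreal (\<sigma> (f s x))) = density \<rho> (\<lambda>x. ennreal (v s x))"
    and sol: "scattering_solution K \<nu> \<sigma> T f0 f"
  shows "\<And>t. 0 \<le> t \<Longrightarrow> ereal t < T \<Longrightarrow> integrable \<nu> (f t)"
    and "\<And>b. 0 \<le> b \<Longrightarrow> ereal b < T \<Longrightarrow> integrable (lborel \<Otimes>\<^sub>M kernel_prod \<rho> K) (\<lambda>z. indicator {0..b} (fst z) * v (fst z) (fst (snd z)))"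
    and "\<And>b. 0 \<le> b \<Longrightarrow> ereal b < T \<Longrightarrow> integrable (lborel \<Otimes>\<^sub>M kernel_prod \<rho> K) (\<lambda>z. indicator {0..b} (fst z) * v (fst z) (snd (snd z)))"
    and "\<And>s t A. 0 \<le> s \<Longrightarrow> s \<le> t \<Longrightarrow> ereal t < T \<Longrightarrow> A \<in> sets \<nu> \<Longrightarrow>
      (\<integral>x. indicator A x * f t x \<partial>\<nu>) - (\<integral>x. indicator A x * f s x \<partial>\<nu>)
        = (\<integral>z. indicator A (snd (snd z)) * (indicator {s..t} (fst z) * (v (fst z) (fst (snd z)) - v (fst z) (snd (snd z)))) \<partial>(lborel \<Otimes>\<^sub>M kernel_prod \<rho> K))"
proof -
  interpret \<nu>: finite_measure \<nu> by fact
  let ?J = "kernel_prod \<rho> K"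
  let ?M = "(lborel :: real measure) \<Otimes>\<^sub>M ?J"
  interpret J: sigma_finite_measure ?J by fact
  interpret P: pair_sigma_finite lborel ?J ..
  have [measurable_cong]: "sets \<rho> = sets \<nu>" by fact
  have Jsets: "sets ?J = sets (\<rho> \<Otimes>\<^sub>M \<rho>)" by (rule sets_kernel_prod)
  note vm[measurable]
  have vt[measurable]: "v t \<in> borel_measurable \<nu>" for t
    using measurable_compose[OF measurable_Pair1'[of t borel \<nu>] vm] by simp
  have fm: "(\<lambda>(t, x). f t x) \<in> borel_measurable (restrict_space borel {t. 0 \<le> t \<and> ereal t < T} \<Otimes>\<^sub>M \<nu>)"
    using sol by (simp add: scattering_solution_def)
  have ft[measurable]: "f t \<in> borel_measurable \<nu>" if "0 \<le> t" "ereal t < T" for t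
  proof -
    have "t \<in> space (restrict_space borel {t. 0 \<le> t \<and> ereal t < T})" using that by (simp add: space_restrict_space)
    from measurable_compose[OF measurable_Pair1'[OF this] fm] show ?thesis by simp
  qed
  show fi: "integrable \<nu> (f t)" if t: "0 \<le> t" "ereal t < T" for t
  proof -
    obtain C where C: "AE x in \<nu>. f t x \<le> C" using sol t unfolding scattering_solution_def by blast
    have nn: "\<forall>x\<in>space \<nu>. 0 \<le> f t x" using sol t unfolding scattering_solution_def by blast
    show ?thesis
      by (rule \<nu>.integrable_const_bound[of _ C]) (use C nn ft[OF t] AE_space[of \<nu>] in \<open>auto elim: eventually_elim2\<close>)
  qed
  have mass: "measure (density \<nu> (\<lambda>x. ennreal (f t x))) A = (\<integral>x. indicator A x * f t x \<partial>\<nu>)"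
    if t: "0 \<le> t" "ereal t < T" and A: "A \<in> sets \<nu>" for t A
  proof -
    have nn: "\<forall>x\<in>space \<nu>. 0 \<le> f t x" using sol t unfolding scattering_solution_def by blast
    have "measure (density \<nu> (\<lambda>x. ennreal (f t x))) A = enn2real (\<integral>\<^sup>+x. ennreal (f t x) * indicator A x \<partial>\<nu>)"
      using A ft[OF t] by (simp add: measure_def emeasure_density)
    also have "(\<integral>\<^sup>+x. ennreal (f t x) * indicator A x \<partial>\<nu>) = (\<integral>\<^sup>+x. ennreal (indicator A x * f t x) \<partial>\<nu>)"
      by (intro nn_integral_cong) (auto simp: indicator_def)
    also have "enn2real \<dots> = (\<integral>x. indicator A x * f t x \<partial>\<nu>)"
      using nn A ft[OF t] by (intro integral_eq_nn_integral[symmetric]) (auto intro!: AE_I2)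
    finally show ?thesis .
  qed
  have rate: "total_rate K (density \<nu> (\<lambda>x. ennreal (\<sigma> (f s x)))) = (\<integral>\<^sup>+z. ennreal (v s (fst z)) \<partial>?J)"
    if "0 \<le> s" "ereal s < T" for s
    unfolding dens[OF that] by (rule total_rate_density[OF K]) simp
  have tot: "(\<integral>\<^sup>+z. ennreal (indicator {0..b} (fst z) * v (fst z) (fst (snd z))) \<partial>?M) < \<infinity>"
    if b: "0 \<le> b" "ereal b < T" for b
  proof -
    have lt: "ereal s < T" if "s \<le> b" for s
      using that b le_less_trans[of "ereal s" "ereal b" T] by simp
    have "(\<integral>\<^sup>+z. ennreal (indicator {0..b} (fst z) * v (fst z) (fst (snd z))) \<partial>?M)
      = (\<integral>\<^sup>+s. \<integral>\<^sup>+z. ennreal (indicator {0..b} s * v s (fst z)) \<partial>?J \<partial>lborel)"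
      by (subst J.nn_integral_fst[symmetric]) simp_all
    also have "\<dots> = (\<integral>\<^sup>+s\<in>{0..b}. total_rate K (density \<nu> (\<lambda>x. ennreal (\<sigma> (f s x)))) \<partial>lborel)"
      by (intro nn_integral_cong) (auto simp: indicator_def rate lt)
    also have "\<dots> < \<infinity>" using sol b unfolding scattering_solution_def by blast
    finally show ?thesis .
  qed
  show i1: "integrable ?M (\<lambda>z. indicator {0..b} (fst z) * v (fst z) (fst (snd z)))" if "0 \<le> b" "ereal b < T" for b
    using tot[OF that] v0 by (intro integrableI_nonneg) auto
  show i2: "integrable ?M (\<lambda>z. indicator {0..b} (fst z) * v (fst z) (snd (snd z)))" if "0 \<le> b" "ereal b < T" for b
  proof (rule integrableI_nonneg)
    have "(\<integral>\<^sup>+z. ennreal (indicator {0..b} (fst z) * v (fst z) (snd (snd z))) \<partial>?M)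
      = (\<integral>\<^sup>+s. \<integral>\<^sup>+z. ennreal (indicator {0..b} s * v s (snd z)) \<partial>?J \<partial>lborel)"
      by (subst J.nn_integral_fst[symmetric]) simp_all
    also have "\<dots> = (\<integral>\<^sup>+s. \<integral>\<^sup>+z. ennreal (indicator {0..b} s * v s (fst z)) \<partial>?J \<partial>lborel)"
      by (intro nn_integral_cong nn_integral_snd_of_marginals[OF marg Jsets]) simp
    also have "\<dots> = (\<integral>\<^sup>+z. ennreal (indicator {0..b} (fst z) * v (fst z) (fst (snd z))) \<partial>?M)"
      by (subst J.nn_integral_fst[symmetric]) simp_all
    finally show "(\<integral>\<^sup>+z. ennreal (indicator {0..b} (fst z) * v (fst z) (snd (snd z))) \<partial>?M) < \<infinity>"
      using tot[OF that] by simp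
  qed (use v0 in auto)
  fix s t A assume st: "0 \<le> s" "s \<le> t" "ereal t < T" and A: "A \<in> sets \<nu>"
  note A[measurable]
  have lt: "ereal \<tau> < T" if "\<tau> \<le> t" for \<tau>
    using that st le_less_trans[of "ereal \<tau>" "ereal t" T] by simp
  have t0: "0 \<le> t" using st by simp
  define X where "X \<tau> z = indicator A (snd z) * (v \<tau> (fst z) - v \<tau> (snd z))" for \<tau> and z :: "'a \<times> 'a"
  define q where "q \<tau> = (\<integral>z. X \<tau> z \<partial>?J)" for \<tau>
  have Xi: "integrable ?M (\<lambda>(\<tau>, z). indicator S \<tau> * X \<tau> z)" if S: "S \<subseteq> {0..t}" "S \<in> sets borel" for S
  proof (rule Bochner_Integration.integrable_bound)
    show "integrable ?M (\<lambda>z. indicator {0..t} (fst z) * v (fst z) (fst (snd z)) + indicator {0..t} (fst z) * v (fst z) (snd (snd z)))"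
      by (intro Bochner_Integration.integrable_add i1 i2 st t0)
    have "\<bar>v \<tau> x - v \<tau> y\<bar> \<le> \<bar>v \<tau> x + v \<tau> y\<bar>" for \<tau> x y
      using v0[of \<tau> x] v0[of \<tau> y] by linarith
    then show "AE z in ?M. norm (case z of (\<tau>, z) \<Rightarrow> indicator S \<tau> * X \<tau> z)
      \<le> norm (indicator {0..t} (fst z) * v (fst z) (fst (snd z)) + indicator {0..t} (fst z) * v (fst z) (snd (snd z)))"
      using S by (intro AE_I2) (auto simp: X_def indicator_def)
  qed (use S in \<open>unfold X_def, measurable\<close>)
  have qS: "integrable lborel (\<lambda>\<tau>. indicator S \<tau> * q \<tau>)"
    "(\<integral>\<tau>. indicator S \<tau> * q \<tau> \<partial>lborel) = (\<integral>(\<tau>, z). indicator S \<tau> * X \<tau> z \<partial>?M)" if S: "S \<subseteq> {0..t}" "S \<in> sets borel" for S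
    using P.integrable_fst[OF Xi[OF S]] P.integral_fst[OF Xi[OF S]] by (simp_all add: q_def)
  have [measurable]: "q \<in> borel_measurable borel"
    unfolding q_def X_def by measurable
  have eq: "(LINT s:{0..t'}|lborel. scattering K (density \<nu> (\<lambda>x. ennreal (\<sigma> (f s x)))) A) = (\<integral>\<tau>. indicator {0..t'} \<tau> * q \<tau> \<partial>lborel)"
    if t': "0 \<le> t'" "t' \<le> t" for t'
  proof -
    \<comment> \<open>\<open>q\<close> is shown to represent the scattering term at times when
      \<open>v \<tau>\<close> is integrable, which is almost every time. The expression
      \<open>r\<close>, built from extended integrals, agrees with the scattering term at every time
      up to \<open>t\<close> and is measurable, as the comparison almost everywhere
      requires.\<close>
    define r where "r \<tau> = enn2real (\<integral>\<^sup>+z. ennreal (v \<tau> (fst z)) * indicator A (snd z) \<partial>?J) - enn2real (\<integral>\<^sup>+z. ennreal (v \<tau> (snd z)) * indicator A (snd z) \<partial>?J)" for \<tau>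
    have [measurable]: "r \<in> borel_measurable borel" unfolding r_def by measurable
    have sr: "scattering K (density \<nu> (\<lambda>x. ennreal (\<sigma> (f \<tau> x)))) A = r \<tau>" if "0 \<le> \<tau>" "\<tau> \<le> t" for \<tau>
      unfolding dens[OF that(1) lt[OF that(2)]] r_def
      using scattering_density_nn[OF K marg, of "\<lambda>x. ennreal (v \<tau> x)" A] by simp
    have "(LINT s:{0..t'}|lborel. scattering K (density \<nu> (\<lambda>x. ennreal (\<sigma> (f s x)))) A) = (\<integral>\<tau>. indicator {0..t'} \<tau> * r \<tau> \<partial>lborel)"
      unfolding set_lebesgue_integral_def
      by (intro Bochner_Integration.integral_cong) (use t' sr in \<open>auto simp: indicator_def\<close>)
    also have "\<dots> = (\<integral>\<tau>. indicator {0..t'} \<tau> * q \<tau> \<partial>lborel)"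
    proof (rule integral_cong_AE)
      have j1: "integrable ?M (\<lambda>(\<tau>, z). indicator {0..t} \<tau> * v \<tau> (fst z))"
        and j2: "integrable ?M (\<lambda>(\<tau>, z). indicator {0..t} \<tau> * v \<tau> (snd z))"
        using i1[OF t0 st(3)] i2[OF t0 st(3)] by (simp_all add: case_prod_unfold)
      show "AE \<tau> in lborel. indicator {0..t'} \<tau> * r \<tau> = indicator {0..t'} \<tau> * q \<tau>"
        using P.AE_integrable_fst[OF j1] P.AE_integrable_fst[OF j2]
      proof eventually_elim
        case (elim \<tau>)
        show ?case
        proof (cases "\<tau> \<in> {0..t'}")
          case True
          then have k: "integrable ?J (\<lambda>z. v \<tau> (fst z))" "integrable ?J (\<lambda>z. v \<tau> (snd z))"
            using elim t' by (auto simp: indicator_def)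
          have "r \<tau> = scattering K (density \<rho> (\<lambda>x. ennreal (v \<tau> x))) A"
            unfolding r_def using scattering_density_nn[OF K marg, of "\<lambda>x. ennreal (v \<tau> x)" A] by simp
          also have "\<dots> = q \<tau>"
            unfolding q_def X_def by (rule scattering_density[OF K marg _ v0 k]) simp_all
          finally show ?thesis by simp
        qed simp
      qed
    qed measurable
    finally show ?thesis .
  qed
  have m: "measure (density \<nu> (\<lambda>x. ennreal (f t' x))) A = measure (density \<nu> (\<lambda>x. ennreal (f0 x))) A
    + (LINT s:{0..t'}|lborel. scattering K (density \<nu> (\<lambda>x. ennreal (\<sigma> (f s x)))) A)" if "0 \<le> t'" "t' \<le> t" for t'
    using sol A that lt[of t'] unfolding scattering_solution_def by blast
  have "(\<integral>x. indicator A x * f t x \<partial>\<nu>) - (\<integral>x. indicator A x * f s x \<partial>\<nu>) = (\<integral>\<tau>. indicator {0..t} \<tau> * q \<tau> \<partial>lborel) - (\<integral>\<tau>. indicator {0..s} \<tau> * q \<tau> \<partial>lborel)"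
    using m[of t] m[of s] eq[of t] eq[of s] st t0 mass[OF _ _ A, of t] mass[OF _ _ A, of s] lt[of s] by simp
  also have "\<dots> = (\<integral>\<tau>. indicator {0..t} \<tau> * q \<tau> - indicator {0..s} \<tau> * q \<tau> \<partial>lborel)"
    using st by (intro Bochner_Integration.integral_diff[symmetric] qS) auto
  \<comment> \<open>Removing \<open>[0, s]\<close> from \<open>[0, t]\<close> also removes the point
    \<open>s\<close>; a single time is null.\<close>
  also have "\<dots> = (\<integral>\<tau>. indicator {s..t} \<tau> * q \<tau> \<partial>lborel)"
    by (rule integral_cong_AE) (use AE_lborel_singleton[of s] st in \<open>auto elim!: eventually_mono simp: indicator_def\<close>)
  also have "\<dots> = (\<integral>(\<tau>, z). indicator {s..t} \<tau> * X \<tau> z \<partial>?M)"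
    using st by (intro qS) auto
  also have "\<dots> = (\<integral>z. indicator A (snd (snd z)) * (indicator {s..t} (fst z) * (v (fst z) (fst (snd z)) - v (fst z) (snd (snd z)))) \<partial>?M)"
    by (intro Bochner_Integration.integral_cong) (auto simp: X_def mult_ac)
  finally show "(\<integral>x. indicator A x * f t x \<partial>\<nu>) - (\<integral>x. indicator A x * f s x \<partial>\<nu>)
    = (\<integral>z. indicator A (snd (snd z)) * (indicator {s..t} (fst z) * (v (fst z) (fst (snd z)) - v (fst z) (snd (snd z)))) \<partial>?M)" .
qed

section \<open>The entropy laws\<close>

lemma has_distr_deriv_cong:
  assumes "has_distr_deriv u du S" "\<And>t. t \<in> S \<Longrightarrow> u t = u' t" "\<And>t. t \<in> S \<Longrightarrow> du t = du' t"
  shows "has_distr_deriv u' du' S"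
proof -
  have "set_integrable lborel C u' \<longleftrightarrow> set_integrable lborel C u" "set_integrable lborel C du' \<longleftrightarrow> set_integrable lborel C du"
    if "C \<subseteq> S" for C
    by (intro set_integrable_cong; use that assms(2,3) in force)+
  moreover have "(LINT t:S|lborel. u' t * deriv \<phi> t) = (LINT t:S|lborel. u t * deriv \<phi> t)"
    "(LINT t:S|lborel. du' t * \<phi> t) = (LINT t:S|lborel. du t * \<phi> t)" for \<phi>
    unfolding set_lebesgue_integral_def
    by (intro Bochner_Integration.integral_cong; use assms(2,3) in \<open>simp add: indicator_def\<close>)+
  ultimately show ?thesis using assms(1) unfolding has_distr_deriv_def by metis
qed

lemma dissipation_cong:
  assumes "space J = X \<times> X" "\<And>x. x \<in> X \<Longrightarrow> h x = h' x"
  shows "dissipation J \<Phi> d\<Phi> h = dissipation J \<Phi> d\<Phi> h'"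
  unfolding dissipation_def by (intro Bochner_Integration.integral_cong) (auto simp: assms)

lemma dissipation_converges_cong:
  assumes conv: "dissipation_converges T J \<Phi> d\<Phi> h" and J: "space J = X \<times> X"
    and h: "\<And>t x. 0 < t \<Longrightarrow> ereal t < T \<Longrightarrow> x \<in> X \<Longrightarrow> h t x = h' t x"
  shows "dissipation_converges T J \<Phi> d\<Phi> h'"
proof -
  have eq: "h t x = h' t x \<and> h t y = h' t y"
    if "0 < a" "ereal b < T" "(t, x, y) \<in> {a..b} \<times> space J" for a b t x y
    using that h[of t] J le_less_trans[of "ereal t" "ereal b" T] by auto
  show ?thesis
    unfolding dissipation_converges_def
  proof (intro allI impI, elim conjE)
    fix a b :: real assume ab: "0 < a" "a \<le> b" "ereal b < T"
    have cong: "set_integrable (lborel \<Otimes>\<^sub>M J) ({a..b} \<times> space J) (\<lambda>(t, x, y). g (h t x) (h t y)) \<longleftrightarrow>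
        set_integrable (lborel \<Otimes>\<^sub>M J) ({a..b} \<times> space J) (\<lambda>(t, x, y). g (h' t x) (h' t y))"
      for g :: "real \<Rightarrow> real \<Rightarrow> real"
      by (rule set_integrable_cong) (use eq[OF ab(1,3)] in auto)
    show "set_integrable (lborel \<Otimes>\<^sub>M J) ({a..b} \<times> space J) (\<lambda>(t, x, y). h' t y * d\<Phi> (h' t y)) \<and>
        set_integrable (lborel \<Otimes>\<^sub>M J) ({a..b} \<times> space J) (\<lambda>(t, x, y). h' t x * d\<Phi> (h' t y)) \<and>
        set_integrable (lborel \<Otimes>\<^sub>M J) ({a..b} \<times> space J) (\<lambda>(t, x, y). \<Phi> (h' t x)) \<and>
        set_integrable (lborel \<Otimes>\<^sub>M J) ({a..b} \<times> space J) (\<lambda>(t, x, y). \<Phi> (h' t y))"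
      using conv ab cong[of "\<lambda>u v. v * d\<Phi> v"] cong[of "\<lambda>u v. u * d\<Phi> v"] cong[of "\<lambda>u v. \<Phi> u"] cong[of "\<lambda>u v. \<Phi> v"]
      unfolding dissipation_converges_def by simp
  qed
qed

section \<open>One-sided derivatives and convexity of the functions \<Phi> and \<Psi>\<close>

lemma MVT_within:
  fixes F :: "real \<Rightarrow> real"
  assumes "a \<le> b" "{a..b} \<subseteq> S" "\<And>r. r \<in> S \<Longrightarrow> (F has_real_derivative F' r) (at r within S)"
  shows "\<exists>x\<in>{a..b}. F b - F a = F' x * (b - a)"
proof -
  have "(F has_derivative (\<lambda>y. F' x * y)) (at x within {a..b})" if "a \<le> x" "x \<le> b" for x
  proof -
    have "x \<in> S" using that assms(2) by auto
    from has_field_derivative_subset[OF assms(3)[OF this] assms(2)] show ?thesis by (simp add: has_field_derivative_def)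
  qed
  from mvt_very_simple[OF assms(1) this] show ?thesis by simp
qed

lemma is_interval_Icc_subset:
  fixes S :: "real set"
  assumes "is_interval S" "a \<in> S" "b \<in> S"
  shows "{a..b} \<subseteq> S"
  using assms unfolding is_interval_1 by (meson atLeastAtMost_iff subsetI)

lemma C2_on_D:
  assumes "C2_on S \<Phi> d\<Phi> dd\<Phi>" "r \<in> S"
  shows "(\<Phi> has_real_derivative d\<Phi> r) (at r within S)" "(d\<Phi> has_real_derivative dd\<Phi> r) (at r within S)"
  using assms unfolding C2_on_def by blast+

lemma C2_on_deriv_mono:
  assumes C2: "C2_on S \<Phi> d\<Phi> dd\<Phi>" and S: "is_interval S" and nn: "\<forall>r\<in>S. 0 \<le> dd\<Phi> r"
    and ab: "a \<in> S" "b \<in> S" "a \<le> b"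
  shows "d\<Phi> a \<le> d\<Phi> b"
proof -
  have sub: "{a..b} \<subseteq> S" using S ab by (intro is_interval_Icc_subset)
  obtain x where "x \<in> {a..b}" "d\<Phi> b - d\<Phi> a = dd\<Phi> x * (b - a)"
    using MVT_within[OF ab(3) sub C2_on_D(2)[OF C2]] by blast
  moreover have "0 \<le> dd\<Phi> x" using calculation(1) sub nn by blast
  ultimately show ?thesis using ab(3) mult_nonneg_nonneg[of "dd\<Phi> x" "b - a"] by linarith
qed

text \<open>The expression is the height of \<open>\<Phi>\<close> at \<open>x\<close> above its
  tangent at \<open>y\<close>, a Bregman divergence. The mean value theorem turns it into a
  difference of slopes times a length, and the slopes are ordered. This is the pointwise sign of the
  dissipation.\<close>

lemma C2_on_convex:
  assumes C2: "C2_on S \<Phi> d\<Phi> dd\<Phi>" and S: "is_interval S" and nn: "\<forall>r\<in>S. 0 \<le> dd\<Phi> r"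
    and xy: "x \<in> S" "y \<in> S"
  shows "0 \<le> (y - x) * d\<Phi> y + \<Phi> x - \<Phi> y"
proof (cases "x \<le> y")
  case True
  have sub: "{x..y} \<subseteq> S" using S xy by (intro is_interval_Icc_subset)
  obtain z where z: "z \<in> {x..y}" "\<Phi> y - \<Phi> x = d\<Phi> z * (y - x)"
    using MVT_within[OF True sub C2_on_D(1)[OF C2]] by blast
  have "d\<Phi> z \<le> d\<Phi> y" using z sub xy by (intro C2_on_deriv_mono[OF C2 S nn]) auto
  then have "d\<Phi> z * (y - x) \<le> d\<Phi> y * (y - x)" using True by (intro mult_right_mono) auto
  with z show ?thesis by (simp add: algebra_simps)
next
  case False
  then have le: "y \<le> x" by simp
  have sub: "{y..x} \<subseteq> S" using S xy by (intro is_interval_Icc_subset)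
  obtain z where z: "z \<in> {y..x}" "\<Phi> x - \<Phi> y = d\<Phi> z * (x - y)"
    using MVT_within[OF le sub C2_on_D(1)[OF C2]] by blast
  have "d\<Phi> y \<le> d\<Phi> z" using z sub xy by (intro C2_on_deriv_mono[OF C2 S nn]) auto
  then have "d\<Phi> y * (x - y) \<le> d\<Phi> z * (x - y)" using le by (intro mult_right_mono) auto
  with z show ?thesis by (simp add: algebra_simps)
qed

lemma C2_on_continuous:
  assumes "C2_on S \<Phi> d\<Phi> dd\<Phi>"
  shows "continuous_on S \<Phi>" "continuous_on S d\<Phi>"
proof -
  show "continuous_on S \<Phi>"
    by (rule DERIV_continuous_on[of S \<Phi> d\<Phi>]) (rule C2_on_D(1)[OF assms])
  show "continuous_on S d\<Phi>"
    by (rule DERIV_continuous_on[of S d\<Phi> dd\<Phi>]) (rule C2_on_D(2)[OF assms])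
qed

lemma dissipation_nonneg:
  assumes C2: "C2_on S \<Phi> d\<Phi> dd\<Phi>" and S: "is_interval S" and nn: "\<forall>r\<in>S. 0 \<le> dd\<Phi> r"
    and J: "space J = X \<times> X" and h: "\<And>x. x \<in> X \<Longrightarrow> h x \<in> S"
  shows "0 \<le> dissipation J \<Phi> d\<Phi> h"
  unfolding dissipation_def
proof (intro integral_nonneg_AE AE_I2)
  fix z assume z: "z \<in> space J"
  obtain x y where xy: "z = (x, y)" by (cases z)
  have "h x \<in> S" "h y \<in> S" using z J h unfolding xy by blast+
  then show "0 \<le> (case z of (x, y) \<Rightarrow> (h y - h x) * d\<Phi> (h y) + \<Phi> (h x) - \<Phi> (h y))"
    unfolding xy prod.case by (rule C2_on_convex[OF C2 S nn])
qed

lemma integral_Icc_times: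
  fixes g :: "'z \<Rightarrow> real" and a b :: real
  assumes J: "sigma_finite_measure J" and g: "integrable J g"
  shows "integrable (lborel \<Otimes>\<^sub>M J) (\<lambda>z. indicator {a..b} (fst z) * g (snd z))"
    and "(\<integral>z. indicator {a..b} (fst z) * g (snd z) \<partial>(lborel \<Otimes>\<^sub>M J)) = measure lborel {a..b} * (\<integral>z. g z \<partial>J)"
proof -
  interpret J: sigma_finite_measure J by fact
  interpret P: pair_sigma_finite lborel J ..
  have [measurable]: "g \<in> borel_measurable J" using g by auto
  have ind: "integrable lborel (indicat_real {a..b})"
    by (rule integrable_real_indicator) (auto simp: emeasure_lborel_Icc_eq)
  have i: "integrable (lborel \<Otimes>\<^sub>M J) (\<lambda>(t, z). indicator {a..b} t * g z)"
    by (rule P.Fubini_integrable) (use g ind in \<open>auto simp: abs_mult\<close>)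
  then show "integrable (lborel \<Otimes>\<^sub>M J) (\<lambda>z. indicator {a..b} (fst z) * g (snd z))"
    by (simp add: case_prod_unfold)
  show "(\<integral>z. indicator {a..b} (fst z) * g (snd z) \<partial>(lborel \<Otimes>\<^sub>M J)) = measure lborel {a..b} * (\<integral>z. g z \<partial>J)"
    using P.integral_fst[OF i] by (simp add: case_prod_unfold)
qed

lemma integrable_Icc_diff:
  fixes u v :: "real \<times> 'z \<Rightarrow> real"
  assumes u: "integrable (lborel \<Otimes>\<^sub>M J) (\<lambda>z. indicator {0..b} (fst z) * u z)"
    and v: "integrable (lborel \<Otimes>\<^sub>M J) (\<lambda>z. indicator {0..b} (fst z) * v z)"
    and a: "0 \<le> a"
  shows "integrable (lborel \<Otimes>\<^sub>M J) (\<lambda>z. indicator {a..b} (fst z) * (u z - v z))"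
proof -
  define d where "d z = indicator {0..b} (fst z) * u z - indicator {0..b} (fst z) * v z" for z
  have d: "integrable (lborel \<Otimes>\<^sub>M J) d"
    unfolding d_def using u v by (rule Bochner_Integration.integrable_diff)
  then have [measurable]: "d \<in> borel_measurable (lborel \<Otimes>\<^sub>M J)" by auto
  have "integrable (lborel \<Otimes>\<^sub>M J) (\<lambda>z. indicator {a..b} (fst z) * d z)"
    by (rule Bochner_Integration.integrable_bound[OF d]) (auto simp: indicator_def)
  moreover have "indicator {a..b} (fst z) * d z = indicator {a..b} (fst z) * (u z - v z)" for z
    using a by (simp add: d_def indicator_def)
  ultimately show ?thesis by simp
qed

section \<open>Common hypotheses and the laws for the two functionals\<close>

locale nonlinear_scattering =
  fixes \<nu> :: "'a measure" and K :: "'a \<Rightarrow> 'a measure" and \<sigma> :: "real \<Rightarrow> real"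
    and finf f0 :: "'a \<Rightarrow> real" and f :: "real \<Rightarrow> 'a \<Rightarrow> real" and T :: ereal
  assumes \<nu>: "finite_measure \<nu>"
    and K: "measure_kernel \<nu> K"
    and \<sigma>_nonneg: "\<forall>r\<ge>0. \<sigma> r \<ge> 0"
    and \<sigma>_mono: "strict_mono_on {0..} \<sigma>"
    and finf[measurable]: "finf \<in> borel_measurable \<nu>"
    and finf_nonneg: "\<forall>x\<in>space \<nu>. 0 \<le> finf x"
    and finf_pos: "AE x in \<nu>. \<sigma> (finf x) > 0"
    and stat: "stationary K (density \<nu> (\<lambda>x. ennreal (\<sigma> (finf x))))"
    and T: "0 < T"
    and sol: "scattering_solution K \<nu> \<sigma> T f0 f"
begin

text \<open>Outside \<open>[0,T)\<close> in time and \<open>[0,\<infinity>)\<close> in the argument of \<open>\<sigma>\<close> nothing is known about the data;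
  freezing them there yields globally measurable functions.\<close>

definition sig :: "real \<Rightarrow> real" where "sig r = \<sigma> (max 0 r)"

definition fbar :: "real \<Rightarrow> 'a \<Rightarrow> real" where
  "fbar t = f (if 0 \<le> t \<and> ereal t < T then t else 0)"

text \<open>The density of the stationary measure, positive almost everywhere. On the exceptional
  null set it may be 0, and a quotient by it then has the default value 0.\<close>

definition c :: "'a \<Rightarrow> real" where "c x = sig (finf x)"

lemma mono_sig: "mono sig"
  using \<sigma>_mono unfolding mono_def sig_def strict_mono_on_def
  by (metis atLeast_iff le_less max.cobounded1 max.mono order_refl)

lemma measurable_sig[measurable]: "sig \<in> borel_measurable borel"
  by (rule borel_measurable_mono[OF mono_sig])

lemma sig_nonneg: "0 \<le> sig r"
  using \<sigma>_nonneg by (simp add: sig_def)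

lemma sig_eq: "0 \<le> r \<Longrightarrow> sig r = \<sigma> r"
  by (simp add: sig_def max_def)

lemma measurable_c[measurable]: "c \<in> borel_measurable \<nu>"
  unfolding c_def by measurable

lemma c_nonneg: "0 \<le> c x"
  by (simp add: c_def sig_nonneg)

lemma c_eq: "x \<in> space \<nu> \<Longrightarrow> c x = \<sigma> (finf x)"
  using finf_nonneg by (simp add: c_def sig_eq)

lemma c_pos: "AE x in \<nu>. 0 < c x"
  using finf_pos AE_space by eventually_elim (simp add: c_eq)

lemma density_c: "density \<nu> (\<lambda>x. ennreal (\<sigma> (finf x))) = density \<nu> (\<lambda>x. ennreal (c x))"
  unfolding density_def by (intro arg_cong[where f = "measure_of _ _"] ext nn_integral_cong) (simp add: c_eq)

lemma measurable_kernel[measurable]: "A \<in> sets \<nu> \<Longrightarrow> (\<lambda>x. emeasure (K x) A) \<in> borel_measurable \<nu>"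
  using K by (simp add: measure_kernel_def)

lemma rate_c: "(\<integral>\<^sup>+x. ennreal (c x) * emeasure (K x) (space \<nu>) \<partial>\<nu>) < \<infinity>"
  using stat by (simp add: stationary_def total_rate_def density_c nn_integral_density)

text \<open>Stationarity bounds the rate weighted by \<open>c\<close>; as \<open>c\<close> is
  positive almost everywhere, the rate can be infinite only on a null set.\<close>

lemma finite_rate: "AE x in \<nu>. emeasure (K x) (space \<nu>) < \<infinity>"
  by (rule AE_finite_of_weighted[OF _ _ _ rate_c]) (use c_pos in auto)

lemma fbar_eq: "0 \<le> t \<Longrightarrow> ereal t < T \<Longrightarrow> fbar t = f t"
  by (simp add: fbar_def)

lemma f_nonneg: "0 \<le> t \<Longrightarrow> ereal t < T \<Longrightarrow> x \<in> space \<nu> \<Longrightarrow> 0 \<le> f t x"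
  using sol unfolding scattering_solution_def by blast

lemma measurable_fbar[measurable]: "(\<lambda>(t, x). fbar t x) \<in> borel_measurable (borel \<Otimes>\<^sub>M \<nu>)"
proof -
  let ?I = "{t. 0 \<le> t \<and> ereal t < T}"
  have "(\<lambda>t. if 0 \<le> t \<and> ereal t < T then t else 0) \<in> measurable borel (restrict_space borel ?I)"
    using T by (intro measurable_restrict_space2) (auto simp: zero_ereal_def)
  then have "(\<lambda>(t, x). (if 0 \<le> t \<and> ereal t < T then t else 0, x)) \<in> measurable (borel \<Otimes>\<^sub>M \<nu>) (restrict_space borel ?I \<Otimes>\<^sub>M \<nu>)"
    by measurable
  moreover have "(\<lambda>(t, x). f t x) \<in> borel_measurable (restrict_space borel ?I \<Otimes>\<^sub>M \<nu>)"
    using sol by (simp add: scattering_solution_def)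
  ultimately have "(\<lambda>p. (\<lambda>(t, x). f t x) ((\<lambda>(t, x). (if 0 \<le> t \<and> ereal t < T then t else 0, x)) p)) \<in> borel_measurable (borel \<Otimes>\<^sub>M \<nu>)"
    by (rule measurable_compose)
  then show ?thesis by (simp add: fbar_def case_prod_unfold)
qed

lemma density_sig: "0 \<le> t \<Longrightarrow> ereal t < T \<Longrightarrow>
    density \<nu> (\<lambda>x. ennreal (\<sigma> (f t x))) = density \<nu> (\<lambda>x. ennreal (sig (fbar t x)))"
  unfolding density_def fbar_eq
  by (intro arg_cong[where f = "measure_of _ _"] ext nn_integral_cong) (simp add: sig_eq f_nonneg)

lemma measurable_fbar_section[measurable]: "fbar t \<in> borel_measurable \<nu>"
  using measurable_compose[OF measurable_Pair1'[of t borel \<nu>] measurable_fbar] by simp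

text \<open>The integration variable stays between two nonnegative values, where \<open>sig\<close>
  and \<open>\<sigma>\<close> agree.\<close>

lemma interval_integral_sig:
  assumes "0 \<le> t" "ereal t < T" "x \<in> space \<nu>"
  shows "(LBINT s=ereal (finf x)..ereal (fbar t x). g (sig s)) = (LBINT s=ereal (finf x)..ereal (f t x). g (\<sigma> s))"
  unfolding fbar_eq[OF assms(1,2)]
proof (rule interval_integral_cong)
  fix s assume "s \<in> einterval (min (ereal (finf x)) (ereal (f t x))) (max (ereal (finf x)) (ereal (f t x)))"
  then have "min (finf x) (f t x) < s" by (simp add: einterval_iff ereal_min[symmetric] del: ereal_min)
  then have "0 \<le> s" using finf_nonneg assms(3) f_nonneg[OF assms] by (auto simp: min_def split: if_splits)
  then show "g (sig s) = g (\<sigma> s)" by (simp add: sig_eq)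
qed

text \<open>With respect to the stationary measure, \<sigma>(f) \<nu> has density h, so h is the
  \<open>w\<close> of the general law, and stationarity makes the marginals equal. The hypothesis
  \<open>d1\<close> makes the subgradient vanish when f equals \<open>finf\<close>.\<close>

lemma relative_entropy_law:
  assumes C2: "C2_on {0..} \<Phi> d\<Phi> dd\<Phi>" and d1: "d\<Phi> 1 = 0" and nn: "\<forall>r\<ge>0. dd\<Phi> r \<ge> 0"
    and Hi: "\<forall>t. 0 < t \<and> ereal t < T \<longrightarrow> integrable \<nu> (H_density \<sigma> d\<Phi> finf (f t))"
    and conv: "dissipation_converges T (kernel_prod (density \<nu> (\<lambda>x. ennreal (\<sigma> (finf x)))) K) \<Phi> d\<Phi>
      (\<lambda>t x. \<sigma> (f t x) / \<sigma> (finf x))"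
  shows "has_distr_deriv (\<lambda>t. H_functional \<nu> \<sigma> d\<Phi> finf (f t))
      (\<lambda>t. - dissipation (kernel_prod (density \<nu> (\<lambda>x. ennreal (\<sigma> (finf x)))) K) \<Phi> d\<Phi> (\<lambda>x. \<sigma> (f t x) / \<sigma> (finf x)))
      (einterval 0 T)"
    and "\<forall>t\<in>einterval 0 T. - dissipation (kernel_prod (density \<nu> (\<lambda>x. ennreal (\<sigma> (finf x)))) K) \<Phi> d\<Phi>
      (\<lambda>x. \<sigma> (f t x) / \<sigma> (finf x)) \<le> 0"
proof -
  define \<rho> where "\<rho> = density \<nu> (\<lambda>x. ennreal (\<sigma> (finf x)))"
  let ?J = "kernel_prod \<rho> K"
  have \<rho>c: "\<rho> = density \<nu> (\<lambda>x. ennreal (c x))" by (simp add: \<rho>_def density_c)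
  have sets\<rho>[measurable_cong]: "sets \<rho> = sets \<nu>" and space\<rho>: "space \<rho> = space \<nu>" by (simp_all add: \<rho>_def)
  have K\<rho>: "measure_kernel \<rho> K"
    using K by (simp add: measure_kernel_def sets\<rho> space\<rho> cong: measurable_cong_sets)
  have fin: "AE x in \<rho>. emeasure (K x) (space \<rho>) < \<infinity>"
    unfolding \<rho>c using finite_rate by (subst AE_density) (auto elim: eventually_mono)
  have rate: "(\<integral>\<^sup>+x. 1 * emeasure (K x) (space \<rho>) \<partial>\<rho>) < \<infinity>"
    using rate_c by (simp add: space\<rho>) (simp add: \<rho>c nn_integral_density)
  have sf: "sigma_finite_measure ?J"
    by (rule sigma_finite_kernel_prod[OF K\<rho> _ _ rate]) auto
  have marg: "distr ?J \<rho> fst = distr ?J \<rho> snd"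
    using stat by (intro stationary_marginals[OF K\<rho>]) (simp add: \<rho>_def)
  \<comment> \<open>\<open>distr\<close> depends on its target only through the space and the
    measurable sets, so \<open>\<rho>\<close> may be replaced by \<open>\<nu>\<close>.\<close>
  have marg': "distr ?J \<nu> fst = distr ?J \<nu> snd"
    using marg distr_cong[OF refl sets\<rho>[symmetric], of ?J fst fst] distr_cong[OF refl sets\<rho>[symmetric], of ?J snd snd] by simp
  have Jsets: "sets ?J = sets (\<nu> \<Otimes>\<^sub>M \<nu>)"
    by (simp add: sets_kernel_prod sets\<rho> cong: sets_pair_measure_cong)
  have spJ: "space ?J = space \<nu> \<times> space \<nu>" by (simp add: space_kernel_prod space\<rho>)
  define w where "w t x = sig (fbar t x) / c x" for t x
  have w_nonneg: "0 \<le> w t x" for t x by (simp add: w_def sig_nonneg c_nonneg)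
  have wm: "(\<lambda>(t, x). w t x) \<in> borel_measurable (borel \<Otimes>\<^sub>M \<nu>)"
    unfolding w_def by measurable
  have w_eq: "w t x = \<sigma> (f t x) / \<sigma> (finf x)" if "0 \<le> t" "ereal t < T" "x \<in> space \<nu>" for t x
    using that by (simp add: w_def c_eq fbar_eq sig_eq f_nonneg)
  have dens: "density \<nu> (\<lambda>x. ennreal (\<sigma> (f s x))) = density \<rho> (\<lambda>x. ennreal (w s x))" if "0 \<le> s" "ereal s < T" for s
  proof -
    have [measurable]: "w s \<in> borel_measurable \<nu>" unfolding w_def by measurable
    have "density \<rho> (\<lambda>x. ennreal (w s x)) = density \<nu> (\<lambda>x. ennreal (c x) * ennreal (w s x))"
      unfolding \<rho>c by (rule density_density_eq) auto
    \<comment> \<open>Where \<open>c x = 0\<close> the quotient is 0 and the product need not give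
      back \<open>sig (fbar s x)\<close>; these points form a null set.\<close>
    also have "\<dots> = density \<nu> (\<lambda>x. ennreal (sig (fbar s x)))"
      using c_pos by (intro density_cong) (auto elim!: eventually_mono simp: w_def sig_nonneg simp flip: ennreal_mult)
    finally show ?thesis using density_sig[OF that] by simp
  qed
  note weak = scattering_weak_form[OF \<nu> K\<rho> fin sets\<rho> sf marg wm w_nonneg dens sol]
  define p where "p x r = d\<Phi> (sig r / c x)" for x r
  have S: "is_interval {0::real..}" by (simp add: is_interval_1)
  have nn': "\<forall>r\<in>{0..}. 0 \<le> dd\<Phi> r" using nn by simp
  \<comment> \<open>\<open>\<Phi>\<close> and its derivative are controlled on the half-line.
    Composition with \<open>max 0\<close> makes them continuous on the whole line, and changes
    nothing at the arguments that occur, which are nonnegative.\<close>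
  have meas_max: "(\<lambda>r. g (max 0 r)) \<in> borel_measurable borel" if "continuous_on {0..} g" for g :: "real \<Rightarrow> real"
    by (intro borel_measurable_continuous_onI continuous_on_compose2[OF that] continuous_intros) auto
  have [measurable]: "(\<lambda>r. d\<Phi> (max 0 r)) \<in> borel_measurable borel" "(\<lambda>r. \<Phi> (max 0 r)) \<in> borel_measurable borel"
    using C2_on_continuous[OF C2] by (auto intro: meas_max)
  have max0: "max 0 (sig r / c x) = sig r / c x" "max 0 (w t x) = w t x" for r x t
    using w_nonneg by (simp_all add: sig_nonneg c_nonneg max_def)
  have pm: "(\<lambda>(x, r). p x r) \<in> borel_measurable (\<nu> \<Otimes>\<^sub>M borel)"
  proof -
    have "(\<lambda>(x, r). d\<Phi> (max 0 (sig r / c x))) \<in> borel_measurable (\<nu> \<Otimes>\<^sub>M borel)" by measurable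
    then show ?thesis unfolding max0 p_def .
  qed
  have \<Phi>m: "(\<lambda>x. \<Phi> (w t x)) \<in> borel_measurable \<nu>" for t
  proof -
    have "(\<lambda>x. \<Phi> (max 0 (w t x))) \<in> borel_measurable \<nu>" unfolding w_def by measurable
    then show ?thesis unfolding max0 .
  qed
  have mono_p: "mono (p x)" for x
    unfolding p_def using monoD[OF mono_sig]
    by (intro monoI C2_on_deriv_mono[OF C2 S nn']) (auto simp: sig_nonneg c_nonneg divide_right_mono)
  \<comment> \<open>Where \<open>c x\<close> is positive, the quotient at \<open>finf x\<close> is
    1; where it is 0, the quotient is 0, hence the claim almost everywhere.\<close>
  have p0: "AE x in \<nu>. p x (finf x) = 0"
    using c_pos by eventually_elim (simp add: p_def d1 flip: c_def)
  have pH: "(LBINT s=ereal (finf x)..ereal (fbar t x). p x s) = H_density \<sigma> d\<Phi> finf (f t) x"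
    if "0 < t" "ereal t < T" "x \<in> space \<nu>" for t x
    using interval_integral_sig[of t x "\<lambda>r. d\<Phi> (r / c x)"] that by (simp add: H_density_def p_def c_eq)
  have "has_distr_deriv (\<lambda>t. \<integral>x. (LBINT s=ereal (finf x)..ereal (fbar t x). p x s) \<partial>\<nu>)
    (\<lambda>t. - dissipation ?J \<Phi> d\<Phi> (w t)) (einterval 0 T)"
  proof (rule has_distr_deriv_entropy[where f = fbar and w = w and p = p and \<Phi> = \<Phi> and \<theta> = d\<Phi>,
      OF T sf Jsets marg' measurable_fbar _ _ _ pm mono_p finf p0 _ \<Phi>m])
    show "integrable \<nu> (fbar t)" if "0 < t" "ereal t < T" for t
      using weak(1)[of t] that by (simp add: fbar_eq)
    show "integrable (lborel \<Otimes>\<^sub>M ?J) (\<lambda>z. indicator {a..b} (fst z) * (w (fst z) (fst (snd z)) - w (fst z) (snd (snd z))))"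
      if "0 < a" "a \<le> b" "ereal b < T" for a b
      using that by (intro integrable_Icc_diff weak(2,3)) auto
    show "(\<integral>x. indicator A x * fbar t x \<partial>\<nu>) - (\<integral>x. indicator A x * fbar s x \<partial>\<nu>)
      = (\<integral>z. indicator A (snd (snd z)) * (indicator {s..t} (fst z) * (w (fst z) (fst (snd z)) - w (fst z) (snd (snd z)))) \<partial>(lborel \<Otimes>\<^sub>M ?J))"
      if "0 < s" "s \<le> t" "ereal t < T" "A \<in> sets \<nu>" for s t A
      using weak(4)[of s t A] that le_less_trans[of "ereal s" "ereal t" T] by (simp add: fbar_eq)
    show "integrable \<nu> (\<lambda>x. LBINT s=ereal (finf x)..ereal (fbar t x). p x s)" if "0 < t" "ereal t < T" for t
      using Hi that pH[OF that] by (simp cong: Bochner_Integration.integrable_cong)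
    show "dissipation_converges T ?J \<Phi> d\<Phi> w"
      using conv[folded \<rho>_def] spJ by (rule dissipation_converges_cong) (simp add: w_eq)
  qed (simp add: p_def w_def)
  then show "has_distr_deriv (\<lambda>t. H_functional \<nu> \<sigma> d\<Phi> finf (f t))
      (\<lambda>t. - dissipation (kernel_prod (density \<nu> (\<lambda>x. ennreal (\<sigma> (finf x)))) K) \<Phi> d\<Phi> (\<lambda>x. \<sigma> (f t x) / \<sigma> (finf x)))
      (einterval 0 T)"
    unfolding \<rho>_def[symmetric]
  proof (rule has_distr_deriv_cong)
    fix t assume t: "t \<in> einterval 0 T"
    then have t': "0 < t" "ereal t < T" by (auto simp: einterval_iff)
    show "(\<integral>x. (LBINT s=ereal (finf x)..ereal (fbar t x). p x s) \<partial>\<nu>) = H_functional \<nu> \<sigma> d\<Phi> finf (f t)"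
      unfolding H_functional_def by (intro Bochner_Integration.integral_cong pH t' refl)
    show "- dissipation ?J \<Phi> d\<Phi> (w t) = - dissipation ?J \<Phi> d\<Phi> (\<lambda>x. \<sigma> (f t x) / \<sigma> (finf x))"
      using dissipation_cong[OF spJ, of "w t" "\<lambda>x. \<sigma> (f t x) / \<sigma> (finf x)" \<Phi> d\<Phi>] w_eq[of t] t' by simp
  qed
  show "\<forall>t\<in>einterval 0 T. - dissipation (kernel_prod (density \<nu> (\<lambda>x. ennreal (\<sigma> (finf x)))) K) \<Phi> d\<Phi>
      (\<lambda>x. \<sigma> (f t x) / \<sigma> (finf x)) \<le> 0"
    unfolding \<rho>_def[symmetric]
  proof
    fix t assume "t \<in> einterval 0 T"
    then have t': "0 \<le> t" "ereal t < T" by (auto simp: einterval_iff)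
    have "\<sigma> (f t x) / \<sigma> (finf x) \<in> {0..}" if "x \<in> space \<nu>" for x
      using w_nonneg[of t x] w_eq[OF t' that] by simp
    then show "- dissipation ?J \<Phi> d\<Phi> (\<lambda>x. \<sigma> (f t x) / \<sigma> (finf x)) \<le> 0"
      using dissipation_nonneg[OF C2 S nn' spJ, of "\<lambda>x. \<sigma> (f t x) / \<sigma> (finf x)"] by simp
  qed
qed

text \<open>The reference measure is now \<open>\<nu>\<close>, with respect to which the equation
  has the density \<sigma>(f) rather than g. Stationarity gives the same weak expression the value 0
  for \<open>c\<close>, so \<open>c\<close> can be subtracted; it also provides the weighted rate
  behind sigma-finiteness of the pair measure.\<close>

lemma reversible_entropy_law:
  assumes rev: "reversible K \<nu>"
    and C2: "C2_on UNIV \<Psi> d\<Psi> dd\<Psi>" and d0: "d\<Psi> 0 = 0" and nn: "\<forall>r. dd\<Psi> r \<ge> 0"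
    and Ni: "\<forall>t. 0 < t \<and> ereal t < T \<longrightarrow> integrable \<nu> (N_density \<sigma> d\<Psi> finf (f t))"
    and conv: "dissipation_converges T (kernel_prod \<nu> K) \<Psi> d\<Psi> (\<lambda>t x. \<sigma> (f t x) - \<sigma> (finf x))"
  shows "has_distr_deriv (\<lambda>t. N_functional \<nu> \<sigma> d\<Psi> finf (f t))
      (\<lambda>t. - dissipation (kernel_prod \<nu> K) \<Psi> d\<Psi> (\<lambda>x. \<sigma> (f t x) - \<sigma> (finf x))) (einterval 0 T)"
    and "\<forall>t\<in>einterval 0 T. - dissipation (kernel_prod \<nu> K) \<Psi> d\<Psi> (\<lambda>x. \<sigma> (f t x) - \<sigma> (finf x)) \<le> 0"
proof -
  let ?J = "kernel_prod \<nu> K"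
  let ?M = "(lborel :: real measure) \<Otimes>\<^sub>M ?J"
  note fin = finite_rate
  have sf: "sigma_finite_measure ?J"
    by (rule sigma_finite_kernel_prod[OF K _ _ rate_c]) (use c_pos in auto)
  have marg: "distr ?J \<nu> fst = distr ?J \<nu> snd" by (rule reversible_marginals[OF rev])
  have Jsets: "sets ?J = sets (\<nu> \<Otimes>\<^sub>M \<nu>)" by (rule sets_kernel_prod)
  have spJ: "space ?J = space \<nu> \<times> space \<nu>" by (rule space_kernel_prod)
  define v where "v t x = sig (fbar t x)" for t x
  have v_nonneg: "0 \<le> v t x" for t x by (simp add: v_def sig_nonneg)
  have vm[measurable]: "(\<lambda>(t, x). v t x) \<in> borel_measurable (borel \<Otimes>\<^sub>M \<nu>)"
    unfolding v_def by measurable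
  note weak = scattering_weak_form[OF \<nu> K fin refl sf marg vm v_nonneg density_sig[folded v_def] sol]
  define w where "w t x = v t x - c x" for t x
  have w_eq: "w t x = \<sigma> (f t x) - \<sigma> (finf x)" if "0 \<le> t" "ereal t < T" "x \<in> space \<nu>" for t x
    using that by (simp add: w_def v_def c_eq fbar_eq sig_eq f_nonneg)
  have ic: "integrable ?J (\<lambda>z. c (fst z))" "integrable ?J (\<lambda>z. c (snd z))"
  proof -
    have "(\<integral>\<^sup>+z. ennreal (c (fst z)) \<partial>?J) < \<infinity>"
      using stat total_rate_density[OF K fin, of "\<lambda>x. ennreal (c x)"] by (simp add: stationary_def density_c)
    moreover from this have "(\<integral>\<^sup>+z. ennreal (c (snd z)) \<partial>?J) < \<infinity>"
      using nn_integral_snd_of_marginals[OF marg Jsets, of "\<lambda>x. ennreal (c x)"] by simp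
    ultimately show "integrable ?J (\<lambda>z. c (fst z))" "integrable ?J (\<lambda>z. c (snd z))"
      using c_nonneg by (auto intro!: integrableI_nonneg)
  qed
  \<comment> \<open>The weak form of stationarity, with the equality of marginals supplied by
    reversibility.\<close>
  have c0: "(\<integral>z. indicator A (snd z) * (c (fst z) - c (snd z)) \<partial>?J) = 0" if A: "A \<in> sets \<nu>" for A
    using scattering_density[OF K fin marg measurable_c c_nonneg ic A] stat A
    by (simp add: stationary_def density_c)
  have Vv: "integrable ?M (\<lambda>z. indicator {a..b} (fst z) * (v (fst z) (fst (snd z)) - v (fst z) (snd (snd z))))"
    if "0 < a" "ereal b < T" "a \<le> b" for a b
    using that by (intro integrable_Icc_diff weak(2,3)) auto
  have weq: "w \<tau> x - w \<tau> y = (v \<tau> x - v \<tau> y) - (c x - c y)" for \<tau> x y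
    by (simp add: w_def)
  define p where "p x r = d\<Psi> (sig r - c x)" for x r
  have S: "is_interval (UNIV :: real set)" by simp
  have nn': "\<forall>r\<in>UNIV. 0 \<le> dd\<Psi> r" using nn by simp
  have [measurable]: "d\<Psi> \<in> borel_measurable borel" "\<Psi> \<in> borel_measurable borel"
    using C2_on_continuous[OF C2] by (auto intro: borel_measurable_continuous_onI)
  have pm: "(\<lambda>(x, r). p x r) \<in> borel_measurable (\<nu> \<Otimes>\<^sub>M borel)"
    unfolding p_def by measurable
  have \<Psi>m: "(\<lambda>x. \<Psi> (w t x)) \<in> borel_measurable \<nu>" for t
    unfolding w_def v_def by measurable
  have mono_p: "mono (p x)" for x
    unfolding p_def using monoD[OF mono_sig]
    by (intro monoI C2_on_deriv_mono[OF C2 S nn']) auto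
  have p0: "AE x in \<nu>. p x (finf x) = 0"
    by (simp add: p_def d0 flip: c_def)
  have pN: "(LBINT s=ereal (finf x)..ereal (fbar t x). p x s) = N_density \<sigma> d\<Psi> finf (f t) x"
    if "0 < t" "ereal t < T" "x \<in> space \<nu>" for t x
    using interval_integral_sig[of t x "\<lambda>r. d\<Psi> (r - c x)"] that by (simp add: N_density_def p_def c_eq)
  have "has_distr_deriv (\<lambda>t. \<integral>x. (LBINT s=ereal (finf x)..ereal (fbar t x). p x s) \<partial>\<nu>)
    (\<lambda>t. - dissipation ?J \<Psi> d\<Psi> (w t)) (einterval 0 T)"
  proof (rule has_distr_deriv_entropy[where f = fbar and w = w and p = p and \<Phi> = \<Psi> and \<theta> = d\<Psi>,
      OF T sf Jsets marg measurable_fbar _ _ _ pm mono_p finf p0 _ \<Psi>m])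
    show "integrable \<nu> (fbar t)" if "0 < t" "ereal t < T" for t
      using weak(1)[of t] that by (simp add: fbar_eq)
    show "integrable ?M (\<lambda>z. indicator {a..b} (fst z) * (w (fst z) (fst (snd z)) - w (fst z) (snd (snd z))))"
      if "0 < a" "a \<le> b" "ereal b < T" for a b
      unfolding weq right_diff_distrib[of _ "v _ _ - v _ _"] using that
      by (intro Bochner_Integration.integrable_diff Vv
        integral_Icc_times(1)[OF sf, of "\<lambda>z. c (fst z) - c (snd z)"] ic) auto
    show "(\<integral>x. indicator A x * fbar t x \<partial>\<nu>) - (\<integral>x. indicator A x * fbar s x \<partial>\<nu>)
      = (\<integral>z. indicator A (snd (snd z)) * (indicator {s..t} (fst z) * (w (fst z) (fst (snd z)) - w (fst z) (snd (snd z)))) \<partial>?M)"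
      if st: "0 < s" "s \<le> t" "ereal t < T" and A: "A \<in> sets \<nu>" for s t A
    proof -
      note A[measurable]
      let ?D = "\<lambda>z. indicator {s..t} (fst z) * (v (fst z) (fst (snd z)) - v (fst z) (snd (snd z)))"
      let ?X = "\<lambda>z. indicator A (snd z) * (c (fst z) - c (snd z))"
      have iD: "integrable ?M (\<lambda>z. indicator A (snd (snd z)) * ?D z)"
        by (rule Bochner_Integration.integrable_bound[OF Vv[OF st(1,3,2)]]) (auto simp: indicator_def)
      have iX: "integrable ?J ?X"
        by (rule Bochner_Integration.integrable_bound[OF Bochner_Integration.integrable_diff[OF ic]]) (auto simp: indicator_def)
      have "(\<integral>x. indicator A x * fbar t x \<partial>\<nu>) - (\<integral>x. indicator A x * fbar s x \<partial>\<nu>) = (\<integral>z. indicator A (snd (snd z)) * ?D z \<partial>?M)"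
        using weak(4)[of s t A] st A le_less_trans[of "ereal s" "ereal t" T] by (simp add: fbar_eq)
      \<comment> \<open>The subtracted term is the length of \<open>[s, t]\<close> times the
        integral that vanishes by \<open>c0\<close>; it turns \<open>v\<close> into \<open>w\<close>
        under the integral.\<close>
      also have "\<dots> = (\<integral>z. indicator A (snd (snd z)) * ?D z \<partial>?M) - (\<integral>z. indicator {s..t} (fst z) * ?X (snd z) \<partial>?M)"
        by (subst integral_Icc_times(2)[OF sf iX]) (simp add: c0[OF A])
      also have "\<dots> = (\<integral>z. indicator A (snd (snd z)) * ?D z - indicator {s..t} (fst z) * ?X (snd z) \<partial>?M)"
        by (rule Bochner_Integration.integral_diff[OF iD integral_Icc_times(1)[OF sf iX], symmetric])
      also have "\<dots> = (\<integral>z. indicator A (snd (snd z)) * (indicator {s..t} (fst z) * (w (fst z) (fst (snd z)) - w (fst z) (snd (snd z)))) \<partial>?M)"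
        by (intro Bochner_Integration.integral_cong) (auto simp: weq indicator_def)
      finally show ?thesis .
    qed
    show "integrable \<nu> (\<lambda>x. LBINT s=ereal (finf x)..ereal (fbar t x). p x s)" if "0 < t" "ereal t < T" for t
      using Ni that pN[OF that] by (simp cong: Bochner_Integration.integrable_cong)
    show "dissipation_converges T ?J \<Psi> d\<Psi> w"
      using conv spJ by (rule dissipation_converges_cong) (simp add: w_eq)
  qed (simp add: p_def w_def v_def)
  then show "has_distr_deriv (\<lambda>t. N_functional \<nu> \<sigma> d\<Psi> finf (f t))
      (\<lambda>t. - dissipation ?J \<Psi> d\<Psi> (\<lambda>x. \<sigma> (f t x) - \<sigma> (finf x))) (einterval 0 T)"
  proof (rule has_distr_deriv_cong)
    fix t assume t: "t \<in> einterval 0 T"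
    then have t': "0 < t" "ereal t < T" by (auto simp: einterval_iff)
    show "(\<integral>x. (LBINT s=ereal (finf x)..ereal (fbar t x). p x s) \<partial>\<nu>) = N_functional \<nu> \<sigma> d\<Psi> finf (f t)"
      unfolding N_functional_def by (intro Bochner_Integration.integral_cong pN t' refl)
    show "- dissipation ?J \<Psi> d\<Psi> (w t) = - dissipation ?J \<Psi> d\<Psi> (\<lambda>x. \<sigma> (f t x) - \<sigma> (finf x))"
      using dissipation_cong[OF spJ, of "w t" "\<lambda>x. \<sigma> (f t x) - \<sigma> (finf x)" \<Psi> d\<Psi>] w_eq[of t] t' by simp
  qed
  show "\<forall>t\<in>einterval 0 T. - dissipation ?J \<Psi> d\<Psi> (\<lambda>x. \<sigma> (f t x) - \<sigma> (finf x)) \<le> 0"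
    using dissipation_nonneg[OF C2 S nn' spJ] by simp
qed

end

theorem proposition5p2:
  fixes \<nu> :: "'a measure"
    and K :: "'a \<Rightarrow> 'a measure"
    and \<sigma> :: "real \<Rightarrow> real"
    and finf f0 :: "'a \<Rightarrow> real"
    and f :: "real \<Rightarrow> 'a \<Rightarrow> real"
    and T :: ereal
  assumes "finite_measure \<nu>"
    and "measure_kernel \<nu> K"
    and "\<forall>r\<ge>0. \<sigma> r \<ge> 0"
    and "strict_mono_on {0..} \<sigma>"
    and "finf \<in> borel_measurable \<nu>"
    and "\<forall>x\<in>space \<nu>. 0 \<le> finf x"
    and "AE x in \<nu>. \<sigma> (finf x) > 0"
    and "stationary K (density \<nu> (\<lambda>x. ennreal (\<sigma> (finf x))))"
    and "0 < T"
    and "scattering_solution K \<nu> \<sigma> T f0 f"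
  shows
    "(\<forall>\<Phi> d\<Phi> dd\<Phi>.
        C2_on {0..} \<Phi> d\<Phi> dd\<Phi> \<and> (\<forall>r\<ge>0. \<Phi> r \<ge> 0) \<and> \<Phi> 1 = 0 \<and> d\<Phi> 1 = 0 \<and>
        (\<forall>r\<ge>0. dd\<Phi> r \<ge> 0) \<and>
        (\<forall>t. 0 < t \<and> ereal t < T \<longrightarrow> integrable \<nu> (H_density \<sigma> d\<Phi> finf (f t))) \<and>
        dissipation_converges T (kernel_prod (density \<nu> (\<lambda>x. ennreal (\<sigma> (finf x)))) K) \<Phi> d\<Phi>
          (\<lambda>t x. \<sigma> (f t x) / \<sigma> (finf x))
        \<longrightarrow>
        has_distr_deriv
          (\<lambda>t. H_functional \<nu> \<sigma> d\<Phi> finf (f t))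
          (\<lambda>t. - dissipation (kernel_prod (density \<nu> (\<lambda>x. ennreal (\<sigma> (finf x)))) K) \<Phi> d\<Phi>
                  (\<lambda>x. \<sigma> (f t x) / \<sigma> (finf x)))
          (einterval 0 T) \<and>
        (\<forall>t\<in>einterval 0 T.
          - dissipation (kernel_prod (density \<nu> (\<lambda>x. ennreal (\<sigma> (finf x)))) K) \<Phi> d\<Phi>
              (\<lambda>x. \<sigma> (f t x) / \<sigma> (finf x)) \<le> 0))
     \<and>
     (reversible K \<nu> \<longrightarrow>
      (\<forall>\<Psi> d\<Psi> dd\<Psi>.
        C2_on UNIV \<Psi> d\<Psi> dd\<Psi> \<and> (\<forall>r. \<Psi> r \<ge> 0) \<and> d\<Psi> 0 = 0 \<and> (\<forall>r. dd\<Psi> r \<ge> 0) \<and>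
        (\<forall>t. 0 < t \<and> ereal t < T \<longrightarrow> integrable \<nu> (N_density \<sigma> d\<Psi> finf (f t))) \<and>
        dissipation_converges T (kernel_prod \<nu> K) \<Psi> d\<Psi>
          (\<lambda>t x. \<sigma> (f t x) - \<sigma> (finf x))
        \<longrightarrow>
        has_distr_deriv
          (\<lambda>t. N_functional \<nu> \<sigma> d\<Psi> finf (f t))
          (\<lambda>t. - dissipation (kernel_prod \<nu> K) \<Psi> d\<Psi> (\<lambda>x. \<sigma> (f t x) - \<sigma> (finf x)))
          (einterval 0 T) \<and>
        (\<forall>t\<in>einterval 0 T.
          - dissipation (kernel_prod \<nu> K) \<Psi> d\<Psi> (\<lambda>x. \<sigma> (f t x) - \<sigma> (finf x)) \<le> 0)))"
proof -
  interpret nonlinear_scattering \<nu> K \<sigma> finf f0 f T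
    using assms by (intro nonlinear_scattering.intro)
  show ?thesis
    by (intro conjI impI allI; elim conjE;
        (rule relative_entropy_law reversible_entropy_law; assumption))
qed

end
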